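(* Let $G=\ast_{j\in J} A_j$ be a free product of nontrivial groups and let $n$ be a positive integer. Then $$k(G,n) = \left\lfloor \frac{n}{2}\right\rfloor - \left\lfloor \frac{n}{N(G)}\right\rfloor + 1.$$
   Context: For a group $G$ with a fixed free-product decomposition $G=\ast_{j\in J} A_j$, let $\hat G$ be the set of elements of $G$ not conjugate to elements of any free factor $A_j$. The commutator length $\mathrm{cl}(h)$ of $h\in[G,G]$ is the minimal $k$ such that $h$ is a product of $k$ commutators, where $[x,y]=x^{-1}y^{-1}xy$. Define $k(G,n)$ as the minimal number $k$ such that some element $g^n\in\hat G$ (with $g\in G$) can be written as a product of $k$ commutators. $N(G)$ denotes the minimal order of a nonidentity element of $G$. If $N(G)=\infty$, the term $\lfloor n/N(G)\rfloor$ is interpreted as $0$. $\lfloor x\rfloor$ denotes the integer part of $x$. *)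

theory Defs
  imports "HOL-Algebra.Algebra" "HOL-Library.Extended_Nat"
begin

definition list_prod :: "('a, 'b) monoid_scheme \<Rightarrow> 'a list \<Rightarrow> 'a" where
  "list_prod G xs = foldr (\<lambda>x y. x \<otimes>\<^bsub>G\<^esub> y) xs \<one>\<^bsub>G\<^esub>"

text \<open>Internal free product decomposition G = *_{j in J} A_j of a group G into
  subgroups A_j: the A_j generate G and every nonempty reduced word
  (nontrivial letters, consecutive letters from different factors) is nontrivial.\<close>
definition is_free_product ::
  "('a, 'b) monoid_scheme \<Rightarrow> 'j set \<Rightarrow> ('j \<Rightarrow> 'a set) \<Rightarrow> bool" where
  "is_free_product G J A \<longleftrightarrow>
     group G \<and>
     (\<forall>j\<in>J. subgroup (A j) G) \<and>
     generate G (\<Union>j\<in>J. A j) = carrier G \<and>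
     (\<forall>w :: ('j \<times> 'a) list.
        w \<noteq> [] \<longrightarrow>
        (\<forall>p\<in>set w. fst p \<in> J \<and> snd p \<in> A (fst p) \<and> snd p \<noteq> \<one>\<^bsub>G\<^esub>) \<longrightarrow>
        (\<forall>i. Suc i < length w \<longrightarrow> fst (w ! i) \<noteq> fst (w ! Suc i)) \<longrightarrow>
        list_prod G (map snd w) \<noteq> \<one>\<^bsub>G\<^esub>)"

definition commutator :: "('a, 'b) monoid_scheme \<Rightarrow> 'a \<Rightarrow> 'a \<Rightarrow> 'a" where
  "commutator G x y = inv\<^bsub>G\<^esub> x \<otimes>\<^bsub>G\<^esub> inv\<^bsub>G\<^esub> y \<otimes>\<^bsub>G\<^esub> x \<otimes>\<^bsub>G\<^esub> y"

definition prod_of_commutators :: "('a, 'b) monoid_scheme \<Rightarrow> nat \<Rightarrow> 'a \<Rightarrow> bool" where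
  "prod_of_commutators G k h \<longleftrightarrow>
     (\<exists>xs ys. length xs = k \<and> length ys = k \<and>
        set xs \<subseteq> carrier G \<and> set ys \<subseteq> carrier G \<and>
        h = list_prod G (map2 (commutator G) xs ys))"

definition hatG :: "('a, 'b) monoid_scheme \<Rightarrow> 'j set \<Rightarrow> ('j \<Rightarrow> 'a set) \<Rightarrow> 'a set" where
  "hatG G J A = {g \<in> carrier G. \<not> (\<exists>j\<in>J. \<exists>x\<in>carrier G. \<exists>a\<in>A j.
                     g = inv\<^bsub>G\<^esub> x \<otimes>\<^bsub>G\<^esub> a \<otimes>\<^bsub>G\<^esub> x)}"

text \<open>The set of k such that some g^n in \<hat>G is a product of k commutators;
  k(G,n) is its least element.\<close>
definition kset :: "('a, 'b) monoid_scheme \<Rightarrow> 'j set \<Rightarrow> ('j \<Rightarrow> 'a set) \<Rightarrow> nat \<Rightarrow> nat set" where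
  "kset G J A n = {k. \<exists>g\<in>carrier G. g [^]\<^bsub>G\<^esub> n \<in> hatG G J A \<and>
                        prod_of_commutators G k (g [^]\<^bsub>G\<^esub> n)}"

text \<open>N(G): minimal order of a nonidentity element (\<infinity> if all such have infinite order;
  group.ord is 0 for elements of infinite order).\<close>
definition min_order :: "('a, 'b) monoid_scheme \<Rightarrow> enat" where
  "min_order G = Inf {enat (group.ord G x) | x.
       x \<in> carrier G \<and> x \<noteq> \<one>\<^bsub>G\<^esub> \<and> group.ord G x \<noteq> 0}"

definition floor_div_enat :: "nat \<Rightarrow> enat \<Rightarrow> nat" where
  "floor_div_enat n N = (case N of enat m \<Rightarrow> n div m | \<infinity> \<Rightarrow> 0)"

end

theory Submission
  imports Defs
begin

text \<open>
  Lower bound. Let \<open>g\<^sup>n\<close> be a product of \<open>k\<close> commutators. Grouping the factors into two, \<open>g\<close> may be taken to be a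
  cyclically reduced alternating word of length \<open>2L\<close>. Then \<open>g\<^sup>n\<close> bounds a surface of genus \<open>k\<close> that is cut by
  \<open>nL\<close> arcs into pieces lying over the two factors, so at least \<open>nL + 1 - 2k\<close> of the pieces are discs.
  The boundary of a piece is a cyclic sequence of letters of \<open>g\<close>; an arc makes it turn from letter \<open>i\<close> to letter \<open>j\<close> on
  one side and from \<open>j - 1\<close> to \<open>i + 1\<close> on the other. Exactly one of these two turns ascends, or none if \<open>j = 0\<close>, so there
  are \<open>n(L - 1)\<close> ascents. A disc without ascents reads \<open>x\<^sup>m = 1\<close> for one letter \<open>x\<close>, so \<open>m \<ge> N\<close>. Counting ascents, and weighting turns so
  that such discs at antipodal letters balance, gives at most \<open>n(L - 1) + 2\<lfloor>n/N\<rfloor>\<close> discs.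

  Upper bound. Let \<open>g = [a, b] = x y\<close> with \<open>x = a\<inverse>\<close>, \<open>y = b\<inverse> a b\<close> and \<open>a\<close> of order \<open>N\<close> in a factor. Interchanging a letter \<open>x\<close>
  with a letter \<open>y\<close> in \<open>(x y)\<^sup>n\<close> costs one commutator. For odd \<open>n = q N + s\<close>, after \<open>(n - 1)/2 - q\<close> suitable interchanges the word
  collapses, using \<open>x\<^sup>N = y\<^sup>N = 1\<close>, to a product of a conjugate of \<open>x\<^sup>s\<close> and a conjugate of \<open>y\<^sup>s\<close>, that is,
  to one more commutator.
\<close>

section \<open>Turns of cyclic sequences\<close>

text \<open>The weighted count of discs falls short by one. Let \<open>D\<close> be the number of
  trivial cycles, \<open>m i\<close> of them constant at letter \<open>i\<close>. For every
  \<open>r\<close> it gives \<open>N * (D + m r - m (r + L)) \<le> N * n * (L - 1) + 2 * n\<close>,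
  and \<open>(2 * n) div N\<close> may be \<open>2 * (n div N) + 1\<close>. If \<open>D\<close>
  attained this extra unit, \<open>m\<close> would agree at antipodal letters, so the number of
  constant trivial cycles would be even. This parity supplies one more of them, and the count of
  non-ascents then gives a contradiction.

  The lower estimate of \<open>D\<close> comes from
  \<open>1 - 2 * k \<le> V + D - 2 * n * L\<close>, and it needs \<open>V \<le> n * L\<close>, that
  is, vertices with a single even turn each. Crowded vertices are therefore split; a split gains a
  vertex and loses at most one disc.

  In the upper bound, even \<open>n\<close> is divided into two odd exponents: \<open>n - 1\<close>
  and \<open>1\<close>, or \<open>n - N\<close> and \<open>N\<close> if \<open>N\<close> divides
  \<open>n\<close>. For \<open>N = 2\<close> the element \<open>a\<close> inverts
  \<open>[a, b]\<close>, so that every even power of \<open>[a, b]\<close> is a single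
  commutator.\<close>

definition cyc_sum :: "('b \<Rightarrow> 'b \<Rightarrow> int) \<Rightarrow> 'b list \<Rightarrow> int" where
  "cyc_sum F c = (\<Sum>t<length c. F (c ! t) (c ! (Suc t mod length c)))"

text \<open>The turn from letter \<open>i\<close> to letter \<open>j\<close> of a cyclic word of length \<open>2 * L\<close> is glued to the turn from
  \<open>j - 1\<close> to \<open>i + 1\<close>. Both have the same axis of symmetry, and the flow along the axis through \<open>r\<close> gives them
  opposite signs.\<close>
definition flow :: "nat \<Rightarrow> int \<Rightarrow> nat \<Rightarrow> nat \<Rightarrow> int" where
  "flow L r i j =
     (if (int i + int j - 2 * r) mod (2 * int L) = 0
      then (if (int i - r) mod (2 * int L) < int L then 1 else -1) else 0)"

lemma cyc_sum_nonneg: "(\<And>i j. 0 \<le> F i j) \<Longrightarrow> 0 \<le> cyc_sum F c"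
  by (simp add: cyc_sum_def sum_nonneg)

lemma cyc_sum_add: "cyc_sum (\<lambda>i j. F i j + H i j) c = cyc_sum F c + cyc_sum H c"
  by (simp add: cyc_sum_def sum.distrib)

lemma cyc_sum_cmult: "cyc_sum (\<lambda>i j. k * F i j) c = k * cyc_sum F c"
  by (simp add: cyc_sum_def sum_distrib_left)

lemma cyclic_crossing:
  assumes "k > (0::nat)" "a < k" "S a" "b < k" "\<not> S b"
  shows "\<exists>t<k. S t \<and> \<not> S (Suc t mod k)"
proof (rule ccontr)
  assume "\<not> ?thesis"
  then have step: "S (Suc t mod k)" if "t < k" "S t" for t using that by blast
  have "S ((a + d) mod k)" for d
  proof (induction d)
    case 0 then show ?case using assms by simp
  next
    case (Suc d)
    have "S (Suc ((a + d) mod k) mod k)" using step[OF _ Suc] assms(1) by simp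
    then show ?case by (simp add: mod_Suc_eq)
  qed
  \<comment> \<open>The position \<open>b\<close> is reached from \<open>a\<close> after
    \<open>b + k - a\<close> steps; the summand \<open>k\<close> keeps the subtraction from being
    truncated.\<close>
  from this[of "b + k - a"] have "S b" using assms by simp
  with assms show False by simp
qed

lemma cyc_sum_ge_1:
  assumes "\<And>i j. 0 \<le> F i j" "t < length c" "1 \<le> F (c ! t) (c ! (Suc t mod length c))"
  shows "1 \<le> cyc_sum F c"
proof -
  have "F (c ! t) (c ! (Suc t mod length c)) \<le> cyc_sum F c"
    unfolding cyc_sum_def by (rule member_le_sum) (use assms in auto)
  with assms(3) show ?thesis by simp
qed

text \<open>The cycle must enter and leave its maximal value: the turn entering it ascends, the turn
  leaving it does not.\<close>

lemma nonconstant_cyclic_ascent: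
  fixes c :: "'b::linorder list"
  assumes "x \<in> set c" "y \<in> set c" "x \<noteq> y"
  shows "1 \<le> cyc_sum (\<lambda>i j. if i < j then 1 else 0) c"
    and "1 \<le> cyc_sum (\<lambda>i j. if i < j then 0 else 1) c"
proof -
  define m where "m = Max (set c)"
  have max: "z \<le> m" if "z \<in> set c" for z using that by (simp add: m_def)
  have "m \<in> set c" unfolding m_def using assms(1) by (intro Max_in) auto
  then obtain a where a: "a < length c" "c ! a = m" by (auto simp: in_set_conv_nth)
  obtain b where b: "b < length c" "c ! b \<noteq> m"
    using assms by (metis in_set_conv_nth)
  have pos: "length c > 0" using a by auto
  obtain t where t: "t < length c" "c ! t = m" "c ! (Suc t mod length c) \<noteq> m"
    using cyclic_crossing[OF pos a(1), of "\<lambda>t. c ! t = m" b] a b by auto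
  obtain s where s: "s < length c" "c ! s \<noteq> m" "c ! (Suc s mod length c) = m"
    using cyclic_crossing[OF pos b(1), of "\<lambda>t. c ! t \<noteq> m" a] a b by auto
  have "c ! (Suc t mod length c) < m"
    using t(3) max[of "c ! (Suc t mod length c)"] pos by fastforce
  then show "1 \<le> cyc_sum (\<lambda>i j. if i < j then 0 else 1) c"
    using t by (intro cyc_sum_ge_1[of _ t]) auto
  have "c ! s < m" using s(2) max[of "c ! s"] s(1) by fastforce
  then show "1 \<le> cyc_sum (\<lambda>i j. if i < j then 1 else 0) c"
    using s by (intro cyc_sum_ge_1[of _ s]) auto
qed

lemma flow_ge: "-1 \<le> flow L r i j" by (simp add: flow_def)

text \<open>The shift by one from \<open>j\<close> to \<open>j - 1\<close> in a partner turn
  replaces the reflection \<open>-x\<close> by \<open>-1 - x\<close>, which fixes no residue. This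
  is why the signs in \<open>flow_partner\<close> are opposite without exception.\<close>

lemma mod_double_neg:
  fixes x :: int
  assumes "0 < L"
  shows "(- 1 - x) mod (2 * L) < L \<longleftrightarrow> \<not> x mod (2 * L) < L"
proof -
  have b: "0 \<le> x mod (2 * L)" "x mod (2 * L) < 2 * L" using assms by auto
  have "(- 1 - x) mod (2 * L) = (2 * L - 1 - x mod (2 * L)) mod (2 * L)"
    by (metis mod_diff_right_eq minus_mod_self1 diff_diff_eq2 mod_diff_left_eq)
  also have "\<dots> = 2 * L - 1 - x mod (2 * L)" using b by (intro mod_pos_pos_trivial) auto
  finally show ?thesis by linarith
qed

text \<open>Two consecutive turns of flow \<open>-1\<close> must be constant turns at the antipode of \<open>r\<close>, so in a
  nonconstant cycle the turns of flow \<open>-1\<close> are outweighed by the others.\<close>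
lemma nonconstant_flow_ge:
  assumes L: "0 < L" and x: "x \<in> set c" "y \<in> set c" "x \<noteq> y" and bound: "\<forall>i\<in>set c. i < 2 * L"
  shows "2 \<le> cyc_sum (\<lambda>i j. 1 + flow L r i j) c"
proof -
  define k where "k = length c"
  define M where "M = 2 * int L"
  define nx where "nx t = Suc t mod k" for t
  define v where "v t = 1 + flow L r (c ! t) (c ! nx t)" for t
  have M: "M > 0" using L by (simp add: M_def)
  have k2: "k \<ge> 2"
  proof (rule ccontr)
    assume "\<not> k \<ge> 2"
    then have "c = [] \<or> (\<exists>z. c = [z])" by (cases c) (auto simp: k_def Suc_le_eq)
    with x show False by auto
  qed
  have v0: "0 \<le> v t" for t using flow_ge[of L r "c ! t" "c ! nx t"] by (simp add: v_def)
  have sumv: "cyc_sum (\<lambda>i j. 1 + flow L r i j) c = (\<Sum>t<k. v t)"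
    by (simp add: cyc_sum_def v_def nx_def k_def)
  have two: ?thesis if "s < k" "t < k" "s \<noteq> t" "v s \<ge> 1" "v t \<ge> 1" for s t
  proof -
    have "v s + v t = (\<Sum>i\<in>{s,t}. v i)" using that by simp
    also have "\<dots> \<le> (\<Sum>i<k. v i)" by (rule sum_mono2) (use that v0 in auto)
    finally show ?thesis using that sumv by linarith
  qed
  have one: ?thesis if "s < k" "v s \<ge> 2" for s
  proof -
    have "v s \<le> (\<Sum>i<k. v i)" by (rule member_le_sum) (use that v0 in auto)
    with that sumv show ?thesis by linarith
  qed
  have nxk: "nx t < k" for t using k2 by (simp add: nx_def)
  have lt: "c ! t < 2 * L" if "t < k" for t using bound that by (simp add: k_def)
  have res_eq: "i = j" if "i < 2 * L" "j < 2 * L" "(int i - int j) mod M = 0" for i j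
  proof -
    have "int i mod M = int j mod M" using that(3) by (simp add: mod_eq_dvd_iff dvd_eq_mod_eq_0)
    then show ?thesis using that M_def by simp
  qed
  have v_cases: "v t \<ge> 1 \<or> ((int (c!t) + int (c ! nx t) - 2 * r) mod M = 0 \<and> \<not> (int (c ! t) - r) mod M < int L)" for t
    by (auto simp: v_def flow_def M_def)
  \<comment> \<open>At the antipode of \<open>r\<close> a constant turn has flow -1 and may be
    repeated. If the cycle visits the antipode, the turns entering and leaving it are counted
    instead.\<close>
  show ?thesis
  proof (cases "\<exists>a<k. (int (c ! a) - r - int L) mod M = 0")
    case True
    from True obtain a where a: "a < k" "(int (c ! a) - r - int L) mod M = 0" by (elim exE conjE)
    define z where "z = c ! a"
    have zz: "(2 * int z - 2 * r) mod M = 0"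
    proof -
      have "M dvd int z - r - int L" using a(2) unfolding z_def mod_eq_0_iff_dvd .
      then obtain d where "int z - r - int L = M * d" by (rule dvdE)
      then have "2 * int z - 2 * r = 2 * (M * d) + M" unfolding M_def by linarith
      then show ?thesis by simp
    qed
    \<comment> \<open>A turn of nonzero flow joins letters with sum congruent to
      \<open>2 * r\<close>. Since \<open>2 * z\<close> is congruent to \<open>2 * r\<close>, a turn
      with exactly one end at \<open>z\<close> has flow 0.\<close>
    have no: "v t \<ge> 1" if "t < k" "(c ! t = z) \<noteq> (c ! nx t = z)" for t
    proof (rule ccontr)
      assume "\<not> v t \<ge> 1"
      with v_cases[of t] have e: "(int (c!t) + int (c ! nx t) - 2 * r) mod M = 0" by blast
      have zlt: "z < 2 * L" using a lt by (simp add: z_def)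
      from that(2) consider "c ! t = z" "c ! nx t \<noteq> z" | "c ! t \<noteq> z" "c ! nx t = z" by blast
      then show False
      proof cases
        case 1
        have "(int (c ! nx t) - int z) mod M = 0"
          using dvd_diff[OF e[unfolded mod_eq_0_iff_dvd] zz[unfolded mod_eq_0_iff_dvd]] 1
          by (simp add: mod_eq_0_iff_dvd algebra_simps)
        then show False using res_eq[OF lt[OF nxk] zlt] 1(2) by simp
      next
        case 2
        have "(int (c ! t) - int z) mod M = 0"
          using dvd_diff[OF e[unfolded mod_eq_0_iff_dvd] zz[unfolded mod_eq_0_iff_dvd]] 2
          by (simp add: mod_eq_0_iff_dvd algebra_simps)
        then show False using res_eq[OF lt[OF that(1)] zlt] 2(1) by simp
      qed
    qed
    obtain b where b: "b < k" "c ! b \<noteq> z" using x by (metis in_set_conv_nth k_def)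
    obtain t where t: "t < k" "c ! t = z" "c ! nx t \<noteq> z"
      using cyclic_crossing[of k a "\<lambda>t. c ! t = z" b] a b k2 by (auto simp: nx_def z_def)
    obtain s where s: "s < k" "c ! s \<noteq> z" "c ! nx s = z"
      using cyclic_crossing[of k b "\<lambda>t. c ! t \<noteq> z" a] a b k2 by (auto simp: nx_def z_def)
    show ?thesis using two[OF t(1) s(1)] no[OF t(1)] no[OF s(1)] t s by auto
  next
    case False
    \<comment> \<open>A turn of flow -1 starts in the negative half and, away from the antipode, is
      reflected into the positive half. So the next turn has flow at least 0, and flow 1 if it goes
      straight back.\<close>
    have key: "v (nx t) \<ge> 1 \<and> (c ! nx (nx t) = c ! t \<longrightarrow> v (nx t) \<ge> 2)" if t: "t < k" "v t < 1" for t
    proof -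
      have e: "(int (c!t) + int (c ! nx t) - 2 * r) mod M = 0" and h: "int L \<le> (int (c ! t) - r) mod M"
        using v_cases[of t] t by auto
      have nz: "(int (c ! t) - r) mod M \<noteq> int L"
      proof
        assume "(int (c ! t) - r) mod M = int L"
        then have "(int (c ! t) - r) mod M = int L mod M" using L by (simp add: M_def)
        then have "(int (c ! t) - r - int L) mod M = 0" by (simp add: mod_eq_dvd_iff dvd_eq_mod_eq_0)
        with t(1) have "\<exists>a<k. (int (c ! a) - r - int L) mod M = 0" by (intro exI conjI)
        with False show False by (rule notE)
      qed
      have ub: "(int (c ! t) - r) mod M < M" using M by simp
      have "(int (c ! nx t) - r) mod M = (- (int (c ! t) - r)) mod M"
        using e by (simp add: mod_eq_dvd_iff algebra_simps mod_eq_0_iff_dvd)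
      also have "\<dots> = M - (int (c ! t) - r) mod M"
        unfolding zmod_zminus1_eq_if using h L by auto
      finally have h': "(int (c ! nx t) - r) mod M < int L" using h nz by (simp add: M_def)
      have "v (nx t) \<ge> 1" using h' by (auto simp: v_def flow_def M_def)
      moreover have "v (nx t) \<ge> 2" if "c ! nx (nx t) = c ! t"
        using h' e that by (auto simp: v_def flow_def M_def add.commute)
      ultimately show ?thesis by simp
    qed
    show ?thesis
    proof (cases "\<exists>t<k. v t < 1")
      case False
      have "1 \<le> v t" if "t < k" for t
      proof (rule ccontr)
        assume "\<not> 1 \<le> v t"
        then have "\<exists>t<k. v t < 1" using that by (intro exI[of _ t] conjI) simp_all
        with False show False by (rule notE)
      qed
      then show ?thesis using two[of 0 1] k2 by simp
    next
      case True
      then obtain t where t: "t < k" "v t < 1" by (elim exE conjE)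
      \<comment> \<open>For \<open>k = 2\<close> the turn after one of flow -1 goes straight back
        and contributes 2. For \<open>k \<ge> 3\<close> the turns before and after it are distinct,
        and each contributes at least 1.\<close>
      show ?thesis
      proof (cases "k = 2")
        case True
        then have "nx (nx t) = t" using t by (auto simp: nx_def mod_Suc)
        then show ?thesis using key[OF t] one[OF nxk, of t] by simp
      next
        case False
        define s where "s = (t + k - 1) mod k"
        have s: "s < k" "nx s = t" using k2 t by (auto simp: s_def nx_def mod_Suc_eq)
        have "v s \<ge> 1" using key[of s] s t by force
        moreover have "s \<noteq> nx t"
        proof
          assume "s = nx t"
          then have "(t + 2) mod k = t mod k" using s t by (simp add: nx_def mod_Suc_eq)
          then have "k dvd 2" by (metis mod_eq_dvd_iff_nat le_add1 add_diff_cancel_left')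
          then show False using False k2 by (auto dest: dvd_imp_le)
        qed
        ultimately show ?thesis using two[OF s(1) nxk] key[OF t] by simp
      qed
    qed
  qed
qed


section \<open>Counting the trivial cycles of a successor permutation\<close>

lemma size_filter_mset_sum:
  "int (size (filter_mset P C)) = (\<Sum>c\<in>#C. if P c then 1 else 0)"
  by (induction C) auto

lemma size_filter_partition:
  assumes "finite I" "\<And>c. c \<in># C \<Longrightarrow> P c \<longleftrightarrow> (\<exists>!i. i \<in> I \<and> R i c)"
    "\<And>c. c \<in># C \<Longrightarrow> \<not> P c \<Longrightarrow> \<forall>i\<in>I. \<not> R i c"
  shows "size (filter_mset P C) = (\<Sum>i\<in>I. size (filter_mset (R i) C))"
  using assms(2,3)
proof (induction C)
  case (add c C)
  have "(if P c then 1 else 0) = (\<Sum>i\<in>I. if R i c then 1 else (0::nat))"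
  proof (cases "P c")
    case True
    with add.prems(1)[of c] obtain i where i: "i \<in> I" "R i c" "\<And>j. j \<in> I \<Longrightarrow> R j c \<Longrightarrow> j = i" by auto
    have "(\<Sum>i\<in>I. if R i c then 1 else (0::nat)) = (\<Sum>j\<in>I. if i = j then 1 else 0)"
      by (rule sum.cong[OF refl]) (metis i(2,3))
    then show ?thesis using True i(1) assms(1) by simp
  next
    case False
    with add.prems(2)[of c] show ?thesis by simp
  qed
  moreover have "size (filter_mset P C) = (\<Sum>i\<in>I. size (filter_mset (R i) C))"
    using add.prems by (intro add.IH) auto
  moreover have "size (filter_mset Q (add_mset c C)) = (if Q c then 1 else 0) + size (filter_mset Q C)" for Q
    by simp
  ultimately show ?case by (simp add: sum.distrib)
qed simp


text \<open>The sum of the two letters is unchanged, so both turns lie on the same axis. On it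
  \<open>j - 1 - r\<close> is congruent to \<open>-1 - (i - r)\<close>, which lies in the other
  half.\<close>

lemma flow_partner:
  assumes "0 < L"
  shows "flow L r ((j + 2 * L - 1) mod (2 * L)) (Suc i) = - flow L r i j"
proof -
  define M where "M = 2 * int L"
  have M: "0 < M" using assms by (simp add: M_def)
  have jm: "int ((j + 2 * L - 1) mod (2 * L)) = (int j - 1) mod M"
  proof -
    have "int ((j + 2 * L - 1) mod (2 * L)) = (int j - 1 + M) mod M"
      using assms by (simp add: M_def zmod_int of_nat_diff algebra_simps)
    then show ?thesis by simp
  qed
  have sum: "((int j - 1) mod M + int (Suc i) - 2 * r) mod M = (int i + int j - 2 * r) mod M"
  proof -
    have "((int j - 1) mod M + int (Suc i) - 2 * r) mod M = (int j - 1 + (int (Suc i) - 2 * r)) mod M"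
      by (metis add_diff_eq mod_add_left_eq)
    then show ?thesis by (simp add: algebra_simps)
  qed
  have half: "((int j - 1) mod M - r) mod M < int L \<longleftrightarrow> \<not> (int i - r) mod M < int L"
    if "(int i + int j - 2 * r) mod M = 0"
  proof -
    have "((int j - 1) mod M - r) mod M = (int j - 1 - r) mod M" by (simp add: mod_diff_left_eq)
    also have "\<dots> = (- 1 - (int i - r)) mod M"
      using that by (simp add: mod_eq_dvd_iff algebra_simps mod_eq_0_iff_dvd)
    finally show ?thesis using mod_double_neg[of "int L" "int i - r"] assms by (simp add: M_def)
  qed
  show ?thesis unfolding flow_def jm M_def[symmetric] sum using half by simp
qed

text \<open>A constant turn lies on the axis if \<open>2 * i\<close> is congruent to
  \<open>2 * r\<close> modulo \<open>2 * L\<close>, that is, at \<open>r\<close> and at its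
  antipode. Hence constant cycles at these two letters enter the weighted count with opposite
  signs.\<close>

lemma flow_diagonal:
  assumes "i < 2 * L" "r < 2 * L"
  shows "flow L (int r) i i = (if i = r then 1 else if i = (r + L) mod (2 * L) then -1 else 0)"
proof -
  define M where "M = 2 * int L"
  have L: "0 < L" using assms by simp
  have M: "0 < M" using L by (simp add: M_def)
  have i: "int i mod M = int i" using assms by (simp add: M_def)
  have r: "int r mod M = int r" using assms by (simp add: M_def)
  consider "i = r" | "i \<noteq> r" "i = (r + L) mod (2 * L)" | "i \<noteq> r" "i \<noteq> (r + L) mod (2 * L)" by metis
  then show ?thesis
  proof cases
    case 1
    then show ?thesis using L by (simp add: flow_def)
  next
    case 2
    have "int i = (int r + int L) mod M" using 2 by (simp add: M_def zmod_int)
    then have e: "(int i - int r) mod M = int L"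
      using L by (simp add: mod_diff_left_eq M_def)
    have "(2 * (int i - int r)) mod M = (2 * int L) mod M" using e by (metis mod_mult_right_eq)
    then have "(int i + int i - 2 * int r) mod M = 0" by (simp add: M_def algebra_simps)
    then show ?thesis using 2 e L by (simp add: flow_def M_def)
  next
    case 3
    have "(int i + int i - 2 * int r) mod M \<noteq> 0"
    proof
      assume "(int i + int i - 2 * int r) mod M = 0"
      then have "2 * int L dvd 2 * (int i - int r)" by (simp add: M_def mod_eq_0_iff_dvd algebra_simps)
      then have "int L dvd int i - int r" by (simp only: dvd_mult_cancel_left) simp
      then obtain d where d: "int i - int r = int L * d" by (rule dvdE)
      have "- 2 < d" "d < 2"
      proof -
        have "int L * d < int L * 2" "int L * (- 2) < int L * d" using d assms by linarith+
        moreover have "0 < int L" using L by simp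
        ultimately show "- 2 < d" "d < 2" by (simp_all only: mult_less_cancel_left_pos)
      qed
      then consider "d = -1" | "d = 0" | "d = 1" by linarith
      then show False
      proof cases
        case 1
        then have "r + L = i + 2 * L" using d by simp
        then show False using 3 assms by (metis mod_add_self2 mod_less)
      next
        case 2
        then show False using d 3 by simp
      next
        case c: 3
        then have "r + L = i" using d by simp
        then show False using 3 assms by simp
      qed
    qed
    then show ?thesis using 3 by (simp add: flow_def M_def)
  qed
qed

lemma card_multiples_lessThan:
  assumes "0 < (m::nat)" shows "card {q. q < m * n \<and> q mod m = 0} = n"
proof -
  have "{q. q < m * n \<and> q mod m = 0} = (\<lambda>k. m * k) ` {..<n}"
    using assms by (auto simp: image_iff)
  moreover have "inj_on (\<lambda>k. m * k) {..<n}" using assms by (auto simp: inj_on_def)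
  ultimately show ?thesis by (simp add: card_image)
qed


text \<open>What remains of the surface is the permutation \<open>\<phi>\<close>, sending a position
  to the next one on its cycle. The premise \<open>pair\<close> expresses the gluing of an even turn
  to an odd one, \<open>triv\<close> may be any predicate, and group orders enter only through
  \<open>mono\<close>.\<close>

theorem trivial_cycle_count:
  fixes L n N l :: nat and C :: "nat list multiset" and \<phi> :: "nat \<Rightarrow> nat"
  assumes l_def: "l = 2 * L * n" and L: "0 < L" and N: "3 \<le> N" and n: "0 < n"
    and tot: "\<And>F. (\<Sum>c\<in>#C. cyc_sum F c) = (\<Sum>p<l. F p (\<phi> p))"
    and bij: "bij_betw \<phi> {..<l} {..<l}"
    and par: "\<And>p. p < l \<Longrightarrow> even (\<phi> p) = even p"
    and pair: "\<And>p. p < l \<Longrightarrow> even p \<Longrightarrow> \<phi> ((\<phi> p + l - 1) mod l) = Suc p"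
    and ne: "\<And>c. c \<in># C \<Longrightarrow> c \<noteq> []"
    and mono: "\<And>c i. c \<in># C \<Longrightarrow> triv c \<Longrightarrow> \<forall>p\<in>set c. p mod (2 * L) = i \<Longrightarrow> N \<le> length c"
  shows "size (filter_mset triv C) \<le> n * (L - 1) + 2 * (n div N)"
proof -
  define M where "M = 2 * L"
  have M: "0 < M" "even M" using L by (simp_all add: M_def)
  have lM: "l = M * n" by (simp add: l_def M_def)
  have evl: "even l" and l0: "0 < l" using lM M n by simp_all
  define E where "E = {p. p < l \<and> even p}"
  define Od where "Od = {p. p < l \<and> odd p}"
  have fin: "finite E" "finite Od" by (auto simp: E_def Od_def)
  define \<rho> where "\<rho> p = (\<phi> p + l - 1) mod l" for p
  have split: "(\<Sum>p<l. h p) = (\<Sum>p\<in>E. h p) + (\<Sum>p\<in>Od. h p)" for h :: "nat \<Rightarrow> int"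
  proof -
    have "{..<l} = E \<union> Od" "E \<inter> Od = {}" by (auto simp: E_def Od_def)
    then show ?thesis using fin by (simp add: sum.union_disjoint)
  qed
  have phil: "\<phi> p < l" if "p < l" for p using bij that by (auto simp: bij_betw_def)
  have bij_Suc: "bij_betw Suc E Od"
  proof -
    have "Suc ` E = Od"
    proof (intro equalityI subsetI)
      fix q assume "q \<in> Suc ` E"
      then obtain p where "q = Suc p" "p < l" "even p" by (auto simp: E_def)
      moreover have "Suc p \<noteq> l" using evl \<open>even p\<close> by auto
      ultimately show "q \<in> Od" by (auto simp: Od_def)
    next
      fix q assume "q \<in> Od"
      then have "q = Suc (q - 1)" "q - 1 \<in> E" by (auto simp: E_def Od_def elim: oddE)
      then show "q \<in> Suc ` E" by blast
    qed
    then show ?thesis by (simp add: bij_betw_def)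
  qed
  have cEO: "card E = card Od" using bij_betw_same_card[OF bij_Suc] .
  have cE: "card E = L * n"
  proof -
    have "int l = int (card E) + int (card Od)" using split[of "\<lambda>_. 1"] by simp
    then have "int (2 * card E) = int (2 * (L * n))" using cEO by (simp add: l_def)
    then show ?thesis unfolding of_nat_eq_iff by simp
  qed
  have bij_rho: "bij_betw \<rho> E Od"
  proof -
    have inj: "inj_on \<rho> E"
    proof (rule inj_onI)
      fix p q assume "p \<in> E" "q \<in> E" "\<rho> p = \<rho> q"
      then show "p = q" using pair[of p] pair[of q] by (simp add: E_def \<rho>_def)
    qed
    have "\<rho> ` E \<subseteq> Od"
    proof
      fix q assume "q \<in> \<rho> ` E"
      then obtain p where p: "p < l" "even p" "q = \<rho> p" by (auto simp: E_def)
      have "odd (\<phi> p + l - 1)" using par[of p] p evl l0 by simp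
      then have "odd q" using p evl by (simp add: \<rho>_def dvd_mod_iff)
      then show "q \<in> Od" using p l0 by (simp add: Od_def \<rho>_def)
    qed
    then have "\<rho> ` E = Od" using card_subset_eq[OF fin(2)] cEO card_image[OF inj] by metis
    then show ?thesis using inj by (simp add: bij_betw_def)
  qed
  have bij_E: "bij_betw \<phi> E E"
  proof -
    have inj: "inj_on \<phi> E" using bij by (auto simp: bij_betw_def E_def inj_on_def)
    have "\<phi> ` E \<subseteq> E" using phil par by (auto simp: E_def)
    then have "\<phi> ` E = E" using card_subset_eq[OF fin(1)] card_image[OF inj] by metis
    then show ?thesis using inj by (simp add: bij_betw_def)
  qed
  define total where "total H = (\<Sum>p<l. H (p mod M) (\<phi> p mod M))" for H :: "nat \<Rightarrow> nat \<Rightarrow> int"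
  \<comment> \<open>The turns are summed in glued pairs: \<open>\<rho> p\<close> is the odd position
    whose turn is glued to the turn at the even position \<open>p\<close>.\<close>
  have total: "total H = (\<Sum>p\<in>E. H (p mod M) (\<phi> p mod M)
       + H ((\<phi> p mod M + M - 1) mod M) (Suc (p mod M)))" for H
  proof -
    have "(\<Sum>p\<in>Od. H (p mod M) (\<phi> p mod M)) = (\<Sum>p\<in>E. H (\<rho> p mod M) (\<phi> (\<rho> p) mod M))"
      by (rule sum.reindex_bij_betw[OF bij_rho, symmetric])
    also have "\<dots> = (\<Sum>p\<in>E. H ((\<phi> p mod M + M - 1) mod M) (Suc (p mod M)))"
    proof (rule sum.cong[OF refl])
      fix p assume p: "p \<in> E"
      have "\<rho> p mod M = (\<phi> p + l - 1) mod M" by (simp add: \<rho>_def lM mod_mod_cancel)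
      also have "\<phi> p + l - 1 = \<phi> p + (M - 1) + M * (n - 1)"
      proof -
        obtain k where "n = Suc k" using n by (cases n) auto
        then show ?thesis using M(1) by (simp add: lM)
      qed
      also have "\<dots> mod M = (\<phi> p mod M + (M - 1)) mod M" by (simp add: mod_add_left_eq)
      finally have 1: "\<rho> p mod M = (\<phi> p mod M + M - 1) mod M" using M by simp
      have "even (p mod M)" "p mod M < M" using p M by (auto simp: E_def dvd_mod_iff)
      then have "Suc (p mod M) \<noteq> M" using M by (metis even_Suc)
      then have "Suc p mod M = Suc (p mod M)" using M by (simp add: mod_Suc)
      then have "\<phi> (\<rho> p) mod M = Suc (p mod M)" using pair[of p] p by (simp add: E_def \<rho>_def)
      with 1 show "H (\<rho> p mod M) (\<phi> (\<rho> p) mod M) = H ((\<phi> p mod M + M - 1) mod M) (Suc (p mod M))" by simp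
    qed
    finally show ?thesis by (simp add: total_def split sum.distrib)
  qed
  define asc :: "nat \<Rightarrow> nat \<Rightarrow> int" where "asc i j = (if i < j then 1 else 0)" for i j
  have tot_flow: "total (flow L r) = 0" for r
    unfolding total using flow_partner[OF L] by (simp add: M_def)
  have tot_asc: "total asc = int (n * (L - 1))"
  proof -
    have "total asc = (\<Sum>p\<in>E. if \<phi> p mod M = 0 then 0 else 1)"
      unfolding total
    proof (rule sum.cong[OF refl])
      fix p assume p: "p \<in> E"
      define i j where "i = p mod M" and "j = \<phi> p mod M"
      have ij: "even i" "even j" "i < M" "j < M"
        using p M par[of p] by (auto simp: i_def j_def E_def dvd_mod_iff)
      have Si: "Suc i < M" using ij M by (metis Suc_lessI even_Suc)
      have "asc i j + asc ((j + M - 1) mod M) (Suc i) = (if j = 0 then 0 else 1)"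
      proof (cases "j = 0")
        case True
        then show ?thesis using Si by (simp add: asc_def)
      next
        case False
        then have "j + M - 1 = (j - 1) + M" by simp
        then have "(j + M - 1) mod M = j - 1" using ij(4) by (simp only: mod_add_self2) simp
        \<comment> \<open>Parity excludes \<open>j = i + 1\<close>, for which both turns of the pair
          would ascend.\<close>
        moreover have "i < j \<longleftrightarrow> \<not> j - 1 < Suc i"
        proof -
          have "j \<noteq> Suc i" using ij by auto
          then show ?thesis using False by linarith
        qed
        ultimately show ?thesis using False by (simp add: asc_def)
      qed
      then show "asc (p mod M) (\<phi> p mod M) + asc ((\<phi> p mod M + M - 1) mod M) (Suc (p mod M))
        = (if \<phi> p mod M = 0 then 0 else 1)" by (simp add: i_def j_def)
    qed
    also have "\<dots> = (\<Sum>q\<in>E. if q mod M = 0 then 0 else 1)"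
      by (rule sum.reindex_bij_betw[OF bij_E])
    also have "\<dots> = (\<Sum>q\<in>E. 1 - (if q mod M = 0 then 1 else 0))" by (rule sum.cong) auto
    also have "\<dots> = int (card E) - int (card {q \<in> E. q mod M = 0})"
      using fin by (simp add: sum_subtractf sum.If_cases Int_def)
    also have "{q \<in> E. q mod M = 0} = {q. q < M * n \<and> q mod M = 0}"
      using M by (auto simp: E_def lM elim: dvd_trans)
    also have "card \<dots> = n" using card_multiples_lessThan M by blast
    finally show ?thesis using cE L by (simp add: algebra_simps of_nat_diff)
  qed
  define res where "res c = map (\<lambda>p. p mod M) c" for c
  have cyc_res: "(\<Sum>c\<in>#C. cyc_sum H (res c)) = total H" for H
  proof -
    have "cyc_sum H (res c) = cyc_sum (\<lambda>p q. H (p mod M) (q mod M)) c" if "c \<in># C" for c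
      unfolding cyc_sum_def res_def using ne[OF that] by (intro sum.cong) auto
    then have "(\<Sum>c\<in>#C. cyc_sum H (res c)) = (\<Sum>c\<in>#C. cyc_sum (\<lambda>p q. H (p mod M) (q mod M)) c)"
      by (intro arg_cong[of _ _ sum_mset] image_mset_cong) auto
    then show ?thesis by (simp add: tot total_def)
  qed
  define pure where "pure i c \<longleftrightarrow> triv c \<and> (\<forall>p\<in>set c. p mod M = i)" for i c
  define mixed where "mixed c \<longleftrightarrow> triv c \<and> (\<forall>i. \<not> pure i c)" for c
  define mm where "mm i = size (filter_mset (pure i) C)" for i
  define D where "D = size (filter_mset triv C)"
  define Mx where "Mx = size (filter_mset mixed C)"
  define K where "K = (\<Sum>i<M. mm i)"
  have at_unique: "i = j" if "pure i c" "pure j c" "c \<in># C" for i j c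
    using that ne[of c] by (cases c) (auto simp: pure_def)
  have at_lt: "i < M" if "pure i c" "c \<in># C" for i c
    using that ne[of c] M by (cases c) (auto simp: pure_def)
  have K: "size (filter_mset (\<lambda>c. \<exists>i. pure i c) C) = K"
    unfolding K_def mm_def
  proof (rule size_filter_partition)
    fix c assume c: "c \<in># C"
    show "(\<exists>i. pure i c) \<longleftrightarrow> (\<exists>!i. i \<in> {..<M} \<and> pure i c)"
      using at_unique[OF _ _ c] at_lt[OF _ c] unfolding lessThan_iff by metis
  qed auto
  have DXK: "D = Mx + K"
  proof -
    have "D = size (filter_mset mixed (filter_mset triv C)) + size (filter_mset (\<lambda>c. \<not> mixed c) (filter_mset triv C))"
      unfolding D_def by (metis multiset_partition size_union)
    moreover have "filter_mset mixed (filter_mset triv C) = filter_mset mixed C"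
      by (auto simp: filter_filter_mset mixed_def intro: filter_mset_cong)
    moreover have "filter_mset (\<lambda>c. \<not> mixed c) (filter_mset triv C) = filter_mset (\<lambda>c. \<exists>i. pure i c) C"
      by (auto simp: filter_filter_mset mixed_def pure_def intro: filter_mset_cong)
    ultimately show ?thesis using K by (simp add: Mx_def)
  qed
  have len_at: "N \<le> length c" if "pure i c" "c \<in># C" for i c
    using mono[of c i] that by (simp add: pure_def M_def)
  have res_at: "res c ! t = i" if "pure i c" "t < length c" for i c t
    using that by (simp add: res_def pure_def)
  have cyc_at: "cyc_sum H (res c) = int (length c) * H i i" if "pure i c" for H i c
  proof -
    have "cyc_sum H (res c) = (\<Sum>t<length c. H i i)"
    proof -
      have "length (res c) = length c" by (simp add: res_def)
      moreover have "Suc t mod length c < length c" if "t < length c" for t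
        using that by (intro mod_less_divisor) linarith
      ultimately show ?thesis unfolding cyc_sum_def
        using res_at[OF that] by (intro sum.cong) simp_all
    qed
    then show ?thesis by simp
  qed
  have mixed_res: "\<exists>x\<in>set (res c). \<exists>y\<in>set (res c). x \<noteq> y" if mc: "mixed c" "c \<in># C" for c
  proof -
    obtain p where p: "p \<in> set c" using ne[OF mc(2)] by (cases c) auto
    have "\<not> pure (p mod M) c" "triv c" using mc by (auto simp: mixed_def)
    then obtain q where "q \<in> set c" "q mod M \<noteq> p mod M" by (auto simp: pure_def)
    with p show ?thesis by (force simp: res_def)
  qed
  have asc0: "0 \<le> asc i j" "0 \<le> 1 - asc i j" for i j by (simp_all add: asc_def)
  have mixed_asc: "1 \<le> cyc_sum asc (res c)" "1 \<le> cyc_sum (\<lambda>i j. 1 - asc i j) (res c)"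
    if mc: "mixed c" "c \<in># C" for c
  proof -
    obtain x y where xy: "x \<in> set (res c)" "y \<in> set (res c)" "x \<noteq> y" using mixed_res[OF mc] by blast
    show "1 \<le> cyc_sum asc (res c)" using nonconstant_cyclic_ascent(1)[OF xy] by (simp add: asc_def[abs_def])
    have "(\<lambda>i j. 1 - asc i j) = (\<lambda>i j. if i < j then 0 else 1)" by (auto simp: asc_def fun_eq_iff)
    then show "1 \<le> cyc_sum (\<lambda>i j. 1 - asc i j) (res c)" using nonconstant_cyclic_ascent(2)[OF xy] by simp
  qed
  have XA: "Mx \<le> n * (L - 1)"
  proof -
    have "int Mx = (\<Sum>c\<in>#C. if mixed c then 1 else 0)" by (simp add: Mx_def size_filter_mset_sum)
    also have "\<dots> \<le> (\<Sum>c\<in>#C. cyc_sum asc (res c))"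
      by (rule sum_mset_mono) (use mixed_asc(1) cyc_sum_nonneg[of asc] asc0 in auto)
    finally have "int Mx \<le> int (n * (L - 1))" by (simp only: cyc_res tot_asc)
    then show ?thesis by (simp only: of_nat_le_iff)
  qed
  \<comment> \<open>Non-ascents are counted here: a constant trivial cycle has at least
    \<open>N\<close> of them, a nonconstant one at least one.\<close>
  have NB: "int N * int K + int Mx \<le> int l - int (n * (L - 1))"
  proof -
    have "int N * int K + int Mx = (\<Sum>c\<in>#C. int N * (if \<exists>i. pure i c then 1 else 0) + (if mixed c then 1 else 0))"
      by (simp only: K[symmetric] Mx_def size_filter_mset_sum sum_mset.distrib sum_mset_distrib_left)
    also have "\<dots> \<le> (\<Sum>c\<in>#C. cyc_sum (\<lambda>i j. 1 - asc i j) (res c))"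
    proof (rule sum_mset_mono)
      fix c assume c: "c \<in># C"
      show "int N * (if \<exists>i. pure i c then 1 else 0) + (if mixed c then 1 else 0) \<le> cyc_sum (\<lambda>i j. 1 - asc i j) (res c)"
      proof (cases "\<exists>i. pure i c")
        case True
        then obtain i where i: "pure i c" by blast
        then have "\<not> mixed c" by (auto simp: mixed_def)
        then show ?thesis using True cyc_at[OF i, of "\<lambda>i j. 1 - asc i j"] len_at[OF i c] by (simp add: asc_def)
      next
        case False
        then show ?thesis using mixed_asc(2)[OF _ c] cyc_sum_nonneg[of "\<lambda>i j. 1 - asc i j"] asc0 by simp
      qed
    qed
    also have "\<dots> = total (\<lambda>i j. 1 - asc i j)" by (rule cyc_res)
    also have "\<dots> = int l - total asc" by (simp add: total_def sum_subtractf)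
    finally show ?thesis by (simp add: tot_asc)
  qed
  have le_anti: "int N * (int D + int (mm r) - int (mm ((r + L) mod M))) \<le> int N * int (n * (L - 1)) + 2 * int n"
    if r: "r < M" for r
  proof -
    define r' where "r' = (r + L) mod M"
    have rr: "r' \<noteq> r"
    proof
      assume "r' = r"
      then have "(r + L) mod M = r mod M" using r by (simp add: r'_def)
      then have "M dvd L" using mod_eq_dvd_iff_nat[of r "r + L" M] by simp
      then show False using L by (auto simp: M_def dest: dvd_imp_le)
    qed
    \<comment> \<open>Partners balance, so the total of \<open>W\<close> is \<open>N * n * (L - 1) + 2 * n\<close>, while every trivial cycle has weight at
      least \<open>N\<close>, except for the constant ones at \<open>r\<close> (\<open>2 * N\<close>) and at its antipode (\<open>0\<close>).\<close>
    define W where "W i j = (int N - 2) * asc i j + (1 + flow L (int r) i j)" for i j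
    have W_split: "cyc_sum W c = (int N - 2) * cyc_sum asc c + cyc_sum (\<lambda>i j. 1 + flow L (int r) i j) c" for c
      by (simp add: W_def[abs_def] cyc_sum_add cyc_sum_cmult)
    have Wpos: "0 \<le> W i j" for i j using N asc0(1)[of i j] flow_ge[of L "int r" i j] by (simp add: W_def)
    have "int N * (int D + int (mm r) - int (mm r'))
      = (\<Sum>c\<in>#C. int N * ((if triv c then 1 else 0) + (if pure r c then 1 else 0) - (if pure r' c then 1 else 0)))"
      unfolding D_def mm_def size_filter_mset_sum sum_mset_distrib_left[symmetric]
      by (induction C) (auto simp: algebra_simps)
    also have "\<dots> \<le> (\<Sum>c\<in>#C. cyc_sum W (res c))"
    proof (rule sum_mset_mono)
      fix c assume c: "c \<in># C"
      show "int N * ((if triv c then 1 else 0) + (if pure r c then 1 else 0) - (if pure r' c then 1 else 0)) \<le> cyc_sum W (res c)"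
      proof (cases "triv c")
        case False
        then show ?thesis using cyc_sum_nonneg[of W "res c"] Wpos by (simp add: pure_def)
      next
        case True
        show ?thesis
        proof (cases "mixed c")
          case mc: True
          obtain x y where xy: "x \<in> set (res c)" "y \<in> set (res c)" "x \<noteq> y" using mixed_res[OF mc c] by blast
          have "2 \<le> cyc_sum (\<lambda>i j. 1 + flow L (int r) i j) (res c)"
            by (rule nonconstant_flow_ge[OF L xy]) (use M in \<open>auto simp: res_def M_def\<close>)
          moreover have "(int N - 2) * 1 \<le> (int N - 2) * cyc_sum asc (res c)"
            using mixed_asc(1)[OF mc c] N by (intro mult_left_mono) auto
          ultimately have "int N \<le> cyc_sum W (res c)" by (simp add: W_split)
          moreover have "\<not> pure r c" "\<not> pure r' c" using mc by (auto simp: mixed_def)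
          ultimately show ?thesis using True by simp
        next
          case False
          then obtain i where i: "pure i c" using True by (auto simp: mixed_def)
          have iM: "i < M" using at_lt[OF i c] .
          have Wi: "cyc_sum W (res c) = int (length c) * (1 + flow L (int r) i i)"
            by (simp add: cyc_at[OF i] W_def asc_def)
          have at_iff: "pure j c \<longleftrightarrow> j = i" for j using at_unique[OF _ i c] i by blast
          have len: "int N \<le> int (length c)" using len_at[OF i c] by simp
          show ?thesis
            unfolding Wi at_iff using flow_diagonal[of i L r] iM r rr len True
            by (auto simp: M_def r'_def)
        qed
      qed
    qed
    also have "\<dots> = total W" by (rule cyc_res)
    also have "\<dots> = (int N - 2) * total asc + int l + total (flow L (int r))"
      by (simp add: total_def W_def sum.distrib sum_distrib_left)
    also have "\<dots> = int N * int (n * (L - 1)) + 2 * int n"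
      using L by (simp add: tot_asc tot_flow l_def algebra_simps of_nat_diff)
    finally show ?thesis by (simp add: r'_def)
  qed
  show ?thesis
  proof (rule ccontr)
    assume "\<not> ?thesis"
    then have big: "n * (L - 1) + 2 * (n div N) + 1 \<le> D" by (simp add: D_def)
    define q where "q = n div N"
    define R where "R = n * (L - 1)"
    have bigR: "int R + 2 * int q + 1 \<le> int D"
    proof -
      have "int (R + 2 * q + 1) \<le> int D" using big by (simp only: of_nat_le_iff R_def q_def)
      then show ?thesis by simp
    qed
    have R: "int R = int n * int L - int n" using L by (simp add: R_def of_nat_diff right_diff_distrib)
    have nq: "n + 1 \<le> N * (q + 1)" using N by (simp add: q_def dividend_less_times_div Suc_leI)
    \<comment> \<open>Since \<open>2 * n < N * (2 * q + 2)\<close>, a surplus of \<open>mm r\<close>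
      over the antipode on top of the extra unit in \<open>D\<close> would violate
      \<open>le_anti\<close>.\<close>
    have m_le: "mm r \<le> mm ((r + L) mod M)" if "r < M" for r
    proof (rule ccontr)
      assume "\<not> ?thesis"
      then have "int R + 2 * int q + 2 \<le> int D + int (mm r) - int (mm ((r + L) mod M))"
        using bigR by linarith
      then have "int N * (int R + 2 * int q + 2) \<le> int N * (int D + int (mm r) - int (mm ((r + L) mod M)))"
        by (intro mult_left_mono) auto
      also note le_anti[OF that]
      finally have "int N * (2 * int q + 2) \<le> 2 * int n" by (simp add: R_def algebra_simps)
      moreover have "2 * int n + 2 \<le> int N * (2 * int q + 2)"
      proof -
        have "int (n + 1) \<le> int (N * (q + 1))" using nq by (rule of_nat_mono)
        then show ?thesis by (simp add: algebra_simps)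
      qed
      ultimately show False by linarith
    qed
    \<comment> \<open>The antipode of the antipode is the letter itself, so the inequality holds in
      both directions.\<close>
    have m_eq: "mm (r + L) = mm r" if "r < L" for r
    proof -
      have "mm r \<le> mm (r + L)" using m_le[of r] that by (simp add: M_def)
      moreover have "(r + L + L) mod M = r"
        using that by (simp add: M_def add.assoc mult_2[symmetric])
      then have "mm (r + L) \<le> mm r" using m_le[of "r + L"] that by (simp add: M_def)
      ultimately show ?thesis by simp
    qed
    have "K = (\<Sum>i<L. mm i) + (\<Sum>i<L. mm (i + L))"
    proof -
      have "{..<M} = {..<L} \<union> (\<lambda>i. i + L) ` {..<L}"
      proof (intro equalityI subsetI)
        fix i assume "i \<in> {..<M}"
        then have "i < L \<or> (i - L < L \<and> i = i - L + L)" by (auto simp: M_def)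
        then show "i \<in> {..<L} \<union> (\<lambda>i. i + L) ` {..<L}" by blast
      qed (auto simp: M_def)
      moreover have "{..<L} \<inter> (\<lambda>i. i + L) ` {..<L} = {}" by auto
      ultimately have "K = sum mm {..<L} + sum mm ((\<lambda>i. i + L) ` {..<L})"
        by (simp add: K_def sum.union_disjoint)
      then show ?thesis by (simp add: sum.reindex)
    qed
    also have "\<dots> = 2 * (\<Sum>i<L. mm i)" using m_eq by simp
    finally have evK: "even K" by simp
    have "K \<ge> 2 * q + 1" using XA big DXK unfolding q_def by linarith
    \<comment> \<open>The gain from parity is decisive: with only \<open>2 * q + 1\<close> constant
      trivial cycles the count of non-ascents need not be contradictory.\<close>
    with evK have K2: "2 * q + 2 \<le> K" by presburger
    have "int N * int K + int Mx \<le> int n * int L + int n"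
      using NB L by (simp add: l_def algebra_simps of_nat_diff)
    then have "(int N - 1) * int K + int D \<le> int n * int L + int n" using DXK by (simp add: algebra_simps)
    moreover have "int D \<ge> int n * int L - int n + 2 * int q + 1" using bigR R by linarith
    moreover have "(int N - 1) * (2 * int q + 2) \<le> (int N - 1) * int K"
      using K2 N by (intro mult_left_mono) auto
    ultimately have "int N * (2 * int q + 2) \<le> 2 * int n + 1" by (simp add: algebra_simps)
    moreover have "2 * int n + 2 \<le> int N * (2 * int q + 2)"
    proof -
      have "int (n + 1) \<le> int (N * (q + 1))" using nq by (rule of_nat_mono)
      then show ?thesis by (simp add: algebra_simps)
    qed
    ultimately show False by linarith
  qed
qed

section \<open>Words bounding surfaces\<close>

fun walk :: "('e \<Rightarrow> 'v) \<Rightarrow> ('e \<Rightarrow> 'v) \<Rightarrow> 'v \<Rightarrow> 'e list \<Rightarrow> 'v \<Rightarrow> bool" where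
  "walk s t x [] y \<longleftrightarrow> x = y"
| "walk s t x (e # es) y \<longleftrightarrow> s e = x \<and> walk s t (t e) es y"

lemma walk_append: "walk s t x (es @ fs) y \<longleftrightarrow> (\<exists>z. walk s t x es z \<and> walk s t z fs y)"
  by (induction es arbitrary: x) auto

lemma walk_rotate: "\<exists>x. walk s t x (es @ fs) x \<Longrightarrow> \<exists>x. walk s t x (fs @ es) x"
  by (auto simp: walk_append)

lemma walk_start_in: "walk s t x es y \<Longrightarrow> es \<noteq> [] \<Longrightarrow> x \<in> s ` set es"
  by (cases es) auto

abbreviation entries :: "'e list multiset \<Rightarrow> 'e multiset" where
  "entries C \<equiv> sum_mset (image_mset mset C)"

type_synonym 'l edge = "nat \<times> 'l \<times> nat"

abbreviation src :: "'l edge \<Rightarrow> nat" where "src \<equiv> fst"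
definition tgt :: "'l edge \<Rightarrow> nat" where "tgt e = snd (snd e)"
definition lab :: "'l edge \<Rightarrow> 'l" where "lab e = fst (snd e)"

lemma tgt_simp [simp]: "tgt (x, l, y) = y" by (simp add: tgt_def)
lemma lab_simp [simp]: "lab (x, l, y) = l" by (simp add: lab_def)
definition mono_cycle :: "('j \<times> 'a) edge list \<Rightarrow> bool" where
  "mono_cycle c \<longleftrightarrow> c \<noteq> [] \<and> (\<exists>x. walk src tgt x c x) \<and> (\<exists>j. \<forall>e\<in>set c. fst (lab e) = j)"

text \<open>The base point is inserted for the empty word, whose surface is a disc with one
  vertex.\<close>

definition vertices :: "nat \<Rightarrow> 'l edge list \<Rightarrow> nat set" where
  "vertices b es = insert b (src ` set es)"

lemma finite_vertices [simp]: "finite (vertices b es)" by (simp add: vertices_def)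

context group
begin

lemma list_prod_Nil [simp]: "list_prod G [] = \<one>" by (simp add: list_prod_def)

lemma list_prod_Cons [simp]: "list_prod G (x # xs) = x \<otimes> list_prod G xs" by (simp add: list_prod_def)

lemma list_prod_closed [simp]: "set xs \<subseteq> carrier G \<Longrightarrow> list_prod G xs \<in> carrier G"
  by (induction xs) auto

lemma list_prod_append:
  "set xs \<subseteq> carrier G \<Longrightarrow> set ys \<subseteq> carrier G \<Longrightarrow> list_prod G (xs @ ys) = list_prod G xs \<otimes> list_prod G ys"
  by (induction xs) (auto simp: m_assoc)

lemma inv_cancel_left [simp]:
  "x \<in> carrier G \<Longrightarrow> y \<in> carrier G \<Longrightarrow> x \<otimes> (inv x \<otimes> y) = y"
  "x \<in> carrier G \<Longrightarrow> y \<in> carrier G \<Longrightarrow> inv x \<otimes> (x \<otimes> y) = y"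
  by (simp_all flip: m_assoc)

lemma mult_eq_one_swap: "x \<in> carrier G \<Longrightarrow> y \<in> carrier G \<Longrightarrow> x \<otimes> y = \<one> \<Longrightarrow> y \<otimes> x = \<one>"
  by (metis inv_equality r_inv)

definition val :: "('j \<times> 'a) list \<Rightarrow> 'a" where "val w = list_prod G (map snd w)"

definition triv :: "('j \<times> 'a) edge list \<Rightarrow> bool" where "triv c \<longleftrightarrow> val (map lab c) = \<one>"

definition in_carrier :: "('j \<times> 'a) list \<Rightarrow> bool" where "in_carrier w \<longleftrightarrow> snd ` set w \<subseteq> carrier G"

lemma in_carrier_simps [simp]:
  "in_carrier []" "in_carrier (l # w) \<longleftrightarrow> snd l \<in> carrier G \<and> in_carrier w"
  "in_carrier (u @ w) \<longleftrightarrow> in_carrier u \<and> in_carrier w"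
  by (auto simp: in_carrier_def)

lemma val_simps [simp]: "val [] = \<one>" "val (l # w) = snd l \<otimes> val w" by (simp_all add: val_def)

lemma val_closed [simp]: "in_carrier w \<Longrightarrow> val w \<in> carrier G"
  by (auto simp: val_def in_carrier_def intro!: list_prod_closed)

lemma val_append: "in_carrier u \<Longrightarrow> in_carrier w \<Longrightarrow> val (u @ w) = val u \<otimes> val w"
  by (auto simp: val_def in_carrier_def intro!: list_prod_append)

lemma val_rotate: "in_carrier u \<Longrightarrow> in_carrier w \<Longrightarrow> val (u @ w) = \<one> \<longleftrightarrow> val (w @ u) = \<one>"
  by (auto simp: val_append intro: mult_eq_one_swap)

text \<open>A word bounds a surface: its edges form a closed walk (the boundary) whose vertices are the
  preimages of the wedge point, and \<open>C\<close> lists the boundary cycles of the pieces of the surface lying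
  over the factors; the cycles with trivial product may be capped by discs, so
  \<open>score\<close> is the Euler characteristic.\<close>
definition config :: "nat \<Rightarrow> ('j \<times> 'a) edge list \<Rightarrow> ('j \<times> 'a) edge list multiset \<Rightarrow> bool" where
  "config b es C \<longleftrightarrow> walk src tgt b es b \<and> entries C = mset es
     \<and> (\<forall>c\<in>#C. mono_cycle c) \<and> in_carrier (map lab es)"

definition score :: "nat \<Rightarrow> ('j \<times> 'a) edge list \<Rightarrow> ('j \<times> 'a) edge list multiset \<Rightarrow> int" where
  "score b es C = int (card (vertices b es)) + int (size (filter_mset triv C)) - int (length es)"

text \<open>An inequality, because reducing a word may raise the Euler characteristic but never
  lowers it.\<close>

definition bounds :: "('j \<times> 'a) list \<Rightarrow> int \<Rightarrow> bool" where
  "bounds w \<chi> \<longleftrightarrow> (\<exists>b es C. map lab es = w \<and> config b es C \<and> \<chi> \<le> score b es C)"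

section \<open>Surgery on surfaces: merging and deleting letters\<close>

lemma config_cycle_in_carrier:
  assumes "config b es C" "c \<in># C"
  shows "set c \<subseteq> set es" "in_carrier (map lab c)"
proof -
  have "mset c \<subseteq># mset es" using assms unfolding config_def
    by (metis (no_types, lifting) image_mset_add_mset insert_DiffM mset_subset_eq_add_left sum_mset.insert)
  then show "set c \<subseteq> set es" by (metis set_mset_mono set_mset_mset)
  then have "snd ` lab ` set c \<subseteq> snd ` lab ` set es" by (intro image_mono)
  then show "in_carrier (map lab c)" using assms(1) unfolding config_def in_carrier_def
    by (metis (no_types) list.set_map subset_trans)
qed

lemma config_rotate_cycle:
  assumes "config b es (add_mset (u @ v) C)"
  shows "config b es (add_mset (v @ u) C)" "score b es (add_mset (v @ u) C) = score b es (add_mset (u @ v) C)"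
proof -
  have "mono_cycle (u @ v)" using assms by (simp add: config_def)
  then have "mono_cycle (v @ u)" using walk_rotate[of src tgt u v] by (auto simp: mono_cycle_def)
  then show "config b es (add_mset (v @ u) C)" using assms by (auto simp: config_def add.commute)
  have "in_carrier (map lab (u @ v))" using config_cycle_in_carrier(2)[OF assms, of "u @ v"] by simp
  then have "triv (v @ u) = triv (u @ v)" by (simp add: triv_def val_rotate)
  then show "score b es (add_mset (v @ u) C) = score b es (add_mset (u @ v) C)" by (simp add: score_def)
qed

text \<open>A cycle may be rotated to begin with a chosen edge. The cycles in \<open>D\<close> are
  left alone, so that a second cycle can be opened while the first stays open.\<close>

lemma config_extract:
  assumes "config b es (C + D)" "e \<in># entries C"
  obtains \<alpha> C' where "config b es (add_mset (e # \<alpha>) C' + D)" "score b es (add_mset (e # \<alpha>) C' + D) = score b es (C + D)"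
    "entries C = mset (e # \<alpha>) + entries C'"
proof -
  obtain c where c: "c \<in># C" "e \<in> set c" using assms(2) by auto
  then obtain C' where C': "C = add_mset c C'" by (metis insert_DiffM)
  obtain u v where uv: "c = u @ e # v" using c(2) by (meson split_list)
  show ?thesis
  proof (rule that)
    show "config b es (add_mset (e # (v @ u)) C' + D)"
      using config_rotate_cycle(1)[of b es u "e # v" "C' + D"] assms C' uv by simp
    show "score b es (add_mset (e # (v @ u)) C' + D) = score b es (C + D)"
      using config_rotate_cycle(2)[of b es u "e # v" "C' + D"] assms C' uv by simp
    show "entries C = mset (e # (v @ u)) + entries C'"
      using C' uv by simp
  qed
qed

text \<open>One edge disappears, so vertices and discs together may drop by one. The replacement
  either cuts the common cycle of \<open>e\<close> and \<open>f\<close> in two or joins their two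
  cycles, and either way at most one disc is lost. The junction vertex can vanish only if
  \<open>f\<close> directly follows \<open>e\<close> on a cycle, and then no disc is lost.\<close>

lemma bounds_merge:
  assumes "bounds (u @ [(j, x), (j, y)] @ v) \<chi>"
  shows "bounds (u @ [(j, x \<otimes> y)] @ v) \<chi>"
proof -
  from assms obtain b es C where es: "map lab es = u @ [(j, x), (j, y)] @ v" and cf: "config b es C" and sc: "\<chi> \<le> score b es C"
    by (auto simp: bounds_def)
  obtain eu e f ev where split: "es = eu @ [e, f] @ ev" "map lab eu = u" "map lab ev = v" "lab e = (j, x)" "lab f = (j, y)"
    using es by (auto simp: map_eq_append_conv Cons_eq_append_conv append_eq_Cons_conv map_eq_Cons_conv)
  define g where "g = (src e, (j, x \<otimes> y), tgt f)"
  define es' where "es' = eu @ [g] @ ev"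
  have g: "src g = src e" "tgt g = tgt f" "lab g = (j, x \<otimes> y)" by (simp_all add: g_def)
  have wk: "walk src tgt b es b" and xy: "x \<in> carrier G" "y \<in> carrier G"
    using cf split by (auto simp: config_def)
  have mid: "src f = tgt e" using wk split(1) by (auto simp: walk_append)
  have wk': "walk src tgt b es' b" using wk mid g by (auto simp: es'_def split(1) walk_append)
  have car': "in_carrier (map lab es')" using cf g xy split by (auto simp: config_def es'_def)
  have lab': "map lab es' = u @ [(j, x \<otimes> y)] @ v" by (simp add: es'_def g split)
  have V: "vertices b es \<subseteq> insert (tgt e) (vertices b es')"
    using mid g by (auto simp: vertices_def es'_def split(1))
  have len: "length es = Suc (length es')" by (simp add: es'_def split(1))
  have goal: ?thesis if "config b es' C'"
    "card (vertices b es) + size (filter_mset triv C) \<le> card (vertices b es') + size (filter_mset triv C') + 1" for C'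
    unfolding bounds_def using that lab' sc len by (intro exI[of _ b] exI[of _ es'] exI[of _ C']) (auto simp: score_def)
  have cardV: "card (vertices b es) \<le> card (vertices b es') + 1"
    using card_mono[OF _ V] card_insert_le_m1[of "Suc (card (vertices b es'))" "vertices b es'" "tgt e"] by simp
  have cardV': "card (vertices b es) \<le> card (vertices b es')" if "tgt e \<in> vertices b es'"
    using card_mono[of "vertices b es'" "vertices b es"] V that by (simp add: insert_absorb)
  have "e \<in># entries C" using cf split by (simp add: config_def)
  then obtain \<alpha> C0 where "config b es (add_mset (e # \<alpha>) C0 + {#})"
    "score b es (add_mset (e # \<alpha>) C0 + {#}) = score b es (C + {#})"
    by (rule config_extract[of b es C "{#}" e, rotated]) (use cf in simp_all)
  then have c0: "config b es (add_mset (e # \<alpha>) C0)" "score b es (add_mset (e # \<alpha>) C0) = score b es C"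
    by simp_all
  have ms: "mset \<alpha> + entries C0 = mset eu + {#f#} + mset ev"
    using c0(1) by (simp add: config_def split(1))
  have ea: "walk src tgt (tgt e) \<alpha> (src e)" "\<forall>h\<in>set \<alpha>. fst (lab h) = j"
    using c0(1) split by (auto simp: config_def mono_cycle_def)
  have ca: "in_carrier (map lab \<alpha>)" using config_cycle_in_carrier(2)[OF c0(1), of "e # \<alpha>"] by simp
  have sz: "size (filter_mset triv C) = size (filter_mset triv (add_mset (e # \<alpha>) C0))"
    using c0(2) by (simp add: score_def)
  show ?thesis
  proof (cases "f \<in> set \<alpha>")
    case True
    then obtain \<beta> \<gamma> where al: "\<alpha> = \<beta> @ f # \<gamma>" by (meson split_list)
    have wb: "walk src tgt (tgt e) \<beta> (tgt e)" and wg: "walk src tgt (tgt f) \<gamma> (src e)"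
      using ea(1) mid by (auto simp: al walk_append)
    have mc: "mono_cycle (g # \<gamma>)" using wg ea(2) g by (auto simp: mono_cycle_def al)
    have ms': "mset \<beta> + mset \<gamma> + entries C0 = mset eu + mset ev" using ms by (simp add: al)
    show ?thesis
    proof (cases "\<beta> = []")
      case True
      have "triv (g # \<gamma>) = triv (e # \<alpha>)"
        using True split xy ca by (simp add: triv_def al g m_assoc)
      moreover have "config b es' (add_mset (g # \<gamma>) C0)"
        using wk' car' mc c0(1) ms' True by (auto simp: config_def es'_def)
      ultimately show ?thesis using goal[of "add_mset (g # \<gamma>) C0"] cardV sz by simp
    next
      case False
      have "mono_cycle \<beta>" using wb ea(2) False by (auto simp: mono_cycle_def al)
      then have cf': "config b es' (add_mset \<beta> (add_mset (g # \<gamma>) C0))"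
        using wk' car' mc c0(1) ms' by (auto simp: config_def es'_def ac_simps)
      have "tgt e \<in> vertices b es'"
        using walk_start_in[OF wb False] config_cycle_in_carrier(1)[OF cf', of \<beta>] by (auto simp: vertices_def)
      then show ?thesis using goal[OF cf'] cardV' sz by simp
    qed
  next
    case False
    have "f \<in># mset \<alpha> + entries C0" unfolding ms by simp
    with False have "f \<in># entries C0" unfolding union_iff by simp
    then obtain \<beta> C1 where c1: "config b es (add_mset (f # \<beta>) C1 + {#e # \<alpha>#})"
      "score b es (add_mset (f # \<beta>) C1 + {#e # \<alpha>#}) = score b es (C0 + {#e # \<alpha>#})"
      "entries C0 = mset (f # \<beta>) + entries C1"
      by (rule config_extract[of b es C0 "{#e # \<alpha>#}" f, rotated]) (use c0(1) in simp_all)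
    have fb: "walk src tgt (tgt f) \<beta> (tgt e)" "\<forall>h\<in>set \<beta>. fst (lab h) = j"
      using c1(1) split mid by (auto simp: config_def mono_cycle_def)
    have cb: "in_carrier (map lab \<beta>)" using config_cycle_in_carrier(2)[OF c1(1), of "f # \<beta>"] by simp
    have mc: "mono_cycle (g # \<beta> @ \<alpha>)" using fb ea g by (auto simp: mono_cycle_def walk_append)
    have cf': "config b es' (add_mset (g # \<beta> @ \<alpha>) C1)"
      using wk' car' mc c1(1,3) ms by (auto simp: config_def es'_def ac_simps)
    have "triv (g # \<beta> @ \<alpha>)" if t: "triv (f # \<beta>)" "triv (e # \<alpha>)"
    proof -
      have "y \<otimes> val (map lab \<beta>) = \<one>" "x \<otimes> val (map lab \<alpha>) = \<one>" using t split by (simp_all add: triv_def)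
      moreover have "x \<otimes> y \<otimes> (val (map lab \<beta>) \<otimes> val (map lab \<alpha>)) = x \<otimes> (y \<otimes> val (map lab \<beta>)) \<otimes> val (map lab \<alpha>)"
        using xy ca cb by (simp add: m_assoc)
      ultimately show ?thesis using xy ca cb by (simp add: triv_def g val_append)
    qed
    then have "size (filter_mset triv (add_mset (f # \<beta>) C1 + {#e # \<alpha>#})) \<le> size (filter_mset triv (add_mset (g # \<beta> @ \<alpha>) C1)) + 1"
      by auto
    moreover have "size (filter_mset triv (add_mset (f # \<beta>) C1 + {#e # \<alpha>#})) = size (filter_mset triv C)"
      using c1(2) sz by (simp add: score_def)
    moreover have "tgt e \<in> vertices b es'"
    proof (cases "\<alpha> = []")
      case True
      then show ?thesis using ea(1) by (simp add: vertices_def es'_def g)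
    next
      case False
      then show ?thesis using walk_start_in[OF ea(1)] config_cycle_in_carrier(1)[OF cf', of "g # \<beta> @ \<alpha>"] by (auto simp: vertices_def)
    qed
    ultimately show ?thesis using goal[OF cf'] cardV' by simp
  qed
qed


text \<open>If the edge \<open>e\<close> is a cycle by itself, it is a loop and cancels against its
  own disc. Otherwise contracting \<open>e\<close> preserves the value of its cycle and loses one
  edge and at most one vertex.\<close>

lemma bounds_delete_one:
  fixes u v :: "('j \<times> 'a) list"
  assumes "bounds (u @ [(j, \<one>)] @ v) \<chi>"
  shows "bounds (u @ v) \<chi>"
proof -
  from assms obtain b es C where es: "map lab es = u @ [(j, \<one>)] @ v" and cf: "config b es C" and sc: "\<chi> \<le> score b es C"
    by (auto simp: bounds_def)
  obtain eu e ev where split: "es = eu @ [e] @ ev" "map lab eu = u" "map lab ev = v" "lab e = (j, \<one>)"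
    using es by (auto simp: map_eq_append_conv Cons_eq_append_conv append_eq_Cons_conv map_eq_Cons_conv)
  have wk: "walk src tgt b eu (src e)" "walk src tgt (tgt e) ev b"
    and car: "in_carrier (map lab (eu @ ev))"
    using cf split by (auto simp: config_def walk_append)
  have "e \<in># entries C" using cf split by (simp add: config_def)
  then obtain \<alpha> C0 where "config b es (add_mset (e # \<alpha>) C0 + {#})"
    "score b es (add_mset (e # \<alpha>) C0 + {#}) = score b es (C + {#})"
    by (rule config_extract[of b es C "{#}" e, rotated]) (use cf in simp_all)
  then have c0: "config b es (add_mset (e # \<alpha>) C0)" and sc0: "\<chi> \<le> score b es (add_mset (e # \<alpha>) C0)"
    using sc by simp_all
  have ms: "mset \<alpha> + entries C0 = mset (eu @ ev)"
    using c0 by (simp add: config_def split(1))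
  have wa: "walk src tgt (tgt e) \<alpha> (src e)" using c0 by (auto simp: config_def mono_cycle_def)
  have mcs: "\<forall>c\<in>#C0. mono_cycle c" using c0 by (simp add: config_def)
  have len: "length es = Suc (length (eu @ ev))" by (simp add: split(1))
  have ca: "in_carrier (map lab \<alpha>)" using config_cycle_in_carrier(2)[OF c0, of "e # \<alpha>"] by simp
  show ?thesis
  proof (cases "\<alpha> = []")
    case True
    then have st: "src e = tgt e" using wa by simp
    have "src e \<in> vertices b (eu @ ev)"
      using wk(2) st by (cases ev) (auto simp: vertices_def)
    then have V: "vertices b es = vertices b (eu @ ev)" by (auto simp: vertices_def split(1))
    have "config b (eu @ ev) C0"
      using wk st car ms mcs True by (auto simp: config_def walk_append)
    moreover have "\<chi> \<le> score b (eu @ ev) C0"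
      using sc0 V len by (auto simp: score_def split: if_splits)
    ultimately show ?thesis unfolding bounds_def using split by (intro exI[of _ b] exI[of _ "eu @ ev"] exI[of _ C0]) simp
  next
    case False
    \<comment> \<open>The edge \<open>e\<close> is contracted by identifying its target with its
      source.\<close>
    define h where "h x = (if x = tgt e then src e else x)" for x
    define r where "r e = (h (src e), lab e, h (tgt e))" for e :: "('j \<times> 'a) edge"
    have r: "src (r e) = h (src e)" "tgt (r e) = h (tgt e)" "lab (r e) = lab e" for e by (simp_all add: r_def)
    have wr: "walk src tgt (h x) (map r es) (h y)" if "walk src tgt x es y" for x y es
      using that by (induction es arbitrary: x) (auto simp: r)
    have labr: "map lab (map r es) = map lab es" for es by (simp add: r)
    define es' where "es' = map r (eu @ ev)"
    define C' where "C' = add_mset (map r \<alpha>) (image_mset (map r) C0)"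
    have hte: "h (tgt e) = h (src e)" by (simp add: h_def)
    have trivr: "triv (map r c) = triv c" for c by (simp only: triv_def labr)
    have mcr: "mono_cycle (map r c)" if "mono_cycle c" for c
      using that wr unfolding mono_cycle_def by (auto simp: r)
    have mca: "mono_cycle (map r \<alpha>)"
    proof -
      have "\<exists>j. \<forall>e\<in>set \<alpha>. fst (lab e) = j" using c0 by (auto simp: config_def mono_cycle_def)
      moreover have "walk src tgt (h (src e)) (map r \<alpha>) (h (src e))" using wr[OF wa] hte by simp
      ultimately show ?thesis using False by (auto simp: mono_cycle_def r)
    qed
    have "walk src tgt (h b) es' (h b)" using wr[OF wk(1)] wr[OF wk(2)] hte by (auto simp: es'_def walk_append)
    moreover have "entries C' = mset es'"
    proof -
      have "sum_mset (image_mset mset (image_mset (map r) D)) = image_mset r (entries D)" for D :: "('j \<times> 'a) edge list multiset"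
        by (induction D) auto
      then have "entries C' = image_mset r (mset \<alpha> + entries C0)"
        by (simp add: C'_def)
      then show ?thesis unfolding ms es'_def by simp
    qed
    ultimately have cf': "config (h b) es' C'"
      using car mcs mca mcr unfolding config_def by (auto simp: es'_def C'_def labr simp del: map_map map_append)
    have "size (filter_mset triv C') = size (filter_mset triv (add_mset (e # \<alpha>) C0))"
    proof -
      have "triv (e # \<alpha>) = triv \<alpha>" using split ca by (simp add: triv_def)
      then show ?thesis by (simp add: C'_def filter_mset_image_mset trivr)
    qed
    moreover have "card (vertices b es) \<le> card (vertices (h b) es') + 1"
    proof -
      have te: "tgt e \<in> src ` set (eu @ ev)"
        using walk_start_in[OF wa False] ms
        by (metis image_mono subsetD set_mset_mset set_mset_union sup_ge1)
      have "x \<in> insert (tgt e) (vertices (h b) es')" if x: "x \<in> vertices b es" for x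
      proof (cases "x = tgt e")
        case False
        have "vertices (h b) es' = h ` insert b (src ` set (eu @ ev))"
          by (simp add: vertices_def es'_def r image_image image_Un)
        moreover have "x = h x" using False by (simp add: h_def)
        moreover have "x \<in> insert b (src ` set (eu @ ev)) \<or> x = src e" using x by (auto simp: vertices_def split(1))
        moreover have "src e = h (tgt e)" by (simp add: h_def)
        ultimately show ?thesis using te by blast
      qed simp
      then have "card (vertices b es) \<le> card (insert (tgt e) (vertices (h b) es'))"
        by (intro card_mono) auto
      also have "\<dots> \<le> card (vertices (h b) es') + 1" by (simp add: card_insert_if)
      finally show ?thesis .
    qed
    ultimately have "\<chi> \<le> score (h b) es' C'" using sc0 len by (simp add: score_def es'_def)
    moreover have "map lab es' = u @ v" unfolding es'_def labr by (simp add: split)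
    ultimately show ?thesis unfolding bounds_def using cf' by blast
  qed
qed

section \<open>Handles attached along words\<close>

definition inv_word :: "('j \<times> 'a) list \<Rightarrow> ('j \<times> 'a) list" where
  "inv_word w = rev (map (\<lambda>(j, x). (j, inv x)) w)"

lemma inv_word_Nil [simp]: "inv_word [] = []" by (simp add: inv_word_def)

lemma inv_word_Cons: "inv_word (l # w) = inv_word w @ [(fst l, inv (snd l))]"
  by (simp add: inv_word_def case_prod_unfold)

lemma length_inv_word [simp]: "length (inv_word w) = length w" by (simp add: inv_word_def)

lemma in_carrier_inv_word [simp]: "in_carrier w \<Longrightarrow> in_carrier (inv_word w)"
  by (induction w) (auto simp: inv_word_Cons)

lemma val_inv_word: "in_carrier w \<Longrightarrow> val (inv_word w) = inv (val w)"
  by (induction w) (auto simp: inv_word_Cons val_append inv_mult_group)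

text \<open>All interior vertices can be chosen distinct and outside \<open>F\<close>, which makes
  the contribution of the word to the Euler characteristic as large as possible.\<close>

lemma fresh_walk:
  assumes "xs \<noteq> []" "finite F"
  shows "\<exists>p. map lab p = xs \<and> walk src tgt s p b \<and> int (length xs) - 1 \<le> int (card (src ` set p - insert s F))"
  using assms
proof (induction xs arbitrary: s F)
  case (Cons l ls)
  show ?case
  proof (cases "ls = []")
    case True
    then show ?thesis by (intro exI[of _ "[(s, l, b)]"]) simp
  next
    case False
    obtain m where m: "m \<notin> insert s F" using Cons.prems(2) by (meson ex_new_if_finite finite_insert infinite_UNIV_nat)
    obtain p where p: "map lab p = ls" "walk src tgt m p b" "int (length ls) - 1 \<le> int (card (src ` set p - insert m (insert s F)))"
      using Cons.IH[OF False, of "insert s F" m] Cons.prems(2) by auto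
    have "p \<noteq> []" using p(1) False by auto
    then have "m \<in> src ` set p" using walk_start_in[OF p(2)] by simp
    then have "insert m (src ` set p - insert m (insert s F)) \<subseteq> src ` set ((s, l, m) # p) - insert s F" using m by auto
    then have "card (insert m (src ` set p - insert m (insert s F))) \<le> card (src ` set ((s, l, m) # p) - insert s F)"
      by (intro card_mono) auto
    then have "int (length (l # ls)) - 1 \<le> int (card (src ` set ((s, l, m) # p) - insert s F))"
      using p(3) by simp
    then show ?thesis using p by (intro exI[of _ "(s, l, m) # p"]) simp
  qed
qed simp

definition flip :: "('j \<times> 'a) edge \<Rightarrow> ('j \<times> 'a) edge" where
  "flip e = (tgt e, (fst (lab e), inv (snd (lab e))), src e)"

lemma flip_simps [simp]: "src (flip e) = tgt e" "tgt (flip e) = src e" "lab (flip e) = (fst (lab e), inv (snd (lab e)))"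
  by (simp_all add: flip_def)

lemma walk_flip: "walk src tgt x p y \<Longrightarrow> walk src tgt y (rev (map flip p)) x"
  by (induction p arbitrary: x) (auto simp: walk_append)

lemma lab_flip: "map lab (rev (map flip p)) = inv_word (map lab p)"
  by (induction p) (auto simp: inv_word_Cons)

text \<open>An edge followed by its inverse has product \<open>\<one>\<close>, so each letter glued
  to its inverse contributes one disc.\<close>

lemma bigons:
  assumes "in_carrier (map lab p)"
  defines "B \<equiv> image_mset (\<lambda>e. [e, flip e]) (mset p)"
  shows "entries B = mset (p @ rev (map flip p))" "\<forall>c\<in>#B. mono_cycle c"
    "size (filter_mset triv B) = length p"
proof -
  show "entries B = mset (p @ rev (map flip p))"
    unfolding B_def by (induction p) auto
  show "\<forall>c\<in>#B. mono_cycle c" by (auto simp: B_def mono_cycle_def)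
  have "triv [e, flip e]" if "e \<in> set p" for e
  proof -
    have "snd (lab e) \<in> carrier G" using assms(1) that by (force simp: in_carrier_def)
    then show ?thesis by (simp add: triv_def)
  qed
  then have "filter_mset triv B = B" by (auto simp: B_def filter_mset_eq_conv)
  then show "size (filter_mset triv B) = length p" by (simp add: B_def)
qed

text \<open>Attaching a handle: the \<open>2 * (length xs + length ys)\<close> new edges are offset
  by \<open>length xs + length ys\<close> bigons and at least
  \<open>length xs + length ys - 2\<close> fresh vertices.\<close>

lemma bounds_commutator:
  assumes "bounds w \<chi>" "xs \<noteq> []" "ys \<noteq> []" "in_carrier xs" "in_carrier ys"
  shows "bounds (inv_word xs @ inv_word ys @ xs @ ys @ w) (\<chi> - 2)"
proof -
  from assms(1) obtain b es C where es: "map lab es = w" and cf: "config b es C" and sc: "\<chi> \<le> score b es C"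
    by (auto simp: bounds_def)
  define F where "F = vertices b es"
  obtain p where p: "map lab p = xs" "walk src tgt b p b" "int (length xs) - 1 \<le> int (card (src ` set p - insert b F))"
    using fresh_walk[OF assms(2), of F b b] F_def by auto
  obtain q where q: "map lab q = ys" "walk src tgt b q b" "int (length ys) - 1 \<le> int (card (src ` set q - insert b (F \<union> src ` set p)))"
    using fresh_walk[OF assms(3), of "F \<union> src ` set p" b b] F_def by auto
  define es' where "es' = rev (map flip p) @ rev (map flip q) @ p @ q @ es"
  define Bp where "Bp = image_mset (\<lambda>e. [e, flip e]) (mset p)"
  define Bq where "Bq = image_mset (\<lambda>e. [e, flip e]) (mset q)"
  define C' where "C' = Bp + Bq + C"
  have cp: "in_carrier (map lab p)" "in_carrier (map lab q)" using p q assms by simp_all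
  note Bp = bigons[OF cp(1), folded Bp_def] and Bq = bigons[OF cp(2), folded Bq_def]
  have lab': "map lab es' = inv_word xs @ inv_word ys @ xs @ ys @ w"
    by (simp only: es'_def map_append lab_flip p q es)
  have "walk src tgt b es' b"
    using walk_flip[OF p(2)] walk_flip[OF q(2)] p(2) q(2) cf by (auto simp: es'_def walk_append config_def)
  moreover have "entries C' = mset es'"
    using Bp(1) Bq(1) cf by (simp add: C'_def es'_def config_def ac_simps)
  moreover have "in_carrier (map lab es')" unfolding lab' using assms es cf by (auto simp: config_def)
  ultimately have cf': "config b es' C'" using Bp(2) Bq(2) cf by (auto simp: config_def C'_def)
  have lens: "length p = length xs" "length q = length ys" using p(1) q(1) by auto
  have "card F + card (src ` set p - insert b F) + card (src ` set q - insert b (F \<union> src ` set p))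
      = card (F \<union> (src ` set p - insert b F) \<union> (src ` set q - insert b (F \<union> src ` set p)))"
    by (subst card_Un_disjoint; auto simp: F_def card_Un_disjoint)+
  also have "\<dots> \<le> card (vertices b es')"
    by (intro card_mono) (auto simp: F_def vertices_def es'_def)
  finally have "int (card F) + (int (length xs) - 1) + (int (length ys) - 1) \<le> int (card (vertices b es'))"
    using p(3) q(3) by linarith
  moreover have "size (filter_mset triv C') = length xs + length ys + size (filter_mset triv C)"
    using Bp(3) Bq(3) lens by (simp add: C'_def)
  moreover have "length es' = 2 * length xs + 2 * length ys + length es" using lens by (simp add: es'_def)
  ultimately have "\<chi> - 2 \<le> score b es' C'" using sc by (simp add: score_def F_def)
  then show ?thesis unfolding bounds_def using lab' cf' by blast
qed

lemma bounds_Nil: "bounds [] 1"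
  unfolding bounds_def by (intro exI[of _ 0] exI[of _ "[]"] exI[of _ "{#}"]) (simp add: config_def score_def vertices_def)

end

section \<open>Reduced words in free products\<close>

lemma not_successivelyE:
  assumes "\<not> successively P w"
  obtains u a b v where "w = u @ a # b # v" "\<not> P a b"
proof -
  have "\<exists>u a b v. w = u @ a # b # v \<and> \<not> P a b"
    using assms
  proof (induction w rule: induct_list012)
    case (3 x y zs)
    show ?case
    proof (cases "P x y")
      case True
      then obtain u a b v where "y # zs = u @ a # b # v" "\<not> P a b" using 3 by auto
      then show ?thesis by (intro exI[of _ "x # u"]) auto
    next
      case False
      then show ?thesis by (intro exI[of _ "[]"]) auto
    qed
  qed auto
  then show ?thesis using that by blast
qed

locale free_prod = group G for G :: "('a, 'b) monoid_scheme" (structure) +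
  fixes J :: "'j set" and A :: "'j \<Rightarrow> 'a set"
  assumes free_product: "is_free_product G J A"
begin

lemma factor_subgroup: "j \<in> J \<Longrightarrow> subgroup (A j) G"
  using free_product by (simp add: is_free_product_def)

definition valid :: "('j \<times> 'a) list \<Rightarrow> bool" where
  "valid w \<longleftrightarrow> (\<forall>p\<in>set w. fst p \<in> J \<and> snd p \<in> A (fst p))"

definition reduced :: "('j \<times> 'a) list \<Rightarrow> bool" where
  "reduced w \<longleftrightarrow> valid w \<and> (\<forall>p\<in>set w. snd p \<noteq> \<one>) \<and> successively (\<lambda>p q. fst p \<noteq> fst q) w"

lemma valid_simps [simp]:
  "valid []" "valid (p # w) \<longleftrightarrow> fst p \<in> J \<and> snd p \<in> A (fst p) \<and> valid w"
  "valid (u @ w) \<longleftrightarrow> valid u \<and> valid w"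
  by (auto simp: valid_def)

lemma reduced_valid: "reduced w \<Longrightarrow> valid w" by (simp add: reduced_def)

lemma valid_in_carrier: "valid w \<Longrightarrow> in_carrier w"
  using subgroup.mem_carrier[OF factor_subgroup] by (induction w) auto

lemma valid_inv_word: "valid w \<Longrightarrow> valid (inv_word w)"
  using subgroup.m_inv_closed[OF factor_subgroup] by (induction w) (auto simp: inv_word_Cons)

lemma reduced_Nil [simp]: "reduced []" by (simp add: reduced_def)

lemma reduced_Cons:
  "reduced (p # w) \<longleftrightarrow> fst p \<in> J \<and> snd p \<in> A (fst p) \<and> snd p \<noteq> \<one> \<and> reduced w \<and> (w = [] \<or> fst p \<noteq> fst (hd w))"
  by (cases w) (auto simp: reduced_def)

lemma reduced_append:
  "reduced (u @ w) \<longleftrightarrow> reduced u \<and> reduced w \<and> (u = [] \<or> w = [] \<or> fst (last u) \<noteq> fst (hd w))"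
  by (auto simp: reduced_def successively_append_iff)

lemma reduced_val_ne_one:
  assumes "reduced w" "w \<noteq> []" shows "val w \<noteq> \<one>"
proof -
  have "\<forall>i. Suc i < length w \<longrightarrow> fst (w ! i) \<noteq> fst (w ! Suc i)"
    using assms(1) by (auto simp: reduced_def successively_conv_nth)
  moreover have "\<forall>p\<in>set w. fst p \<in> J \<and> snd p \<in> A (fst p) \<and> snd p \<noteq> \<one>"
    using assms(1) by (simp add: reduced_def valid_def)
  moreover have "w \<noteq> [] \<longrightarrow> (\<forall>p\<in>set w. fst p \<in> J \<and> snd p \<in> A (fst p) \<and> snd p \<noteq> \<one>) \<longrightarrow>
     (\<forall>i. Suc i < length w \<longrightarrow> fst (w ! i) \<noteq> fst (w ! Suc i)) \<longrightarrow> list_prod G (map snd w) \<noteq> \<one>"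
    using free_product unfolding is_free_product_def by (elim conjE) (rule spec)
  ultimately show ?thesis using assms(2) unfolding val_def by simp
qed

lemma fst_last_inv_word: "w \<noteq> [] \<Longrightarrow> fst (last (inv_word w)) = fst (hd w)"
  by (cases w) (auto simp: inv_word_Cons)

lemma inv_word_eq_Nil [simp]: "inv_word w = [] \<longleftrightarrow> w = []" by (simp add: inv_word_def)

lemma reduced_inv_word: "reduced w \<Longrightarrow> reduced (inv_word w)"
proof (induction w)
  case (Cons p w)
  have p: "fst p \<in> J" "snd p \<in> A (fst p)" "snd p \<noteq> \<one>" and w: "reduced w" "w = [] \<or> fst p \<noteq> fst (hd w)"
    using Cons.prems by (auto simp: reduced_Cons)
  have c: "snd p \<in> carrier G" using subgroup.mem_carrier[OF factor_subgroup] p by blast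
  have "inv (snd p) \<in> A (fst p)" using subgroup.m_inv_closed[OF factor_subgroup] p by blast
  moreover have "inv (snd p) \<noteq> \<one>" using p(3) c by (metis inv_inv inv_one)
  ultimately have "reduced [(fst p, inv (snd p))]" using p by (simp add: reduced_Cons)
  then show ?case using Cons.IH[OF w(1)] w(2) fst_last_inv_word[of w]
    by (auto simp: inv_word_Cons reduced_append)
qed simp

text \<open>The first letters are compared. If they differ, the inverse of \<open>u\<close> followed
  by \<open>v\<close>, with the two first letters merged when they share a factor, is a nonempty
  reduced word of value \<open>\<one>\<close>.\<close>

lemma reduced_unique:
  assumes "reduced u" "reduced v" "val u = val v"
  shows "u = v"
  using assms
proof (induction u arbitrary: v)
  case Nil
  then show ?case using reduced_val_ne_one[of v] by auto
next
  case (Cons a u)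
  obtain b v' where v: "v = b # v'" using Cons.prems reduced_val_ne_one[of "a # u"] by (cases v) auto
  have ra: "fst a \<in> J" "snd a \<in> A (fst a)" "snd a \<noteq> \<one>" "reduced u" "u = [] \<or> fst a \<noteq> fst (hd u)"
    and rb: "fst b \<in> J" "snd b \<in> A (fst b)" "snd b \<noteq> \<one>" "reduced v'" "v' = [] \<or> fst b \<noteq> fst (hd v')"
    using Cons.prems by (auto simp: reduced_Cons v)
  have car: "snd a \<in> carrier G" "snd b \<in> carrier G" "in_carrier u" "in_carrier v'" "in_carrier (a # u)"
    using ra rb subgroup.mem_carrier[OF factor_subgroup] valid_in_carrier reduced_valid by auto
  have eq: "snd a \<otimes> val u = snd b \<otimes> val v'" using Cons.prems(3) v by simp
  have "fst a = fst b"
  proof (rule ccontr)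
    assume ne: "fst a \<noteq> fst b"
    have "reduced (inv_word (a # u) @ v)"
      using reduced_inv_word[OF Cons.prems(1)] Cons.prems(2) fst_last_inv_word[of "a # u"] ne v
      by (auto simp: reduced_append)
    moreover have "val (inv_word (a # u) @ v) = \<one>"
      using car Cons.prems(3) v by (simp add: val_append val_inv_word)
    ultimately show False using reduced_val_ne_one v by blast
  qed
  moreover have "snd a = snd b"
  proof (rule ccontr)
    assume ne: "snd a \<noteq> snd b"
    define c where "c = inv (snd a) \<otimes> snd b"
    have "c \<noteq> \<one>" using ne car by (metis c_def inv_closed inv_equality inv_inv)
    moreover have "c \<in> A (fst a)"
      using ra rb \<open>fst a = fst b\<close> factor_subgroup[OF ra(1)] by (simp add: c_def subgroup.m_closed subgroup.m_inv_closed)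
    ultimately have r: "reduced (inv_word u @ (fst a, c) # v')"
      using reduced_inv_word[OF ra(4)] ra rb \<open>fst a = fst b\<close> fst_last_inv_word[of u]
      by (auto simp: reduced_append reduced_Cons)
    have "val (inv_word u @ (fst a, c) # v') = inv (val u) \<otimes> (inv (snd a) \<otimes> (snd b \<otimes> val v'))"
      using car by (simp add: val_append val_inv_word c_def m_assoc)
    also have "\<dots> = \<one>" unfolding eq[symmetric] using car by (simp add: m_assoc[symmetric])
    finally show False using reduced_val_ne_one[OF r] by blast
  qed
  ultimately have ab: "a = b" by (simp add: prod_eq_iff)
  then have "val u = val v'" using eq car by simp
  then show ?case using Cons.IH[OF ra(4) rb(4)] ab v by simp
qed

text \<open>The invariant \<open>P\<close> lets the normal form inherit further data: later a
  bounding surface (\<open>bounds\<close>), or the absence of letters from one factor.\<close>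

lemma reduce:
  assumes "valid w" "P w"
    and merge: "\<And>u j x y v. P (u @ [(j, x), (j, y)] @ v) \<Longrightarrow> P (u @ [(j, x \<otimes> y)] @ v)"
    and delete: "\<And>u j v. P (u @ [(j, \<one>)] @ v) \<Longrightarrow> P (u @ v)"
  shows "\<exists>v. reduced v \<and> val v = val w \<and> P v \<and> length v \<le> length w"
  using assms(1,2)
proof (induction "length w" arbitrary: w rule: less_induct)
  case less
  show ?case
  proof (cases "reduced w")
    case True
    then show ?thesis using less.prems by blast
  next
    case False
    have "\<exists>w'. length w' < length w \<and> valid w' \<and> P w' \<and> val w' = val w"
    proof (cases "\<exists>p\<in>set w. snd p = \<one>")
      case True
      then obtain p u v where w: "w = u @ p # v" "snd p = \<one>" by (meson split_list)
      then have "w = u @ [(fst p, \<one>)] @ v" by (metis append_Cons append_Nil prod.collapse)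
      moreover have "val (u @ v) = val w"
        using valid_in_carrier[of u] valid_in_carrier[of v] less.prems w by (simp add: val_append)
      ultimately show ?thesis using delete[of u "fst p" v] less.prems w by (intro exI[of _ "u @ v"]) auto
    next
      case False
      then have "\<not> successively (\<lambda>p q. fst p \<noteq> fst q) w" using \<open>\<not> reduced w\<close> less.prems by (auto simp: reduced_def)
      then obtain u a b v where w: "w = u @ a # b # v" "\<not> fst a \<noteq> fst b" by (rule not_successivelyE)
      then have ab: "fst a = fst b" by simp
      have ww: "w = u @ [(fst a, snd a), (fst a, snd b)] @ v"
        unfolding w(1) by (simp add: prod_eq_iff ab)
      have ab: "fst a \<in> J" "snd a \<in> A (fst a)" "snd b \<in> A (fst a)" "valid u" "valid v"
        using less.prems w by auto
      have car: "snd a \<in> carrier G" "snd b \<in> carrier G" "in_carrier u" "in_carrier v"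
        using ab subgroup.mem_carrier[OF factor_subgroup] valid_in_carrier by auto
      have "snd a \<otimes> snd b \<in> A (fst a)" using ab subgroup.m_closed[OF factor_subgroup] by blast
      moreover have "val (u @ [(fst a, snd a \<otimes> snd b)] @ v) = val w"
        using car w by (simp add: val_append m_assoc)
      ultimately show ?thesis using merge[of u "fst a" "snd a" "snd b" v] less.prems(2) ww ab
        by (intro exI[of _ "u @ [(fst a, snd a \<otimes> snd b)] @ v"]) auto
    qed
    then obtain w' where w': "length w' < length w" "valid w'" "P w'" "val w' = val w" by blast
    then show ?thesis using less.hyps[of w'] by (metis less_imp_le_nat order_trans)
  qed
qed

lemma reduced_form:
  assumes "valid w" obtains v where "reduced v" "val v = val w" "length v \<le> length w"
  using reduce[OF assms, of "\<lambda>_. True"] by blast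

lemma reduced_length_le: "reduced v \<Longrightarrow> valid w \<Longrightarrow> val v = val w \<Longrightarrow> length v \<le> length w"
proof -
  assume a: "reduced v" "valid w" "val v = val w"
  obtain u where "reduced u" "val u = val w" "length u \<le> length w" using reduced_form[OF a(2)] .
  then show "length v \<le> length w" using reduced_unique[of u v] a by simp
qed

lemma generate_word:
  assumes "x \<in> generate G (\<Union>j\<in>I. A j)" "I \<subseteq> J"
  shows "\<exists>w. valid w \<and> fst ` set w \<subseteq> I \<and> val w = x"
  using assms(1)
proof (induction rule: generate.induct)
  case one
  then show ?case by (intro exI[of _ "[]"]) simp
next
  case (incl h)
  then obtain j where "j \<in> I" "h \<in> A j" by blast
  then show ?case using assms(2) subgroup.mem_carrier[OF factor_subgroup] by (intro exI[of _ "[(j, h)]"]) auto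
next
  case (inv h)
  then obtain j where "j \<in> I" "h \<in> A j" by blast
  then show ?case
    using assms(2) subgroup.mem_carrier[OF factor_subgroup] subgroup.m_inv_closed[OF factor_subgroup]
    by (intro exI[of _ "[(j, inv h)]"]) auto
next
  case (eng h1 h2)
  then obtain u v where "valid u" "fst ` set u \<subseteq> I" "val u = h1" "valid v" "fst ` set v \<subseteq> I" "val v = h2" by blast
  then show ?case using valid_in_carrier by (intro exI[of _ "u @ v"]) (auto simp: val_append)
qed

lemma word_exists:
  assumes "x \<in> carrier G" shows "\<exists>w. valid w \<and> val w = x"
proof -
  have "generate G (\<Union>j\<in>J. A j) = carrier G" using free_product by (simp add: is_free_product_def)
  then show ?thesis using generate_word[of x J] assms by auto
qed

text \<open>Handles are attached along nonempty words; the identity can be written with a letter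
  \<open>\<one>\<close>, which \<open>valid\<close> permits.\<close>

lemma nonempty_word_exists:
  assumes "x \<in> carrier G" "J \<noteq> {}" shows "\<exists>w. valid w \<and> w \<noteq> [] \<and> val w = x"
proof -
  obtain w where w: "valid w" "val w = x" using word_exists[OF assms(1)] by blast
  obtain j where "j \<in> J" using assms(2) by blast
  then have "valid ((j, \<one>) # w)" "val ((j, \<one>) # w) = x"
    using w subgroup.one_closed[OF factor_subgroup] valid_in_carrier assms(1) by auto
  then show ?thesis by blast
qed

text \<open>The empty word bounds a disc, of characteristic 1, and every commutator adds a handle,
  which costs 2.\<close>

lemma prod_of_commutators_bounds:
  assumes "prod_of_commutators G k h" "J \<noteq> {}"
  shows "\<exists>w. valid w \<and> val w = h \<and> bounds w (1 - 2 * int k)"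
proof -
  from assms(1) obtain xs ys where len: "length xs = k" "length ys = k"
    and car: "set xs \<subseteq> carrier G" "set ys \<subseteq> carrier G" and h: "h = list_prod G (map2 (commutator G) xs ys)"
    by (auto simp: prod_of_commutators_def)
  have "length xs = length ys" using len by simp
  then have "\<exists>w. valid w \<and> val w = list_prod G (map2 (commutator G) xs ys) \<and> bounds w (1 - 2 * int (length xs))"
    using car
  proof (induction xs ys rule: list_induct2)
    case Nil
    then show ?case using bounds_Nil by (intro exI[of _ "[]"]) simp
  next
    case (Cons x xs y ys)
    then obtain w where w: "valid w" "val w = list_prod G (map2 (commutator G) xs ys)" "bounds w (1 - 2 * int (length xs))" by auto
    obtain p q where p: "valid p" "p \<noteq> []" "val p = x" and q: "valid q" "q \<noteq> []" "val q = y"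
      using nonempty_word_exists assms(2) Cons.prems by (metis insert_subset list.simps(15))
    have xy: "x \<in> carrier G" "y \<in> carrier G" using Cons.prems by auto
    have c: "in_carrier p" "in_carrier q" "in_carrier w" using p q w valid_in_carrier by auto
    have "bounds (inv_word p @ inv_word q @ p @ q @ w) (1 - 2 * int (length xs) - 2)"
      by (rule bounds_commutator[OF w(3) p(2) q(2) c(1,2)])
    moreover have "val (inv_word p @ inv_word q @ p @ q @ w) = commutator G x y \<otimes> val w"
      using c p q xy by (simp add: val_append val_inv_word commutator_def m_assoc)
    ultimately show ?case using p q w valid_inv_word
      by (intro exI[of _ "inv_word p @ inv_word q @ p @ q @ w"]) auto
  qed
  then show ?thesis using h len by auto
qed

text \<open>Reducing the word that carries the handles preserves the surface, and by uniqueness of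
  normal forms the reduction ends at \<open>v\<close>.\<close>

lemma reduced_bounds:
  assumes "prod_of_commutators G k (val v)" "reduced v" "J \<noteq> {}"
  shows "bounds v (1 - 2 * int k)"
proof -
  obtain w where w: "valid w" "val w = val v" "bounds w (1 - 2 * int k)"
    using prod_of_commutators_bounds[OF assms(1,3)] by blast
  have "\<exists>v'. reduced v' \<and> val v' = val w \<and> bounds v' (1 - 2 * int k) \<and> length v' \<le> length w"
    by (rule reduce[OF w(1), of "\<lambda>w. bounds w (1 - 2 * int k)", OF w(3)])
      (erule bounds_merge, erule bounds_delete_one)
  then obtain v' where "reduced v'" "val v' = val w" "bounds v' (1 - 2 * int k)" by blast
  then show ?thesis using reduced_unique assms(2) w by metis
qed

text \<open>The condition on the two ends also excludes single letters, so these words have length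
  at least 2.\<close>

definition cyc_reduced :: "('j \<times> 'a) list \<Rightarrow> bool" where
  "cyc_reduced w \<longleftrightarrow> reduced w \<and> w \<noteq> [] \<and> fst (hd w) \<noteq> fst (last w)"

lemma in_carrier_concat_replicate: "in_carrier u \<Longrightarrow> in_carrier (concat (replicate n u))"
  by (induction n) auto

lemma val_concat_replicate: "in_carrier u \<Longrightarrow> val (concat (replicate n u)) = val u [^] n"
proof (induction n)
  case (Suc n)
  then show ?case
    using nat_pow_Suc2[of "val u" n] by (simp add: val_append in_carrier_concat_replicate)
qed simp

lemma reduced_concat_replicate:
  assumes "cyc_reduced u" shows "reduced (concat (replicate n u))"
proof (induction n)
  case (Suc n)
  have "concat (replicate n u) = [] \<or> fst (last u) \<noteq> fst (hd (concat (replicate n u)))"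
    using assms by (cases n) (auto simp: cyc_reduced_def)
  then show ?case using Suc assms by (auto simp: reduced_append cyc_reduced_def)
qed simp

lemma length_concat_replicate: "length (concat (replicate n u)) = n * length u"
  by (induction n) auto

lemma cyc_reduced_pow_ne_one:
  assumes "cyc_reduced u" "0 < n" shows "val u [^] (n::nat) \<noteq> \<one>"
proof -
  have "concat (replicate n u) \<noteq> []" using assms by (cases n) (auto simp: cyc_reduced_def)
  then show ?thesis
    using reduced_val_ne_one[OF reduced_concat_replicate[OF assms(1)]] val_concat_replicate[of u n] assms(1)
      valid_in_carrier by (metis cyc_reduced_def reduced_valid)
qed

lemma conj_pow:
  assumes "x \<in> carrier G" "a \<in> carrier G"
  shows "(inv x \<otimes> a \<otimes> x) [^] (m::nat) = inv x \<otimes> a [^] m \<otimes> x"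
proof (induction m)
  case (Suc m)
  then show ?case using assms by (simp add: m_assoc)
qed (use assms in simp)

text \<open>The powers of a cyclically reduced word grow linearly in length, whereas the powers of a conjugate
  of an element of a factor stay bounded.\<close>
lemma cyc_reduced_in_hat:
  assumes u: "cyc_reduced u" shows "val u \<in> hatG G J A"
proof -
  have ru: "reduced u" using u by (simp add: cyc_reduced_def)
  have cu: "in_carrier u" using ru reduced_valid valid_in_carrier by blast
  have "False" if h: "j \<in> J" "x \<in> carrier G" "a \<in> A j" "val u = inv x \<otimes> a \<otimes> x" for j x a
  proof -
    obtain w where w: "valid w" "val w = x" using word_exists[OF h(2)] by blast
    define m where "m = 2 * length w + 2"
    have ac: "a \<in> carrier G" using h subgroup.mem_carrier[OF factor_subgroup] by blast
    have "a [^] m \<in> A j"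
    proof (induction m)
      case 0
      then show ?case using subgroup.one_closed[OF factor_subgroup[OF h(1)]] by simp
    next
      case (Suc m)
      then show ?case using subgroup.m_closed[OF factor_subgroup[OF h(1)]] h(3) by simp
    qed
    then have v: "valid (inv_word w @ [(j, a [^] m)] @ w)" using w valid_inv_word h by simp
    have "val (inv_word w @ [(j, a [^] m)] @ w) = inv x \<otimes> a [^] m \<otimes> x"
      using w valid_in_carrier ac h by (simp add: val_append val_inv_word m_assoc)
    also have "\<dots> = val (concat (replicate m u))"
      using conj_pow[OF h(2) ac] h(4) cu by (simp add: val_concat_replicate)
    finally have "length (concat (replicate m u)) \<le> length (inv_word w @ [(j, a [^] m)] @ w)"
      using reduced_length_le[OF reduced_concat_replicate[OF u] v] by simp
    then have "m * length u \<le> 2 * length w + 1" by (simp add: length_concat_replicate)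
    moreover have "m * 1 \<le> m * length u" using u by (intro mult_left_mono) (auto simp: cyc_reduced_def Suc_le_eq)
    ultimately show False by (simp add: m_def)
  qed
  then show ?thesis using cu by (auto simp: hatG_def)
qed

text \<open>A shortest word in the conjugacy class is taken. If it had at least two letters and both
  ends in one factor, conjugation by the last letter would bring the ends together and shorten
  it.\<close>

lemma conj_cyc_reduced:
  assumes "g \<in> carrier G"
  obtains x w where "x \<in> carrier G" "reduced w" "val w = inv x \<otimes> g \<otimes> x" "length w \<le> 1 \<or> cyc_reduced w"
proof -
  define P where "P k \<longleftrightarrow> (\<exists>x w. x \<in> carrier G \<and> reduced w \<and> val w = inv x \<otimes> g \<otimes> x \<and> length w = k)" for k
  obtain w0 where "valid w0" "val w0 = g" using word_exists[OF assms] by blast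
  then obtain w1 where "reduced w1" "val w1 = g" by (metis reduced_form)
  then have "P (length w1)" unfolding P_def using assms by (intro exI[of _ \<one>] exI[of _ w1]) simp
  then have "P (LEAST k. P k)" by (rule LeastI)
  then obtain x w where xw: "x \<in> carrier G" "reduced w" "val w = inv x \<otimes> g \<otimes> x" "length w = (LEAST k. P k)"
    unfolding P_def by blast
  have "length w \<le> 1 \<or> cyc_reduced w"
  proof (rule ccontr)
    assume "\<not> ?thesis"
    then have len: "length w \<ge> 2" and eq: "fst (hd w) = fst (last w)" using xw by (auto simp: cyc_reduced_def)
    obtain a w' where w'0: "w = a # w'" using len by (cases w) auto
    with len have w': "w = a # w'" "w' \<noteq> []" by auto
    obtain v b where v: "w' = v @ [b]" using w'(2) by (metis append_butlast_last_id)
    have ab: "fst a = fst b" using eq w' v by simp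
    have val: "fst a \<in> J" "snd a \<in> A (fst a)" "snd b \<in> A (fst a)" "valid v"
      using reduced_valid[OF xw(2)] w' v ab by auto
    have car: "snd a \<in> carrier G" "snd b \<in> carrier G" "in_carrier v"
      using val subgroup.mem_carrier[OF factor_subgroup] valid_in_carrier by auto
    have "valid ((fst a, snd b \<otimes> snd a) # v)" using val subgroup.m_closed[OF factor_subgroup] by simp
    then obtain z where z: "reduced z" "val z = val ((fst a, snd b \<otimes> snd a) # v)" "length z \<le> length ((fst a, snd b \<otimes> snd a) # v)"
      by (rule reduced_form)
    have "val z = snd b \<otimes> val w \<otimes> inv (snd b)"
      using z(2) w' v car by (simp add: val_append m_assoc)
    also have "\<dots> = inv (x \<otimes> inv (snd b)) \<otimes> g \<otimes> (x \<otimes> inv (snd b))"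
      using xw car assms by (simp add: inv_mult_group m_assoc)
    finally have "P (length z)" unfolding P_def
      using xw(1) car(2) z(1) by (intro exI[of _ "x \<otimes> inv (snd b)"] exI[of _ z] conjI) simp_all
    then have "length w \<le> length z" using xw(4) by (simp add: Least_le)
    then show False using z(3) w' v by simp
  qed
  then show ?thesis using that xw by blast
qed

end

section \<open>Coarsening to two factors\<close>

context free_prod
begin

text \<open>With two factors the letters of a reduced word alternate, so the parity of a position
  determines its factor.\<close>

definition coarse :: "'j \<Rightarrow> bool \<Rightarrow> 'a set" where
  "coarse i t = (if t then A i else generate G (\<Union>j\<in>J - {i}. A j))"

lemma factor_carrier: "j \<in> J \<Longrightarrow> x \<in> A j \<Longrightarrow> x \<in> carrier G"
  using subgroup.mem_carrier[OF factor_subgroup] .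

lemma coarse_subgroup: "i \<in> J \<Longrightarrow> subgroup (coarse i t) G"
  using factor_carrier by (auto simp: coarse_def factor_subgroup intro!: generate_is_subgroup)

lemma coarse_False_word:
  assumes "x \<in> coarse i False"
  shows "\<exists>w. reduced w \<and> i \<notin> fst ` set w \<and> val w = x"
proof -
  obtain w where w: "valid w" "fst ` set w \<subseteq> J - {i}" "val w = x"
    using generate_word[of x "J - {i}"] assms by (auto simp: coarse_def)
  have "\<exists>v. reduced v \<and> val v = val w \<and> i \<notin> fst ` set v \<and> length v \<le> length w"
    by (rule reduce[OF w(1), of "\<lambda>v. i \<notin> fst ` set v"]) (use w(2) in auto)
  then show ?thesis using w by auto
qed

text \<open>Of two consecutive letters of \<open>w\<close>, one expands to a letter of factor
  \<open>i\<close> and the other to a reduced word avoiding \<open>i\<close>, so nothing merges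
  where the expansions meet.\<close>

lemma expand_coarse_word:
  assumes i: "i \<in> J" and "\<forall>p\<in>set w. snd p \<in> coarse i (fst p) \<and> snd p \<noteq> \<one>"
    "successively (\<lambda>p q. fst p \<noteq> fst q) w" "w \<noteq> []"
  shows "\<exists>v. reduced v \<and> v \<noteq> [] \<and> val v = val w \<and> (fst (hd v) = i \<longleftrightarrow> fst (hd w))"
  using assms(2-)
proof (induction w)
  case (Cons p w)
  have "\<exists>e. reduced e \<and> e \<noteq> [] \<and> val e = snd p \<and> (\<forall>q\<in>set e. fst q = i \<longleftrightarrow> fst p)"
  proof (cases "fst p")
    case True
    then have "snd p \<in> A i" "snd p \<noteq> \<one>" using Cons.prems by (auto simp: coarse_def)
    then show ?thesis using True i factor_carrier[OF i] by (intro exI[of _ "[(i, snd p)]"]) (auto simp: reduced_Cons)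
  next
    case False
    then obtain e where e: "reduced e" "i \<notin> fst ` set e" "val e = snd p"
      using coarse_False_word[of "snd p" i] Cons.prems by auto
    moreover have "e \<noteq> []" using e Cons.prems by auto
    moreover have "\<forall>q\<in>set e. fst q = i \<longleftrightarrow> fst p" using e(2) False by force
    ultimately show ?thesis by blast
  qed
  then obtain e where e: "reduced e" "e \<noteq> []" "val e = snd p" "\<forall>q\<in>set e. fst q = i \<longleftrightarrow> fst p" by blast
  have hde: "fst (hd e) = i \<longleftrightarrow> fst p" "fst (last e) = i \<longleftrightarrow> fst p" using e(2,4) by simp_all
  show ?case
  proof (cases "w = []")
    case True
    have "snd p \<in> carrier G" using e reduced_valid valid_in_carrier by (metis val_closed)
    then show ?thesis using True e hde by (intro exI[of _ e]) simp
  next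
    case False
    then have "fst p \<noteq> fst (hd w)" and ih: "\<exists>v. reduced v \<and> v \<noteq> [] \<and> val v = val w \<and> (fst (hd v) = i \<longleftrightarrow> fst (hd w))"
      using Cons by (cases w; auto)+
    then obtain v where v: "reduced v" "v \<noteq> []" "val v = val w" "fst (hd v) = i \<longleftrightarrow> fst (hd w)" by blast
    have "reduced (e @ v)" using e v hde \<open>fst p \<noteq> fst (hd w)\<close> by (auto simp: reduced_append)
    moreover have "val (e @ v) = val (p # w)"
      using e v reduced_valid valid_in_carrier by (simp add: val_append)
    ultimately show ?thesis using e v hde by (intro exI[of _ "e @ v"]) simp
  qed
qed simp

lemma coarse_free_product:
  assumes i: "i \<in> J" shows "is_free_product G (UNIV :: bool set) (coarse i)"
  unfolding is_free_product_def
proof (intro conjI allI impI ballI)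
  show "group G" by (rule is_group)
  show "subgroup (coarse i t) G" for t using coarse_subgroup[OF i] .
  show "generate G (\<Union>t\<in>UNIV. coarse i t) = carrier G"
  proof
    show "generate G (\<Union>t\<in>UNIV. coarse i t) \<subseteq> carrier G"
      using subgroup.subset[OF coarse_subgroup[OF i]] by (intro generate_incl) blast
    have "(\<Union>j\<in>J. A j) \<subseteq> (\<Union>t\<in>UNIV. coarse i t)"
    proof
      fix x assume "x \<in> (\<Union>j\<in>J. A j)"
      then obtain j where j: "j \<in> J" "x \<in> A j" by blast
      have "x \<in> coarse i (j = i)"
        using j by (auto simp: coarse_def intro: generate.incl)
      then show "x \<in> (\<Union>t\<in>UNIV. coarse i t)" by blast
    qed
    then have "generate G (\<Union>j\<in>J. A j) \<subseteq> generate G (\<Union>t\<in>UNIV. coarse i t)" by (rule mono_generate)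
    then show "carrier G \<subseteq> generate G (\<Union>t\<in>UNIV. coarse i t)"
      using free_product by (simp add: is_free_product_def)
  qed
  fix w :: "(bool \<times> 'a) list"
  assume w: "w \<noteq> []" "\<forall>p\<in>set w. fst p \<in> UNIV \<and> snd p \<in> coarse i (fst p) \<and> snd p \<noteq> \<one>"
    "\<forall>k. Suc k < length w \<longrightarrow> fst (w ! k) \<noteq> fst (w ! Suc k)"
  then obtain v where "reduced v" "v \<noteq> []" "val v = val w"
    using expand_coarse_word[OF i, of w] by (auto simp: successively_conv_nth)
  then show "list_prod G (map snd w) \<noteq> \<one>" using reduced_val_ne_one by (metis val_def)
qed

text \<open>Maximal runs of letters outside factor \<open>i\<close> are multiplied together. The
  factors of both ends are recorded so that a cyclically reduced word stays cyclically reduced if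
  \<open>i\<close> is the factor of its first letter.\<close>

lemma coarsen_word:
  assumes i: "i \<in> J" and "reduced w" "w \<noteq> []"
  shows "\<exists>u. free_prod.reduced G (UNIV :: bool set) (coarse i) u \<and> u \<noteq> [] \<and> val u = val w
    \<and> fst (hd u) = (fst (hd w) = i) \<and> fst (last u) = (fst (last w) = i)"
proof -
  interpret c: free_prod G "UNIV :: bool set" "coarse i"
    by unfold_locales (rule coarse_free_product[OF i])
  show ?thesis using assms(2,3)
  proof (induction "length w" arbitrary: w rule: less_induct)
    case less
    obtain p w' where w: "w = p # w'" using less.prems by (cases w) auto
    show ?case
    proof (cases "fst p = i")
      case True
      have p: "snd p \<in> coarse i True" "snd p \<noteq> \<one>" "reduced w'" "snd p \<in> carrier G"
        using less.prems w True factor_carrier[OF i] by (auto simp: reduced_Cons coarse_def)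
      show ?thesis
      proof (cases "w' = []")
        case True
        then show ?thesis using p w \<open>fst p = i\<close> by (intro exI[of _ "[(True, snd p)]"]) (simp add: c.reduced_Cons)
      next
        case False
        then obtain u where u: "c.reduced u" "u \<noteq> []" "val u = val w'" "fst (hd u) = (fst (hd w') = i)" "fst (last u) = (fst (last w') = i)"
          using less.hyps[of w'] w p by auto
        have "fst (hd w') \<noteq> i" using less.prems w False True by (auto simp: reduced_Cons)
        then show ?thesis using p w u True False by (intro exI[of _ "(True, snd p) # u"]) (auto simp: c.reduced_Cons)
      qed
    next
      case False
      define x where "x = takeWhile (\<lambda>q. fst q \<noteq> i) w"
      define y where "y = dropWhile (\<lambda>q. fst q \<noteq> i) w"
      have xy: "w = x @ y" by (simp add: x_def y_def)
      have x: "x \<noteq> []" "\<forall>q\<in>set x. fst q \<noteq> i" using False by (auto simp: x_def w dest: set_takeWhileD)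
      have y: "y \<noteq> [] \<Longrightarrow> fst (hd y) = i" using hd_dropWhile[of "\<lambda>q. fst q \<noteq> i" w] by (auto simp: y_def)
      have rx: "reduced x" "reduced y" using less.prems xy by (auto simp: reduced_append)
      have cx: "in_carrier x" "in_carrier y" using rx reduced_valid valid_in_carrier by auto
      have vx: "val x \<noteq> \<one>" using reduced_val_ne_one rx x by blast
      have "valid x \<Longrightarrow> \<forall>q\<in>set x. fst q \<noteq> i \<Longrightarrow> val x \<in> coarse i False" for x
      proof (induction x)
        case Nil
        then show ?case by (simp add: coarse_def generate.one)
      next
        case (Cons q x)
        have "snd q \<in> coarse i False" using Cons.prems by (auto simp: coarse_def intro: generate.incl)
        then show ?case using Cons subgroup.m_closed[OF coarse_subgroup[OF i]] by auto
      qed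
      then have vxB: "val x \<in> coarse i False" using x rx reduced_valid by blast
      show ?thesis
      proof (cases "y = []")
        case True
        have "fst (last x) \<noteq> i" "fst (hd x) \<noteq> i" using x by auto
        then show ?thesis using vx vxB True xy x cx by (intro exI[of _ "[(False, val x)]"]) (simp add: c.reduced_Cons)
      next
        case False
        have "length y < length w" using xy x by simp
        then obtain u where u: "c.reduced u" "u \<noteq> []" "val u = val y" "fst (hd u) = (fst (hd y) = i)" "fst (last u) = (fst (last y) = i)"
          using less.hyps[of y] rx False by auto
        have "fst (hd x) \<noteq> i" using x by auto
        then show ?thesis using vx vxB xy x cx u y False
          by (intro exI[of _ "(False, val x) # u"]) (auto simp: c.reduced_Cons val_append)
      qed
    qed
  qed
qed

end

lemma alternating_bool_list:
  assumes "successively (\<noteq>) (bs :: bool list)" "k < length bs" "hd bs"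
  shows "bs ! k = even k"
  using assms(2)
proof (induction k)
  case 0
  then show ?case using assms(3) by (cases bs) auto
next
  case (Suc k)
  then show ?case using assms(1) by (auto simp: successively_conv_nth)
qed

section \<open>Surfaces bounded by alternating words\<close>

lemma image_mset_eq_plusE:
  assumes "A + B = image_mset f M"
  shows "\<exists>M1 M2. M = M1 + M2 \<and> image_mset f M1 = A \<and> image_mset f M2 = B"
  using assms
proof (induction A arbitrary: M)
  case empty
  then show ?case by (intro exI[of _ "{#}"] exI[of _ M]) simp
next
  case (add a A)
  have "a \<in># image_mset f M" by (simp flip: add.prems)
  then obtain y where y: "y \<in># M" "f y = a" by auto
  obtain M' where M: "M = add_mset y M'" using y(1) by (metis insert_DiffM)
  have "A + B = image_mset f M'" using add.prems y M by simp
  then obtain M1 M2 where "M' = M1 + M2" "image_mset f M1 = A" "image_mset f M2 = B" using add.IH by blast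
  then show ?case using M y by (intro exI[of _ "add_mset y M1"] exI[of _ M2]) simp
qed

lemma mset_eq_image_msetE:
  assumes "mset c = image_mset f M" shows "\<exists>c'. mset c' = M \<and> map f c' = c"
  using assms
proof (induction c arbitrary: M)
  case (Cons a c)
  have "a \<in># image_mset f M" by (simp flip: Cons.prems)
  then obtain y where y: "y \<in># M" "f y = a" by auto
  obtain M' where M: "M = add_mset y M'" using y(1) by (metis insert_DiffM)
  then obtain c' where "mset c' = M'" "map f c' = c" using Cons.IH[of M'] Cons.prems y by auto
  then show ?case using M y by (intro exI[of _ "y # c'"]) simp
qed simp

text \<open>Used to lift cycles of edges to cycles of positions: the same edge may occur at several
  positions, and the occurrences have to be distributed consistently.\<close>

lemma sum_mset_mset_eq_imageE:
  assumes "entries C = image_mset f M"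
  shows "\<exists>C'. image_mset (map f) C' = C \<and> entries C' = M"
  using assms
proof (induction C arbitrary: M)
  case empty
  then show ?case by (intro exI[of _ "{#}"]) simp
next
  case (add c C)
  then obtain M1 M2 where M: "M = M1 + M2" "image_mset f M1 = mset c" "image_mset f M2 = entries C"
    using image_mset_eq_plusE[of "mset c" "entries C" f M] by auto
  obtain c' where c': "mset c' = M1" "map f c' = c" using mset_eq_image_msetE[of c f M1] M by auto
  obtain C' where C': "image_mset (map f) C' = C" "entries C' = M2" using add.IH[of M2] M by auto
  show ?case using M c' C' by (intro exI[of _ "add_mset c' C'"]) simp
qed

lemma image_mset_nth: "image_mset ((!) c) (mset_set {..<length c}) = mset c"
proof -
  have "mset_set {..<length c} = mset [0..<length c]" by (simp add: mset_upt lessThan_atLeast0)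
  then have "image_mset ((!) c) (mset_set {..<length c}) = mset (map ((!) c) [0..<length c])" by simp
  then show ?thesis by (simp only: map_nth)
qed

lemma graph_msetE:
  assumes "finite S" "image_mset fst T = mset_set S"
  shows "\<exists>\<phi>. T = image_mset (\<lambda>p. (p, \<phi> p)) (mset_set S)"
  using assms
proof (induction S arbitrary: T rule: finite_induct)
  case (insert x S)
  have "x \<in># image_mset fst T" using insert by simp
  then obtain q where q: "(x, q) \<in># T" by auto
  then obtain T' where T: "T = add_mset (x, q) T'" by (metis insert_DiffM)
  then obtain \<phi> where \<phi>: "T' = image_mset (\<lambda>p. (p, \<phi> p)) (mset_set S)" using insert.IH[of T'] insert.prems insert.hyps by auto
  have "image_mset (\<lambda>p. (p, \<phi> p)) (mset_set S) = image_mset (\<lambda>p. (p, (\<phi>(x := q)) p)) (mset_set S)"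
    using insert.hyps by (intro image_mset_cong) auto
  then show ?case using T \<phi> insert.hyps by (intro exI[of _ "\<phi>(x := q)"]) simp
qed simp

lemma walk_cong:
  "(\<And>e. e \<in> set es \<Longrightarrow> s e = s' e \<and> t e = t' e) \<Longrightarrow> walk s t x es y \<longleftrightarrow> walk s' t' x es y"
  by (induction es arbitrary: x) auto

lemma walk_nth:
  "walk s t x es y \<Longrightarrow> k < length es \<Longrightarrow> t (es ! k) = (if Suc k < length es then s (es ! Suc k) else y)"
proof (induction es arbitrary: x k)
  case (Cons e es)
  show ?case
  proof (cases k)
    case 0
    then show ?thesis using Cons.prems by (cases es) auto
  next
    case (Suc k')
    then show ?thesis using Cons.prems Cons.IH[of "t e" k'] by auto
  qed
qed simp

lemma walk_hd: "walk s t x es y \<Longrightarrow> es \<noteq> [] \<Longrightarrow> s (es ! 0) = x"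
  by (cases es) auto

lemma closed_walk_turn:
  assumes "walk s t x c x" "k < length c"
  shows "t (c ! k) = s (c ! (Suc k mod length c))"
proof -
  have "c \<noteq> []" using assms by auto
  show ?thesis
  proof (cases "Suc k < length c")
    case True
    then show ?thesis using walk_nth[OF assms] by simp
  next
    case False
    then have "Suc k = length c" using assms by simp
    then show ?thesis using walk_nth[OF assms] walk_hd[OF assms(1) \<open>c \<noteq> []\<close>] by simp
  qed
qed

definition pos_cycle :: "(nat \<Rightarrow> nat) \<Rightarrow> (nat \<Rightarrow> nat) \<Rightarrow> nat list \<Rightarrow> bool" where
  "pos_cycle s t c \<longleftrightarrow> c \<noteq> [] \<and> (\<exists>x. walk s t x c x) \<and> (\<exists>b. \<forall>p\<in>set c. even p = b)"

text \<open>Here \<open>\<kappa> p\<close> is the vertex where position \<open>p\<close> starts; the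
  position ends where its successor in the word starts. Positions, unlike edges, are pairwise
  distinct, so a single occurrence can be detached from its vertex.\<close>

definition pos_config :: "nat \<Rightarrow> (nat \<Rightarrow> nat) \<Rightarrow> nat list multiset \<Rightarrow> bool" where
  "pos_config l \<kappa> C \<longleftrightarrow> entries C = mset_set {..<l}
     \<and> (\<forall>c\<in>#C. pos_cycle \<kappa> (\<lambda>p. \<kappa> (Suc p mod l)) c)"

lemma pos_cycle_rotate: "pos_cycle s t (u @ v) \<Longrightarrow> pos_cycle s t (v @ u)"
  using walk_rotate[of s t u v] by (auto simp: pos_cycle_def)

context group
begin

section \<open>Splitting vertices\<close>

definition ptriv :: "(nat \<Rightarrow> 'j \<times> 'a) \<Rightarrow> nat list \<Rightarrow> bool" where
  "ptriv f c \<longleftrightarrow> val (map f c) = \<one>"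

lemma pos_extract:
  assumes cyc: "\<forall>c\<in>#C. pos_cycle s t c" and e: "e \<in># entries C"
    and car: "\<forall>c\<in>#C. in_carrier (map f c)"
  obtains \<alpha> C' where "\<forall>c\<in>#add_mset (e # \<alpha>) C'. pos_cycle s t c"
    "size (filter_mset (ptriv f) (add_mset (e # \<alpha>) C')) = size (filter_mset (ptriv f) C)"
    "entries C = mset (e # \<alpha>) + entries C'"
    "\<forall>c\<in>#add_mset (e # \<alpha>) C'. in_carrier (map f c)"
proof -
  obtain c where c: "c \<in># C" "e \<in> set c" using e by auto
  then obtain C' where C': "C = add_mset c C'" by (metis insert_DiffM)
  obtain u v where uv: "c = u @ e # v" using c(2) by (meson split_list)
  have "in_carrier (map f u)" "in_carrier (map f (e # v))" using car C' uv by auto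
  then have "ptriv f (e # v @ u) = ptriv f c" using val_rotate[of "map f (e # v)" "map f u"] by (simp add: ptriv_def uv)
  moreover have "pos_cycle s t (e # v @ u)" using cyc C' uv pos_cycle_rotate[of s t u "e # v"] by simp
  ultimately show ?thesis using that[of "v @ u" C'] cyc car C' uv by simp
qed

text \<open>The start of \<open>e\<close> and the end of \<open>h\<close> move to a common new
  vertex, so \<open>e\<close> is made to follow \<open>h\<close>. If both lie on one cycle, it is
  cut in two unless \<open>e\<close> already follows \<open>h\<close>; otherwise their two cycles
  are joined, and the joined cycle is trivial if both were. At most one trivial cycle is
  lost.\<close>

lemma pos_swap:
  fixes f :: "nat \<Rightarrow> 'j \<times> 'a"
  assumes cyc: "\<forall>c\<in>#C. pos_cycle s t c" and car: "\<forall>c\<in>#C. in_carrier (map f c)"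
    and cnt: "count (entries C) e = 1" "count (entries C) h = 1"
    and col: "even e = even h" and turn: "s e = t h" "s' e = t' h"
    and same: "\<And>x. x \<in># entries C \<Longrightarrow> x \<noteq> e \<Longrightarrow> s' x = s x"
      "\<And>x. x \<in># entries C \<Longrightarrow> x \<noteq> h \<Longrightarrow> t' x = t x"
  shows "\<exists>C'. entries C' = entries C \<and> (\<forall>c\<in>#C'. pos_cycle s' t' c)
    \<and> size (filter_mset (ptriv f) C) \<le> size (filter_mset (ptriv f) C') + 1"
proof -
  define M where "M = entries C"
  have h: "h \<in># M" and e: "e \<in># M" using cnt unfolding M_def by (metis count_inI zero_neq_one)+
  obtain \<gamma> C1 where C1: "\<forall>c\<in>#add_mset (h # \<gamma>) C1. pos_cycle s t c"
    "size (filter_mset (ptriv f) (add_mset (h # \<gamma>) C1)) = size (filter_mset (ptriv f) C)"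
    "M = mset (h # \<gamma>) + entries C1" "\<forall>c\<in>#add_mset (h # \<gamma>) C1. in_carrier (map f c)"
    using pos_extract[OF cyc h[unfolded M_def] car] unfolding M_def by metis
  have cntM: "count M e = 1" "count M h = 1" using cnt by (simp_all add: M_def)
  have hn: "h \<notin> set \<gamma>" "h \<notin># entries C1"
  proof -
    have "count (mset (h # \<gamma>)) h = Suc (count (mset \<gamma>) h)" by simp
    then have z: "count (mset \<gamma>) h = 0" "count (entries C1) h = 0"
      using cntM(2) unfolding C1(3) count_union by linarith+
    show "h \<notin> set \<gamma>" using z(1) by simp
    show "h \<notin># entries C1" using z(2) by (simp only: not_in_iff)
  qed
  have wg: "walk s t (t h) \<gamma> (s h)" using C1(1) by (auto simp: pos_cycle_def)
  have colg: "\<forall>p\<in>set \<gamma>. even p = even h" using C1(1) by (auto simp: pos_cycle_def)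
  have cong: "walk s' t' x c y" if w: "walk s t x c y" and sub: "set c \<subseteq> set_mset M" and no: "e \<notin> set c" "h \<notin> set c" for x c y
  proof -
    have "walk s t x c y = walk s' t' x c y"
    proof (rule walk_cong)
      fix z assume "z \<in> set c"
      then have "z \<in># M" "z \<noteq> e" "z \<noteq> h" using sub no by auto
      then show "s z = s' z \<and> t z = t' z" using same unfolding M_def by simp
    qed
    then show ?thesis using w by simp
  qed
  have sub_in: "set c \<subseteq> set_mset (entries D)" if "c \<in># D" for c and D :: "nat list multiset"
    using that by auto
  have keep: "\<forall>c\<in>#D. pos_cycle s' t' c" if D: "D \<subseteq># C1" "e \<notin># entries D" for D
  proof
    fix c assume c: "c \<in># D"
    then have cC: "c \<in># C1" using D(1) mset_subset_eqD by metis
    have "set c \<subseteq> set_mset M" unfolding C1(3) using sub_in[OF cC] by auto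
    moreover have "e \<notin> set c" using sub_in[OF c] D(2) by auto
    moreover have "h \<notin> set c" using sub_in[OF cC] hn(2) by auto
    moreover have "pos_cycle s t c" using C1(1) cC by simp
    ultimately show "pos_cycle s' t' c" using cong unfolding pos_cycle_def by blast
  qed
  have subg: "set \<gamma> \<subseteq> set_mset M" unfolding C1(3) by auto
  have e_split: "count (mset (h # \<gamma>)) e + count (entries C1) e = 1" using cntM(1) unfolding C1(3) count_union .
  show ?thesis unfolding M_def[symmetric]
  proof (cases "e = h")
    case True
    have e1: "e \<notin># entries C1" using True hn by simp
    have k1: "\<forall>c\<in>#C1. pos_cycle s' t' c" using keep[of C1] e1 by simp
    have ch: "pos_cycle s' t' [h]" using turn(2) True by (auto simp: pos_cycle_def)
    show "\<exists>C'. entries C' = M \<and> (\<forall>c\<in>#C'. pos_cycle s' t' c)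
      \<and> size (filter_mset (ptriv f) C) \<le> size (filter_mset (ptriv f) C') + 1"
    proof (cases "\<gamma> = []")
      case g: True
      then show ?thesis using C1 k1 ch by (intro exI[of _ "add_mset [h] C1"]) auto
    next
      case False
      have "walk s' t' (t h) \<gamma> (t h)" using cong[OF wg subg] hn True turn(1) by simp
      then have "pos_cycle s' t' \<gamma>" using False colg by (auto simp: pos_cycle_def)
      then show ?thesis using C1 k1 ch by (intro exI[of _ "add_mset [h] (add_mset \<gamma> C1)"]) (auto split: if_splits)
    qed
  next
    case False
    have s'h: "s' h = s h" using same(1)[of h] h False unfolding M_def by simp
    have t'e: "t' e = t e" using same(2)[of e] e False unfolding M_def by simp
    show "\<exists>C'. entries C' = M \<and> (\<forall>c\<in>#C'. pos_cycle s' t' c)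
      \<and> size (filter_mset (ptriv f) C) \<le> size (filter_mset (ptriv f) C') + 1"
    proof (cases "e \<in> set \<gamma>")
      case True
      then obtain \<delta> \<epsilon> where g: "\<gamma> = \<delta> @ e # \<epsilon>" by (meson split_list)
      have cnt0: "count (mset \<delta>) e = 0" "count (mset \<epsilon>) e = 0" "count (entries C1) e = 0"
      proof -
        have "count (mset (h # \<gamma>)) e = count (mset \<delta>) e + 1 + count (mset \<epsilon>) e" using False by (simp add: g)
        then show "count (mset \<delta>) e = 0" "count (mset \<epsilon>) e = 0" "count (entries C1) e = 0"
          using e_split by linarith+
      qed
      have e1: "e \<notin> set \<delta>" "e \<notin> set \<epsilon>" using cnt0(1,2) by simp_all
      have e1': "e \<notin># entries C1" using cnt0(3) by (simp only: not_in_iff)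
      have k1: "\<forall>c\<in>#C1. pos_cycle s' t' c" using keep[OF subset_mset.order_refl e1'] .
      have wd: "walk s t (t h) \<delta> (t h)" and we: "walk s t (t e) \<epsilon> (s h)"
        using wg turn(1) by (auto simp: g walk_append)
      have wd': "walk s' t' (t h) \<delta> (t h)" by (rule cong[OF wd]) (use subg hn e1 g in auto)
      have we': "walk s' t' (t e) \<epsilon> (s h)" by (rule cong[OF we]) (use subg hn e1 g in auto)
      have pc: "pos_cycle s' t' (h # e # \<epsilon>)"
        using we' s'h t'e turn(2) colg col g by (auto simp: pos_cycle_def)
      show ?thesis
      proof (cases "\<delta> = []")
        case True
        then have "h # e # \<epsilon> = h # \<gamma>" using g by simp
        then show ?thesis using C1 k1 pc by (intro exI[of _ "add_mset (h # e # \<epsilon>) C1"]) (simp del: filter_mset_add_mset)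
      next
        case False
        then have "pos_cycle s' t' \<delta>" using wd' colg g by (auto simp: pos_cycle_def)
        then show ?thesis using C1 k1 pc by (intro exI[of _ "add_mset \<delta> (add_mset (h # e # \<epsilon>) C1)"]) (auto simp: g split: if_splits)
      qed
    next
      case nin: False
      then have ce: "count (mset (h # \<gamma>)) e = 0" using False by (simp only: count_mset_0_iff) simp
      then have "count (entries C1) e = 1" using e_split by linarith
      then have eC1: "e \<in># entries C1" by (intro count_inI) simp
      have cyc1: "\<forall>c\<in>#C1. pos_cycle s t c" and car1: "\<forall>c\<in>#C1. in_carrier (map f c)" using C1 by simp_all
      obtain \<delta> C2 where C2: "\<forall>c\<in>#add_mset (e # \<delta>) C2. pos_cycle s t c"
        "size (filter_mset (ptriv f) (add_mset (e # \<delta>) C2)) = size (filter_mset (ptriv f) C1)"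
        "entries C1 = mset (e # \<delta>) + entries C2"
        "\<forall>c\<in>#add_mset (e # \<delta>) C2. in_carrier (map f c)"
        using pos_extract[OF cyc1 eC1 car1] by metis
      have e2: "e \<notin> set \<delta>" "e \<notin># entries C2"
      proof -
        have "count (mset (e # \<delta>)) e = Suc (count (mset \<delta>) e)" by simp
        then have z: "count (mset \<delta>) e = 0" "count (entries C2) e = 0"
          using e_split ce unfolding C2(3) count_union by linarith+
        show "e \<notin> set \<delta>" using z(1) by simp
        show "e \<notin># entries C2" using z(2) by (simp only: not_in_iff)
      qed
      have hd: "h \<notin> set \<delta>" "h \<notin># entries C2" using hn(2) unfolding C2(3) by auto
      have wd: "walk s t (t e) \<delta> (t h)" using C2(1) turn(1) by (auto simp: pos_cycle_def)
      have cold: "\<forall>p\<in>set \<delta>. even p = even e" using C2(1) by (auto simp: pos_cycle_def)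
      have wd': "walk s' t' (t e) \<delta> (t h)"
        by (rule cong[OF wd]) (use e2 hd in \<open>auto simp: C1(3) C2(3)\<close>)
      have wg': "walk s' t' (t h) \<gamma> (s h)" by (rule cong[OF wg subg nin hn(1)])
      have pc: "pos_cycle s' t' (h # e # \<delta> @ \<gamma>)"
        using wd' wg' s'h t'e turn(2) colg cold col by (auto simp: pos_cycle_def walk_append)
      have k2: "\<forall>c\<in>#C2. pos_cycle s' t' c"
      proof
        fix c assume c: "c \<in># C2"
        have "set c \<subseteq> set_mset M" unfolding C1(3) C2(3) using sub_in[OF c] by auto
        moreover have "e \<notin> set c" "h \<notin> set c" using sub_in[OF c] e2(2) hd(2) by auto
        moreover have "pos_cycle s t c" using C2(1) c by simp
        ultimately show "pos_cycle s' t' c" using cong unfolding pos_cycle_def by blast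
      qed
      have tr: "ptriv f (h # e # \<delta> @ \<gamma>)" if pt: "ptriv f (h # \<gamma>)" "ptriv f (e # \<delta>)"
      proof -
        have c: "snd (f h) \<in> carrier G" "in_carrier (map f \<gamma>)" "snd (f e) \<in> carrier G" "in_carrier (map f \<delta>)"
          using C1(4) C2(4) by simp_all
        have "snd (f e) \<otimes> (val (map f \<delta>) \<otimes> val (map f \<gamma>)) = (snd (f e) \<otimes> val (map f \<delta>)) \<otimes> val (map f \<gamma>)"
          using c by (simp add: m_assoc)
        then show ?thesis using pt c by (simp add: ptriv_def val_append)
      qed
      show ?thesis
      proof (intro exI[of _ "add_mset (h # e # \<delta> @ \<gamma>) C2"] conjI)
        show "sum_mset (image_mset mset (add_mset (h # e # \<delta> @ \<gamma>) C2)) = M" unfolding C1(3) C2(3) by simp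
        show "\<forall>c\<in>#add_mset (h # e # \<delta> @ \<gamma>) C2. pos_cycle s' t' c" using pc k2 by simp
        show "size (filter_mset (ptriv f) C) \<le> size (filter_mset (ptriv f) (add_mset (h # e # \<delta> @ \<gamma>) C2)) + 1"
          using C1(2) C2(2) tr by (auto split: if_splits)
      qed
    qed
  qed
qed

end

lemma pred_mod:
  assumes "q < (l::nat)" shows "Suc ((q + l - 1) mod l) mod l = q"
proof -
  have "Suc ((q + l - 1) mod l) mod l = Suc (q + l - 1) mod l" by (rule mod_Suc_eq)
  then show ?thesis using assms by simp
qed

lemma pred_mod_unique:
  assumes "x < (l::nat)" "Suc x mod l = q" shows "x = (q + l - 1) mod l"
proof (cases "Suc x = l")
  case True
  then show ?thesis using assms by auto
next
  case False
  then have "q = Suc x" using assms by simp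
  then show ?thesis using assms by simp
qed

context group
begin

lemma pos_config_carrier:
  assumes "pos_config l \<kappa> C" "\<forall>p<l. snd (f p) \<in> carrier G" "c \<in># C"
  shows "set c \<subseteq> {..<l}" "in_carrier (map f c)"
proof -
  have "set c \<subseteq> set_mset (entries C)" using assms(3) by auto
  also have "\<dots> = {..<l}" using assms(1) by (simp only: pos_config_def finite_set_mset_mset_set finite_lessThan)
  finally show "set c \<subseteq> {..<l}" .
  then show "in_carrier (map f c)" using assms(2) by (auto simp: in_carrier_def)
qed

text \<open>The two junctions of the turn after \<open>p\<close> are detached from a vertex carrying a second even turn; rejoining
  the odd cycles accordingly destroys at most one trivial cycle.\<close>
lemma split_vertex:
  assumes pc: "pos_config l \<kappa> C" and f: "\<forall>p<l. snd (f p) \<in> carrier G" and evl: "even l"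
    and p: "p < l" "even p" and p2: "p2 < l" "even p2" "p2 \<noteq> p" "\<kappa> (Suc p2) = \<kappa> (Suc p)"
  shows "\<exists>\<kappa>' C'. pos_config l \<kappa>' C' \<and> card (\<kappa> ` {..<l}) < card (\<kappa>' ` {..<l})
    \<and> size (filter_mset (ptriv f) C) \<le> size (filter_mset (ptriv f) C') + 1"
proof -
  define t where "t = (\<lambda>p. \<kappa> (Suc p mod l))"
  have sum: "entries C = mset_set {..<l}" and cyc: "\<forall>c\<in>#C. pos_cycle \<kappa> t c"
    using pc by (simp_all add: pos_config_def t_def)
  have Sp: "Suc x < l" if "x < l" "even x" for x using that evl by (metis Suc_lessI even_Suc)
  have car: "\<forall>c\<in>#C. in_carrier (map f c)" using pos_config_carrier(2)[OF pc f] by blast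
  have "p \<in># entries C" unfolding sum using p by simp
  then obtain \<alpha> C1 where C1: "\<forall>c\<in>#add_mset (p # \<alpha>) C1. pos_cycle \<kappa> t c"
    "size (filter_mset (ptriv f) (add_mset (p # \<alpha>) C1)) = size (filter_mset (ptriv f) C)"
    "mset_set {..<l} = mset (p # \<alpha>) + entries C1" "\<forall>c\<in>#add_mset (p # \<alpha>) C1. in_carrier (map f c)"
    using pos_extract[OF cyc _ car] unfolding sum by metis
  define S where "S = entries C1"
  have cnt: "count (mset (p # \<alpha>)) x + count S x = (if x < l then 1 else 0)" for x
  proof -
    have "count (mset_set {..<l}) x = count (mset (p # \<alpha>)) x + count S x" unfolding C1(3) S_def count_union ..
    then show ?thesis by (simp add: count_mset_set')
  qed
  have inl: "x < l" if "x \<in> set (p # \<alpha>)" for x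
    using cnt[of x] that by (metis add_is_0 count_mset_0_iff)
  have dis: "x \<notin># S" if "x \<in> set (p # \<alpha>)" for x
  proof -
    have "count (mset (p # \<alpha>)) x \<noteq> 0" using that by (simp only: count_mset_0_iff) simp
    moreover have "count (mset (p # \<alpha>)) x + count S x \<le> 1" unfolding cnt by simp
    ultimately have "count S x = 0" by linarith
    then show ?thesis by (simp only: not_in_iff)
  qed
  have pal: "\<forall>x\<in>set \<alpha>. even x" using C1(1) p by (auto simp: pos_cycle_def)
  have wa: "walk \<kappa> t (t p) \<alpha> (\<kappa> p)" using C1(1) by (auto simp: pos_cycle_def)
  have pna: "p \<notin> set \<alpha>"
  proof -
    have "count (mset (p # \<alpha>)) p = Suc (count (mset \<alpha>) p)" by simp
    then have "count (mset \<alpha>) p = 0" using cnt[of p] by (simp split: if_splits)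
    then show ?thesis by simp
  qed
  \<comment> \<open>The position \<open>q\<close> follows \<open>p\<close> on its even cycle; for
    empty \<open>\<alpha>\<close> it is \<open>p\<close> itself.\<close>
  define q where "q = hd (\<alpha> @ [p])"
  have q: "q \<in> set (p # \<alpha>)" "even q" "q < l" "\<kappa> q = t p"
  proof -
    show q1: "q \<in> set (p # \<alpha>)" by (cases \<alpha>) (auto simp: q_def)
    then show "even q" "q < l" using pal p inl by auto
    show "\<kappa> q = t p" using wa by (cases \<alpha>) (auto simp: q_def)
  qed
  \<comment> \<open>The new vertex is to carry just two turns: the even one from \<open>p\<close> to
    \<open>q\<close>, and the odd one from \<open>h\<close>, the position before \<open>q\<close>,
    to \<open>e\<close>, the position after \<open>p\<close>.\<close>
  define e where "e = Suc p"
  define h where "h = (q + l - 1) mod l"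
  have e: "e < l" "odd e" using Sp p by (auto simp: e_def)
  have l0: "0 < l" using p by simp
  have h: "h < l" "odd h" "Suc h mod l = q"
  proof -
    show "h < l" using l0 by (simp add: h_def)
    have "odd (q + l - 1)" using q evl l0 by simp
    then show "odd h" using evl by (simp add: h_def dvd_mod_iff)
    show "Suc h mod l = q" unfolding h_def by (rule pred_mod[OF q(3)])
  qed
  obtain n where n: "n \<notin> \<kappa> ` {..<l}" by (meson ex_new_if_finite finite_imageI finite_lessThan infinite_UNIV_nat)
  define \<kappa>' where "\<kappa>' = \<kappa>(e := n, q := n)"
  define t' where "t' = (\<lambda>p. \<kappa>' (Suc p mod l))"
  have tp: "t p = \<kappa> e" using e by (simp add: t_def e_def)
  have inS: "x \<in># S \<longleftrightarrow> x < l \<and> x \<notin> set (p # \<alpha>)" for x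
  proof -
    have "x \<in># mset_set {..<l} \<longleftrightarrow> x \<in> set (p # \<alpha>) \<or> x \<in># S" unfolding C1(3) S_def union_iff by simp
    then show ?thesis using dis inl by auto
  qed
  have cS: "count S x = 1" if "x < l" "odd x" for x
  proof -
    have "count (mset (p # \<alpha>)) x = 0" using that p pal by (simp only: count_mset_0_iff) auto
    then show ?thesis using cnt[of x] that by simp
  qed
  have "\<exists>C'. entries C' = entries C1 \<and> (\<forall>c\<in>#C'. pos_cycle \<kappa>' t' c)
    \<and> size (filter_mset (ptriv f) C1) \<le> size (filter_mset (ptriv f) C') + 1"
  proof (rule pos_swap)
    show "\<forall>c\<in>#C1. pos_cycle \<kappa> t c" "\<forall>c\<in>#C1. in_carrier (map f c)" using C1 by simp_all
    show "count (entries C1) e = 1" "count (entries C1) h = 1"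
      using cS e h unfolding S_def by blast+
    show "even e = even h" using e h by simp
    show "\<kappa> e = t h" using q(4) h(3) tp by (simp add: t_def)
    show "\<kappa>' e = t' h" using h(3) by (simp add: t'_def \<kappa>'_def)
    fix x assume "x \<in># entries C1"
    then have x: "x < l" "x \<notin> set (p # \<alpha>)" using inS[of x] unfolding S_def by simp_all
    show "x \<noteq> e \<Longrightarrow> \<kappa>' x = \<kappa> x" using x q(1) by (auto simp: \<kappa>'_def)
    assume "x \<noteq> h"
    then have "Suc x mod l \<noteq> q" using pred_mod_unique[OF x(1)] by (auto simp: h_def)
    moreover have "Suc x mod l \<noteq> e"
    proof
      assume "Suc x mod l = e"
      then have "Suc x = Suc p" using x(1) by (cases "Suc x = l") (auto simp: e_def)
      then show False using x(2) by simp
    qed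
    ultimately show "t' x = t x" by (simp add: t'_def t_def \<kappa>'_def)
  qed
  then obtain C2 where C2: "entries C2 = entries C1" "\<forall>c\<in>#C2. pos_cycle \<kappa>' t' c"
    "size (filter_mset (ptriv f) C1) \<le> size (filter_mset (ptriv f) C2) + 1" by blast
  have t'p: "t' p = n" using e by (simp add: t'_def \<kappa>'_def e_def)
  have "pos_cycle \<kappa>' t' (p # \<alpha>)"
  proof -
    have even_same: "t' x = t x" if "even x" "x \<noteq> p" "x < l" for x
      using that Sp[of x] q(2) by (auto simp: t'_def t_def \<kappa>'_def e_def)
    have even_same': "\<kappa>' x = \<kappa> x" if "even x" "x \<noteq> q" for x
      using that e by (auto simp: \<kappa>'_def)
    have w: "\<exists>x. walk \<kappa>' t' x (p # \<alpha>) x"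
    proof (cases \<alpha>)
      case Nil
      then show ?thesis using t'p by (auto simp: q_def \<kappa>'_def)
    next
      case (Cons a \<beta>)
      then have qa: "q = a" by (simp add: q_def)
      have "a \<notin> set \<beta>"
      proof -
        have "count (mset (p # \<alpha>)) a = 1 + count (mset \<beta>) a" using Cons pna by simp
        then have "count (mset \<beta>) a = 0" using cnt[of a] by (simp split: if_splits)
        then show ?thesis by simp
      qed
      moreover have "walk \<kappa> t (t a) \<beta> (\<kappa> p)" using wa Cons by simp
      moreover have "walk \<kappa> t (t a) \<beta> (\<kappa> p) = walk \<kappa>' t' (t a) \<beta> (\<kappa> p)"
      proof (rule walk_cong)
        fix x assume x: "x \<in> set \<beta>"
        then have "even x" "x \<noteq> p" "x < l" "x \<noteq> q" using pal pna Cons inl qa \<open>a \<notin> set \<beta>\<close> by auto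
        then show "\<kappa> x = \<kappa>' x \<and> t x = t' x" using even_same even_same' by simp
      qed
      moreover have "t' a = t a" using even_same[of a] pal pna Cons inl by auto
      moreover have "\<kappa>' p = \<kappa> p" using even_same'[of p] p qa pna Cons by auto
      moreover have "\<kappa>' a = n" using qa by (simp add: \<kappa>'_def)
      ultimately show ?thesis using t'p Cons by auto
    qed
    then show ?thesis using pal p by (auto simp: pos_cycle_def)
  qed
  then have "pos_config l \<kappa>' (add_mset (p # \<alpha>) C2)"
    using C1(3) C2(1,2) by (simp add: pos_config_def t'_def)
  moreover have "size (filter_mset (ptriv f) C) \<le> size (filter_mset (ptriv f) (add_mset (p # \<alpha>) C2)) + 1"
    using C1(2) C2(3) by auto
  \<comment> \<open>The old vertex survives because the turn after \<open>p2\<close> still passes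
    through it, and \<open>n\<close> is added.\<close>
  moreover have "card (\<kappa> ` {..<l}) < card (\<kappa>' ` {..<l})"
  proof -
    have "Suc p2 \<noteq> e" "Suc p2 \<noteq> q" "Suc p2 < l" using p2 q Sp by (auto simp: e_def)
    then have v: "\<kappa>' (Suc p2) = \<kappa> e" using p2 by (simp add: \<kappa>'_def e_def)
    have "\<kappa> x \<in> \<kappa>' ` {..<l}" if "x < l" for x
    proof (cases "x = e \<or> x = q")
      case True
      then have "\<kappa> x = \<kappa>' (Suc p2)" using v q(4) tp by auto
      then show ?thesis using \<open>Suc p2 < l\<close> by blast
    next
      case False
      then have "\<kappa> x = \<kappa>' x" by (simp add: \<kappa>'_def)
      then show ?thesis using that by blast
    qed
    moreover have "n \<in> \<kappa>' ` {..<l}" using q(3) by (force simp: \<kappa>'_def)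
    ultimately have "insert n (\<kappa> ` {..<l}) \<subseteq> \<kappa>' ` {..<l}" by auto
    then have "card (insert n (\<kappa> ` {..<l})) \<le> card (\<kappa>' ` {..<l})" by (intro card_mono) auto
    then show ?thesis using n by simp
  qed
  ultimately show ?thesis by blast
qed

text \<open>Each split raises the number of vertices, which never exceeds \<open>l\<close>, and does
  not lower the sum of vertices and trivial cycles.\<close>

lemma split_all_vertices:
  assumes "pos_config l \<kappa> C" "\<forall>p<l. snd (f p) \<in> carrier G" "even l"
    "B \<le> card (\<kappa> ` {..<l}) + size (filter_mset (ptriv f) C)"
  shows "\<exists>\<kappa>' C'. pos_config l \<kappa>' C' \<and> B \<le> card (\<kappa>' ` {..<l}) + size (filter_mset (ptriv f) C')
    \<and> inj_on (\<lambda>p. \<kappa>' (Suc p)) {p. p < l \<and> even p}"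
  using assms(1,4)
proof (induction "l - card (\<kappa> ` {..<l})" arbitrary: \<kappa> C rule: less_induct)
  case less
  show ?case
  proof (cases "inj_on (\<lambda>p. \<kappa> (Suc p)) {p. p < l \<and> even p}")
    case True
    then show ?thesis using less.prems by blast
  next
    case False
    then obtain p p2 where "p < l" "even p" "p2 < l" "even p2" "p2 \<noteq> p" "\<kappa> (Suc p2) = \<kappa> (Suc p)"
      by (auto simp: inj_on_def)
    then obtain \<kappa>' C' where k: "pos_config l \<kappa>' C'" "card (\<kappa> ` {..<l}) < card (\<kappa>' ` {..<l})"
      "size (filter_mset (ptriv f) C) \<le> size (filter_mset (ptriv f) C') + 1"
      using split_vertex[OF less.prems(1) assms(2,3)] by blast
    have "card (\<kappa>' ` {..<l}) \<le> l" using card_image_le[of "{..<l}" \<kappa>'] by simp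
    then have "l - card (\<kappa>' ` {..<l}) < l - card (\<kappa> ` {..<l})" using k(2) by linarith
    moreover have "B \<le> card (\<kappa>' ` {..<l}) + size (filter_mset (ptriv f) C')" using less.prems(2) k(2,3) by linarith
    ultimately show ?thesis using less.hyps[OF _ k(1)] by blast
  qed
qed

lemma bounds_pos_config:
  fixes w :: "(bool \<times> 'a) list"
  assumes "bounds w \<chi>" "w \<noteq> []" "\<forall>p<length w. fst (w ! p) = even p"
  shows "\<exists>\<kappa> C. pos_config (length w) \<kappa> C
    \<and> \<chi> + int (length w) \<le> int (card (\<kappa> ` {..<length w}) + size (filter_mset (ptriv ((!) w)) C))"
proof -
  define l where "l = length w"
  from assms(1) obtain b es C where es: "map lab es = w" and cf: "config b es C" and sc: "\<chi> \<le> score b es C"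
    by (auto simp: bounds_def)
  have len: "length es = l" using es by (auto simp: l_def)
  have l0: "0 < l" using assms(2) by (simp add: l_def)
  define \<kappa> where "\<kappa> p = src (es ! p)" for p
  have wk: "walk src tgt b es b" using cf by (simp add: config_def)
  have tg: "tgt (es ! p) = \<kappa> (Suc p mod l)" if "p < l" for p
    using closed_walk_turn[OF wk, of p] that by (simp add: len \<kappa>_def)
  have lb: "lab (es ! p) = w ! p" if "p < l" for p using that len es by (metis nth_map)
  have "mset es = image_mset ((!) es) (mset_set {..<l})"
    using image_mset_nth[of es] by (simp add: len)
  then have "entries C = image_mset ((!) es) (mset_set {..<l})" using cf by (simp add: config_def)
  then obtain C' where C': "image_mset (map ((!) es)) C' = C" "entries C' = mset_set {..<l}"
    using sum_mset_mset_eq_imageE by blast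
  have sub: "set c \<subseteq> {..<l}" if "c \<in># C'" for c
  proof -
    have "set c \<subseteq> set_mset (entries C')" using that by auto
    then show ?thesis unfolding C'(2) by simp
  qed
  have "pos_cycle \<kappa> (\<lambda>p. \<kappa> (Suc p mod l)) c" if c: "c \<in># C'" for c
  proof -
    have "mono_cycle (map ((!) es) c)" using cf C'(1) c by (auto simp: config_def)
    then obtain x j where m: "c \<noteq> []" "walk src tgt x (map ((!) es) c) x" "\<forall>p\<in>set c. fst (lab (es ! p)) = j"
      by (auto simp: mono_cycle_def)
    have "walk src tgt y (map ((!) es) d) x \<longleftrightarrow> walk \<kappa> (\<lambda>p. \<kappa> (Suc p mod l)) y d x" if "set d \<subseteq> {..<l}" for y d
      using that by (induction d arbitrary: y) (auto simp: \<kappa>_def[symmetric] tg)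
    then have "walk \<kappa> (\<lambda>p. \<kappa> (Suc p mod l)) x c x" using m(2) sub[OF c] by blast
    moreover have "\<forall>p\<in>set c. even p = j"
    proof
      fix p assume p: "p \<in> set c"
      then have "p < l" using sub[OF c] by auto
      then show "even p = j" using m(3) p lb assms(3) by (auto simp: l_def)
    qed
    ultimately show ?thesis using m(1) by (auto simp: pos_cycle_def)
  qed
  then have pc: "pos_config l \<kappa> C'" using C'(2) by (simp add: pos_config_def)
  have "size (filter_mset triv C) = size (filter_mset (ptriv ((!) w)) C')"
  proof -
    have "triv (map ((!) es) c) = ptriv ((!) w) c" if "c \<in># C'" for c
    proof -
      have "map lab (map ((!) es) c) = map ((!) w) c" using sub[OF that] lb by auto
      then show ?thesis by (simp only: triv_def ptriv_def)
    qed
    then have "filter_mset (\<lambda>c. triv (map ((!) es) c)) C' = filter_mset (ptriv ((!) w)) C'" by (intro filter_mset_cong) auto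
    then show ?thesis unfolding C'(1)[symmetric] filter_mset_image_mset by (simp add: comp_def)
  qed
  moreover have "vertices b es = \<kappa> ` {..<l}"
  proof -
    have "b = \<kappa> 0" using walk_hd[OF wk] len l0 by (auto simp: \<kappa>_def)
    moreover have "src ` set es = \<kappa> ` {..<l}" by (auto simp: set_conv_nth len \<kappa>_def image_iff)
    ultimately show ?thesis using l0 by (auto simp: vertices_def)
  qed
  ultimately have "\<chi> + int l \<le> int (card (\<kappa> ` {..<l}) + size (filter_mset (ptriv ((!) w)) C'))"
    using sc len by (simp add: score_def)
  then show ?thesis using pc unfolding l_def by blast
qed

end

section \<open>The lower bound\<close>

definition turns :: "nat list \<Rightarrow> (nat \<times> nat) multiset" where
  "turns c = image_mset (\<lambda>k. (c ! k, c ! (Suc k mod length c))) (mset_set {..<length c})"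

lemma fst_turns: "image_mset fst (turns c) = mset c"
proof -
  have "image_mset fst (turns c) = image_mset ((!) c) (mset_set {..<length c})"
    by (simp add: turns_def image_mset.compositionality comp_def)
  also have "\<dots> = mset c" by (rule image_mset_nth)
  finally show ?thesis .
qed

lemma snd_turns: "image_mset snd (turns c) = mset c"
proof (cases "c = []")
  case False
  define k where "k = length c"
  have k: "0 < k" using False by (simp add: k_def)
  have "inj_on (\<lambda>i. Suc i mod k) {..<k}"
  proof (rule inj_onI)
    fix x y assume "x \<in> {..<k}" "y \<in> {..<k}" "Suc x mod k = Suc y mod k"
    then show "x = y" using pred_mod_unique[of x k] pred_mod_unique[of y k] by simp
  qed
  moreover have "(\<lambda>i. Suc i mod k) ` {..<k} \<subseteq> {..<k}" using k by auto
  ultimately have "(\<lambda>i. Suc i mod k) ` {..<k} = {..<k}" by (intro endo_inj_surj) auto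
  then have r: "image_mset (\<lambda>i. Suc i mod k) (mset_set {..<k}) = mset_set {..<k}"
    using image_mset_mset_set[OF \<open>inj_on (\<lambda>i. Suc i mod k) {..<k}\<close>] by simp
  have "image_mset snd (turns c) = image_mset ((!) c) (image_mset (\<lambda>i. Suc i mod k) (mset_set {..<k}))"
    by (simp add: turns_def image_mset.compositionality comp_def k_def)
  also have "\<dots> = mset c" unfolding r unfolding k_def by (rule image_mset_nth)
  finally show ?thesis .
qed (simp add: turns_def)

lemma cyc_sum_turns: "cyc_sum F c = (\<Sum>(p, q)\<in>#turns c. F p q)"
  by (simp add: cyc_sum_def turns_def image_mset.compositionality comp_def sum_unfold_sum_mset)

text \<open>Every position occurs exactly once in the cycles, both as the start and as the end of a
  turn; hence the turns form the graph of a permutation.\<close>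

lemma pos_config_successor:
  assumes "pos_config l \<kappa> C"
  obtains \<phi> where "bij_betw \<phi> {..<l} {..<l}" "\<And>F. (\<Sum>c\<in>#C. cyc_sum F c) = (\<Sum>p<l. F p (\<phi> p))"
    "\<And>p. p < l \<Longrightarrow> \<kappa> (Suc p mod l) = \<kappa> (\<phi> p) \<and> even (\<phi> p) = even p"
proof -
  have sum: "entries C = mset_set {..<l}"
    and cyc: "\<forall>c\<in>#C. pos_cycle \<kappa> (\<lambda>p. \<kappa> (Suc p mod l)) c"
    using assms by (simp_all add: pos_config_def)
  define T where "T = sum_mset (image_mset turns C)"
  have img: "image_mset g (sum_mset (image_mset turns D)) = sum_mset (image_mset (\<lambda>c. image_mset g (turns c)) D)" for g :: "nat \<times> nat \<Rightarrow> nat" and D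
    by (induction D) auto
  have T1: "image_mset fst T = mset_set {..<l}" by (simp add: T_def img fst_turns sum)
  have T2: "image_mset snd T = mset_set {..<l}" by (simp add: T_def img snd_turns sum)
  obtain \<phi> where \<phi>: "T = image_mset (\<lambda>p. (p, \<phi> p)) (mset_set {..<l})" using graph_msetE[OF _ T1] by auto
  have "image_mset \<phi> (mset_set {..<l}) = mset_set {..<l}"
    using T2 unfolding \<phi> by (simp add: image_mset.compositionality comp_def)
  then have "set_mset (image_mset \<phi> (mset_set {..<l})) = set_mset (mset_set {..<l})" by (rule arg_cong)
  then have surj: "\<phi> ` {..<l} = {..<l}" by simp
  then have "inj_on \<phi> {..<l}" by (intro eq_card_imp_inj_on) auto
  then have bij: "bij_betw \<phi> {..<l} {..<l}" using surj by (simp add: bij_betw_def)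
  have tot: "(\<Sum>c\<in>#C. cyc_sum F c) = (\<Sum>p<l. F p (\<phi> p))" for F
  proof -
    have "(\<Sum>c\<in>#D. cyc_sum F c) = (\<Sum>(p, q)\<in>#sum_mset (image_mset turns D). F p q)" for D
      by (induction D) (auto simp: cyc_sum_turns)
    then have "(\<Sum>c\<in>#C. cyc_sum F c) = (\<Sum>(p, q)\<in>#T. F p q)" by (simp add: T_def)
    also have "\<dots> = (\<Sum>p<l. F p (\<phi> p))" unfolding \<phi>
      by (simp add: image_mset.compositionality comp_def sum_unfold_sum_mset)
    finally show ?thesis .
  qed
  have turn: "\<kappa> (Suc p mod l) = \<kappa> (\<phi> p) \<and> even (\<phi> p) = even p" if "p < l" for p
  proof -
    have "(p, \<phi> p) \<in># T" unfolding \<phi> using that by simp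
    then obtain c where c: "c \<in># C" "(p, \<phi> p) \<in># turns c" by (auto simp: T_def)
    then obtain k where k: "k < length c" "p = c ! k" "\<phi> p = c ! (Suc k mod length c)" by (auto simp: turns_def)
    obtain x b where x: "walk \<kappa> (\<lambda>p. \<kappa> (Suc p mod l)) x c x" "\<forall>p\<in>set c. even p = b"
      using bspec[OF cyc c(1)] unfolding pos_cycle_def by blast
    have "Suc k mod length c < length c" using k(1) by (intro mod_less_divisor) linarith
    then have "p \<in> set c" "\<phi> p \<in> set c" using k by auto
    then show ?thesis using closed_walk_turn[OF x(1) k(1)] k x(2) by auto
  qed
  show ?thesis by (rule that[OF bij tot turn])
qed

lemma nth_concat_replicate:
  "p < n * length u \<Longrightarrow> concat (replicate n u) ! p = u ! (p mod length u)"
proof (induction n arbitrary: p)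
  case (Suc n)
  show ?case
  proof (cases "p < length u")
    case True
    then show ?thesis by (simp add: nth_append)
  next
    case False
    then have "concat (replicate n u) ! (p - length u) = u ! ((p - length u) mod length u)"
      using Suc by simp
    moreover have "(p - length u) mod length u = p mod length u" using False by (simp add: le_mod_geq)
    ultimately show ?thesis using False by (simp add: nth_append)
  qed
qed simp

lemma (in group) val_constant: "(\<forall>p\<in>set w. snd p = x) \<Longrightarrow> x \<in> carrier G \<Longrightarrow> val w = x [^] length w"
proof (induction w)
  case (Cons p w)
  then show ?case using nat_pow_Suc2[of x "length w"] by simp
qed simp

text \<open>Characteristic at least \<open>1 - 2 * k\<close>, with \<open>2 * L * n\<close> edges
  and after splitting at most \<open>L * n\<close> vertices, forces \<open>L * n + 1 - 2 * k\<close>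
  trivial cycles. This is compared with \<open>trivial_cycle_count\<close>.\<close>

lemma two_factor_lower_bound:
  fixes G (structure) and A :: "bool \<Rightarrow> 'a set"
  assumes "free_prod G UNIV A"
    and u: "free_prod.cyc_reduced G UNIV A u" "fst (hd u)" "\<not> fst (last u)"
    and k: "prod_of_commutators G k (group.val G u [^] n)" and n: "0 < n" and N: "3 \<le> N"
    and ord: "\<And>x m. x \<in> carrier G \<Longrightarrow> x \<noteq> \<one> \<Longrightarrow> 0 < m \<Longrightarrow> x [^] (m::nat) = \<one> \<Longrightarrow> N \<le> m"
  shows "n + 1 \<le> 2 * k + 2 * (n div N)"
proof -
  interpret free_prod G UNIV A by fact
  have ru: "reduced u" "u \<noteq> []" using u(1) by (auto simp: cyc_reduced_def)
  have cu: "in_carrier u" using ru reduced_valid valid_in_carrier by blast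
  have alt: "fst (u ! p) = even p" if "p < length u" for p
  proof -
    have "successively (\<noteq>) (map fst u)" using ru(1) by (simp add: reduced_def successively_map)
    moreover have "hd (map fst u)" using u(2) ru(2) by (simp add: hd_map)
    ultimately have "map fst u ! p = even p" using that by (intro alternating_bool_list) auto
    then show ?thesis using that by simp
  qed
  have "odd (length u - 1)" using alt[of "length u - 1"] u(3) ru(2) by (simp add: last_conv_nth)
  then have "even (length u)" using ru(2) by (cases u) auto
  then obtain L where L: "length u = 2 * L" by (rule evenE)
  have L0: "0 < L" using L ru(2) by (cases L) auto
  define w where "w = concat (replicate n u)"
  define l where "l = 2 * L * n"
  have lw: "length w = l" by (simp add: w_def length_concat_replicate l_def L)
  have wn: "w ! p = u ! (p mod (2 * L))" if "p < l" for p
    using nth_concat_replicate[of p n u] that by (simp add: w_def L l_def mult.commute)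
  have evl: "even l" by (simp add: l_def)
  have "bounds w (1 - 2 * int k)"
    using reduced_bounds[of k w] k reduced_concat_replicate[OF u(1)] val_concat_replicate[OF cu] by (simp add: w_def)
  moreover have "w \<noteq> []" using lw L0 n by (auto simp: l_def)
  moreover have "\<forall>p<length w. fst (w ! p) = even p"
  proof (intro allI impI)
    fix p assume p: "p < length w"
    have "p mod (2 * L) < length u" using L0 L by simp
    then show "fst (w ! p) = even p" using wn[of p] alt[of "p mod (2 * L)"] p lw by (simp add: dvd_mod_iff)
  qed
  ultimately obtain \<kappa>0 C0 where k0: "pos_config l \<kappa>0 C0"
    "1 - 2 * int k + int l \<le> int (card (\<kappa>0 ` {..<l}) + size (filter_mset (ptriv ((!) w)) C0))"
    using bounds_pos_config[of w "1 - 2 * int k"] lw by auto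
  have carw: "\<forall>p<l. snd (w ! p) \<in> carrier G"
    using in_carrier_concat_replicate[OF cu, of n] lw by (auto simp: w_def[symmetric] in_carrier_def)
  obtain \<kappa> C where kc: "pos_config l \<kappa> C"
    "card (\<kappa>0 ` {..<l}) + size (filter_mset (ptriv ((!) w)) C0) \<le> card (\<kappa> ` {..<l}) + size (filter_mset (ptriv ((!) w)) C)"
    "inj_on (\<lambda>p. \<kappa> (Suc p)) {p. p < l \<and> even p}"
    using split_all_vertices[OF k0(1) carw evl order_refl] by blast
  obtain \<phi> where bij: "bij_betw \<phi> {..<l} {..<l}" and tot: "\<And>F. (\<Sum>c\<in>#C. cyc_sum F c) = (\<Sum>p<l. F p (\<phi> p))"
    and \<phi>: "\<And>p. p < l \<Longrightarrow> \<kappa> (Suc p mod l) = \<kappa> (\<phi> p) \<and> even (\<phi> p) = even p"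
    using pos_config_successor[OF kc(1)] by blast
  have Sp: "Suc x mod l = Suc x" if "x < l" "even x" for x
    using that evl by (metis Suc_lessI even_Suc mod_less)
  have phil: "\<phi> p < l" if "p < l" for p using bij that by (auto simp: bij_betw_def)
  \<comment> \<open>The odd turn at the junction before \<open>\<phi> p\<close> leads to an odd
    position at the same vertex; as the vertex has only one even turn, that position is
    \<open>Suc p\<close>.\<close>
  have pair: "\<phi> ((\<phi> p + l - 1) mod l) = Suc p" if p: "p < l" "even p" for p
  proof -
    define h where "h = (\<phi> p + l - 1) mod l"
    have hl: "h < l" using p by (simp add: h_def)
    have "odd (\<phi> p + l - 1)" using \<phi>[OF p(1)] p evl by simp
    then have oh: "odd h" using evl by (simp add: h_def dvd_mod_iff)
    have Sh: "Suc h mod l = \<phi> p" unfolding h_def by (rule pred_mod[OF phil[OF p(1)]])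
    have "odd (\<phi> h)" using \<phi>[OF hl] oh by simp
    then obtain p' where p': "\<phi> h = Suc p'" "even p'" by (cases "\<phi> h") auto
    have "\<kappa> (Suc p') = \<kappa> (Suc p)" using \<phi>[OF hl] \<phi>[OF p(1)] Sh p' Sp[OF p] by simp
    moreover have "p' < l" using phil[OF hl] p' by simp
    ultimately have "p' = p" using kc(3) p p' by (auto simp: inj_on_def)
    then show ?thesis using p' by (simp add: h_def)
  qed
  \<comment> \<open>Every position starts at the vertex of some even turn: an odd one directly after
    an even position, an even one at the end of the turn leading to it.\<close>
  have V: "card (\<kappa> ` {..<l}) \<le> L * n"
  proof -
    have "\<kappa> x \<in> (\<lambda>i. \<kappa> (Suc (2 * i))) ` {..<L * n}" if x: "x < l" for x
    proof -
      have "\<exists>p. p < l \<and> even p \<and> \<kappa> x = \<kappa> (Suc p)"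
      proof (cases "even x")
        case True
        have "x \<in> \<phi> ` {..<l}" using bij x by (simp add: bij_betw_def)
        then obtain p where p: "p < l" "\<phi> p = x" by auto
        then show ?thesis using \<phi>[OF p(1)] Sp[OF p(1)] True by auto
      next
        case False
        then obtain p where "x = Suc p" "even p" by (cases x) auto
        then show ?thesis using x by (intro exI[of _ p]) simp
      qed
      then obtain p where p: "p < l" "even p" "\<kappa> x = \<kappa> (Suc p)" by blast
      then obtain i where "p = 2 * i" by (auto elim: evenE)
      then show ?thesis using p by (auto simp: l_def)
    qed
    then have "\<kappa> ` {..<l} \<subseteq> (\<lambda>i. \<kappa> (Suc (2 * i))) ` {..<L * n}" by blast
    then have "card (\<kappa> ` {..<l}) \<le> card ((\<lambda>i. \<kappa> (Suc (2 * i))) ` {..<L * n})" by (intro card_mono) auto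
    also have "\<dots> \<le> L * n" using card_image_le[of "{..<L * n}"] by simp
    finally show ?thesis .
  qed
  have ne: "c \<noteq> []" if "c \<in># C" for c using kc(1) that by (auto simp: pos_config_def pos_cycle_def)
  have D: "size (filter_mset (ptriv ((!) w)) C) \<le> n * (L - 1) + 2 * (n div N)"
  proof (rule trivial_cycle_count[OF l_def L0 N n tot bij _ pair ne])
    show "p < l \<Longrightarrow> even (\<phi> p) = even p" for p using \<phi> by blast
    fix c i assume c: "c \<in># C" "ptriv ((!) w) c" "\<forall>p\<in>set c. p mod (2 * L) = i"
    obtain p where p: "p \<in> set c" using ne[OF c(1)] by (cases c) auto
    then have i: "i < length u" using c(3) L L0 by auto
    have x: "snd (u ! i) \<in> carrier G" "snd (u ! i) \<noteq> \<one>"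
      using ru(1) cu i by (auto simp: reduced_def in_carrier_def)
    have "val (map ((!) w) c) = snd (u ! i) [^] length (map ((!) w) c)"
    proof (rule val_constant[OF _ x(1)])
      show "\<forall>q\<in>set (map ((!) w) c). snd q = snd (u ! i)"
        using pos_config_carrier(1)[OF kc(1) carw c(1)] wn c(3) by auto
    qed
    then have "snd (u ! i) [^] length c = \<one>" using c(2) by (simp add: ptriv_def)
    then show "N \<le> length c" using ord[OF x] ne[OF c(1)] by simp
  qed
  have "1 - 2 * int k + int l \<le> int (L * n) + int (n * (L - 1) + 2 * (n div N))"
    using k0(2) kc(2) V D by linarith
  moreover have "int (n * (L - 1)) = int (L * n) - int n"
    using L0 by (simp add: of_nat_diff right_diff_distrib mult.commute)
  moreover have "int l = 2 * int (L * n)" by (simp add: l_def)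
  ultimately show ?thesis by linarith
qed

context group
begin

lemma conj_prod_of_commutators:
  assumes "prod_of_commutators G k h" "x \<in> carrier G" "h \<in> carrier G"
  shows "prod_of_commutators G k (inv x \<otimes> h \<otimes> x)"
proof -
  from assms(1) obtain xs ys where len: "length xs = k" "length ys = k"
    and car: "set xs \<subseteq> carrier G" "set ys \<subseteq> carrier G" and h: "h = list_prod G (map2 (commutator G) xs ys)"
    by (auto simp: prod_of_commutators_def)
  define c where "c = (\<lambda>z. inv x \<otimes> z \<otimes> x)"
  have cc: "c z \<in> carrier G" if "z \<in> carrier G" for z using that assms by (simp add: c_def)
  have cm: "c (y \<otimes> z) = c y \<otimes> c z" if "y \<in> carrier G" "z \<in> carrier G" for y z
    using that assms by (simp add: c_def m_assoc)
  have ci: "c (inv z) = inv (c z)" if "z \<in> carrier G" for z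
    using that assms by (simp add: c_def inv_mult_group m_assoc)
  have "length xs = length ys" using len by simp
  then have "c (list_prod G (map2 (commutator G) xs ys)) = list_prod G (map2 (commutator G) (map c xs) (map c ys))
    \<and> list_prod G (map2 (commutator G) xs ys) \<in> carrier G"
    using car
  proof (induction xs ys rule: list_induct2)
    case Nil
    then show ?case using assms by (simp add: c_def)
  next
    case (Cons a as b bs)
    then show ?case by (simp add: commutator_def cm ci)
  qed
  then show ?thesis unfolding prod_of_commutators_def
    using len car cc h by (intro exI[of _ "map c xs"] exI[of _ "map c ys"]) (auto simp: c_def)
qed

end

context free_prod
begin

text \<open>If \<open>g\<close> were conjugate to a single letter or trivial, \<open>g [^] n\<close>
  would be conjugate into a factor. So \<open>g\<close> is conjugate to a cyclically reduced word,
  and the factor \<open>i\<close> of its first letter is the one kept apart.\<close>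

theorem commutator_length_lower_bound:
  assumes ne: "J \<noteq> {}" and g: "g \<in> carrier G" "g [^] n \<in> hatG G J A" and n: "0 < n" and N: "3 \<le> N"
    and k: "prod_of_commutators G k (g [^] n)"
    and ord: "\<And>x m. x \<in> carrier G \<Longrightarrow> x \<noteq> \<one> \<Longrightarrow> 0 < m \<Longrightarrow> x [^] (m::nat) = \<one> \<Longrightarrow> N \<le> m"
  shows "n + 1 \<le> 2 * k + 2 * (n div N)"
proof -
  obtain x w where xw: "x \<in> carrier G" "reduced w" "val w = inv x \<otimes> g \<otimes> x" "length w \<le> 1 \<or> cyc_reduced w"
    using conj_cyc_reduced[OF g(1)] .
  have pow: "val w [^] n = inv x \<otimes> g [^] n \<otimes> x" using conj_pow[OF xw(1) g(1)] xw(3) by simp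
  have "\<not> length w \<le> 1"
  proof
    assume "length w \<le> 1"
    then have "\<exists>j\<in>J. val w \<in> A j"
    proof (cases w)
      case Nil
      then show ?thesis using ne subgroup.one_closed[OF factor_subgroup] by auto
    next
      case (Cons p v)
      then show ?thesis using \<open>length w \<le> 1\<close> xw(2) factor_carrier by (auto simp: reduced_Cons)
    qed
    then obtain j where j: "j \<in> J" "val w \<in> A j" by blast
    have "val w [^] m \<in> A j" for m :: nat
      by (induction m) (use j subgroup.one_closed[OF factor_subgroup] subgroup.m_closed[OF factor_subgroup] in auto)
    moreover have "g [^] n = inv (inv x) \<otimes> val w [^] n \<otimes> inv x"
      unfolding pow using xw(1) g(1) by (simp add: m_assoc)
    ultimately show False using g(2) j(1) xw(1) unfolding hatG_def by blast
  qed
  then have cw: "cyc_reduced w" using xw(4) by simp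
  define i where "i = fst (hd w)"
  have w: "w \<noteq> []" "fst (last w) \<noteq> i" using cw by (auto simp: cyc_reduced_def i_def)
  have i: "i \<in> J" using reduced_valid[OF xw(2)] w(1) by (cases w) (auto simp: i_def)
  have fc: "free_prod G UNIV (coarse i)" by unfold_locales (rule coarse_free_product[OF i])
  obtain u where u: "free_prod.reduced G UNIV (coarse i) u" "u \<noteq> []" "val u = val w" "fst (hd u)" "\<not> fst (last u)"
    using coarsen_word[OF i xw(2) w(1)] w(2) i_def by auto
  have cu: "free_prod.cyc_reduced G UNIV (coarse i) u"
    using u by (simp add: free_prod.cyc_reduced_def[OF fc])
  have "prod_of_commutators G k (val u [^] n)"
    unfolding u(3) pow by (rule conj_prod_of_commutators[OF k xw(1)]) (use g in simp)
  then show ?thesis by (rule two_factor_lower_bound[OF fc cu u(4,5) _ n N ord])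
qed

end

section \<open>Powers of commutators as products of few commutators\<close>

context group
begin

lemma commutator_closed [simp]: "x \<in> carrier G \<Longrightarrow> y \<in> carrier G \<Longrightarrow> commutator G x y \<in> carrier G"
  by (simp add: commutator_def)

lemma prod_of_commutators_0: "prod_of_commutators G 0 \<one>"
  by (simp add: prod_of_commutators_def)

lemma prod_of_commutators_1: "x \<in> carrier G \<Longrightarrow> y \<in> carrier G \<Longrightarrow> prod_of_commutators G 1 (commutator G x y)"
  unfolding prod_of_commutators_def by (intro exI[of _ "[x]"] exI[of _ "[y]"]) simp

lemma map2_commutator_closed:
  assumes "set xs \<subseteq> carrier G" "set ys \<subseteq> carrier G"
  shows "set (map2 (commutator G) xs ys) \<subseteq> carrier G"
proof
  fix z assume "z \<in> set (map2 (commutator G) xs ys)"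
  then obtain a b where "(a, b) \<in> set (zip xs ys)" "z = commutator G a b" by auto
  then show "z \<in> carrier G"
    using assms set_zip_leftD[of a b xs ys] set_zip_rightD[of a b xs ys] by (simp add: subset_iff)
qed

lemma prod_of_commutators_mult:
  assumes "prod_of_commutators G j a" "prod_of_commutators G k b"
  shows "prod_of_commutators G (j + k) (a \<otimes> b)"
proof -
  obtain xs ys where x: "length xs = j" "length ys = j" "set xs \<subseteq> carrier G" "set ys \<subseteq> carrier G"
    "a = list_prod G (map2 (commutator G) xs ys)" using assms(1) by (auto simp: prod_of_commutators_def)
  obtain us vs where u: "length us = k" "length vs = k" "set us \<subseteq> carrier G" "set vs \<subseteq> carrier G"
    "b = list_prod G (map2 (commutator G) us vs)" using assms(2) by (auto simp: prod_of_commutators_def)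
  have "set (map2 (commutator G) xs ys) \<subseteq> carrier G" "set (map2 (commutator G) us vs) \<subseteq> carrier G"
    using x u by (simp_all only: map2_commutator_closed)
  then have "list_prod G (map2 (commutator G) (xs @ us) (ys @ vs)) = a \<otimes> b"
    using x u by (simp add: list_prod_append)
  then show ?thesis unfolding prod_of_commutators_def
    using x u by (intro exI[of _ "xs @ us"] exI[of _ "ys @ vs"]) auto
qed

text \<open>Equality up to \<open>t\<close> commutators. The costs of successive changes add up, and
  a common prefix or suffix is harmless because conjugates of commutators are commutators.\<close>

definition ceq :: "nat \<Rightarrow> 'a \<Rightarrow> 'a \<Rightarrow> bool" where
  "ceq t a b \<longleftrightarrow> a \<in> carrier G \<and> b \<in> carrier G \<and> prod_of_commutators G t (a \<otimes> inv b)"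

lemma ceq_refl: "a \<in> carrier G \<Longrightarrow> ceq 0 a a"
  by (simp add: ceq_def prod_of_commutators_0)

lemma ceq_trans: "ceq s a b \<Longrightarrow> ceq t b c \<Longrightarrow> ceq (s + t) a c"
  unfolding ceq_def using prod_of_commutators_mult[of s "a \<otimes> inv b" t "b \<otimes> inv c"]
  by (auto simp: m_assoc)

lemma ceq_prod: "ceq s a b \<Longrightarrow> prod_of_commutators G t b \<Longrightarrow> prod_of_commutators G (s + t) a"
  unfolding ceq_def using prod_of_commutators_mult[of s "a \<otimes> inv b" t b] by (auto simp: m_assoc)

text \<open>Interchanging two blocks costs one commutator, because
  \<open>u m v u\<inverse> m\<inverse> v\<inverse>\<close> is the commutator of \<open>(u m)\<inverse>\<close> and \<open>(v u\<inverse>)\<inverse>\<close>.\<close>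
lemma ceq_interchange:
  assumes c: "c \<in> carrier G" "u \<in> carrier G" "m \<in> carrier G" "v \<in> carrier G" "e \<in> carrier G"
  shows "ceq 1 (c \<otimes> u \<otimes> m \<otimes> v \<otimes> e) (c \<otimes> v \<otimes> m \<otimes> u \<otimes> e)"
proof -
  define h where "h = commutator G (inv (u \<otimes> m)) (inv (v \<otimes> inv u))"
  have "prod_of_commutators G 1 h" using c unfolding h_def by (intro prod_of_commutators_1) simp_all
  then have "prod_of_commutators G 1 (inv (inv c) \<otimes> h \<otimes> inv c)"
    using c by (intro conj_prod_of_commutators) (simp_all add: h_def)
  moreover have "inv (inv c) \<otimes> h \<otimes> inv c = (c \<otimes> u \<otimes> m \<otimes> v \<otimes> e) \<otimes> inv (c \<otimes> v \<otimes> m \<otimes> u \<otimes> e)"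
    using c by (simp add: h_def commutator_def inv_mult_group m_assoc)
  ultimately show ?thesis using c by (simp add: ceq_def)
qed

section \<open>Interchanges in complementary alternating words\<close>

definition letter :: "'a \<Rightarrow> 'a \<Rightarrow> bool \<Rightarrow> 'a" where "letter x y b = (if b then x else y)"

fun alternating :: "'a \<Rightarrow> 'a \<Rightarrow> bool \<Rightarrow> nat \<Rightarrow> 'a" where
  "alternating x y b 0 = \<one>"
| "alternating x y b (Suc n) = letter x y b \<otimes> alternating x y (\<not> b) n"

text \<open>\<open>reach x y b n t p q\<close>: exchanging \<open>t\<close> letters at equal positions of the two complementary alternating words of
  length \<open>n\<close> turns them into words with values \<open>p\<close> and \<open>q\<close>.\<close>
definition reach :: "'a \<Rightarrow> 'a \<Rightarrow> bool \<Rightarrow> nat \<Rightarrow> nat \<Rightarrow> 'a \<Rightarrow> 'a \<Rightarrow> bool" where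
  "reach x y b n t p q \<longleftrightarrow> p \<in> carrier G \<and> q \<in> carrier G \<and>
     (\<forall>c\<in>carrier G. \<forall>m\<in>carrier G. \<forall>e\<in>carrier G.
        ceq t (c \<otimes> alternating x y b n \<otimes> m \<otimes> alternating x y (\<not> b) n \<otimes> e) (c \<otimes> p \<otimes> m \<otimes> q \<otimes> e))"

context
  fixes x y :: 'a
  assumes x: "x \<in> carrier G" and y: "y \<in> carrier G"
begin

lemma letter_closed [simp]: "letter x y b \<in> carrier G" using x y by (simp add: letter_def)

lemma alternating_closed [simp]: "alternating x y b n \<in> carrier G"
  by (induction n arbitrary: b) auto

text \<open>The truth value \<open>b = even n\<close> is the letter due after \<open>n\<close>
  alternations starting from \<open>b\<close>.\<close>

lemma alternating_add:
  "alternating x y b (n + m) = alternating x y b n \<otimes> alternating x y (b = even n) m"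
proof (induction n arbitrary: b)
  case (Suc n)
  have "((\<not> b) = even n) = (b = even (Suc n))" by auto
  then show ?case using Suc[of "\<not> b"] by (simp add: m_assoc)
qed simp

lemma alternating_double: "alternating x y b (2 * n) = (letter x y b \<otimes> letter x y (\<not> b)) [^] n"
proof (induction n)
  case (Suc n)
  then show ?case
    using nat_pow_Suc2[of "letter x y b \<otimes> letter x y (\<not> b)" n] by (simp add: m_assoc)
qed simp

lemma reach_keep: "reach x y b 1 0 (letter x y b) (letter x y (\<not> b))"
  by (simp add: reach_def ceq_refl)

lemma reach_swap: "reach x y b 1 1 (letter x y (\<not> b)) (letter x y b)"
  using ceq_interchange by (simp add: reach_def)

text \<open>The free middle part \<open>m\<close> in \<open>reach\<close> absorbs the other blocks:
  first the initial blocks are exchanged around the rest of the first word, then the final blocks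
  around the part \<open>q\<close> already obtained.\<close>

lemma reach_append:
  assumes "reach x y b n t p q" "reach x y (b = even n) n' t' p' q'"
  shows "reach x y b (n + n') (t + t') (p \<otimes> p') (q \<otimes> q')"
proof -
  have car: "p \<in> carrier G" "q \<in> carrier G" "p' \<in> carrier G" "q' \<in> carrier G" using assms by (auto simp: reach_def)
  have "ceq (t + t') (c \<otimes> alternating x y b (n + n') \<otimes> m \<otimes> alternating x y (\<not> b) (n + n') \<otimes> e)
      (c \<otimes> (p \<otimes> p') \<otimes> m \<otimes> (q \<otimes> q') \<otimes> e)"
    if c: "c \<in> carrier G" "m \<in> carrier G" "e \<in> carrier G" for c m e
  proof (rule ceq_trans)
    have "ceq t (c \<otimes> alternating x y b n \<otimes> (alternating x y (b = even n) n' \<otimes> m) \<otimes> alternating x y (\<not> b) n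
        \<otimes> (alternating x y (\<not> (b = even n)) n' \<otimes> e))
      (c \<otimes> p \<otimes> (alternating x y (b = even n) n' \<otimes> m) \<otimes> q \<otimes> (alternating x y (\<not> (b = even n)) n' \<otimes> e))"
      using assms(1) c unfolding reach_def by simp
    moreover have "((\<not> b) = even n) = (\<not> (b = even n))" by auto
    ultimately show "ceq t (c \<otimes> alternating x y b (n + n') \<otimes> m \<otimes> alternating x y (\<not> b) (n + n') \<otimes> e)
      (c \<otimes> p \<otimes> alternating x y (b = even n) n' \<otimes> (m \<otimes> q) \<otimes> alternating x y (\<not> (b = even n)) n' \<otimes> e)"
      using c car by (simp add: alternating_add m_assoc)
    have "ceq t' (c \<otimes> p \<otimes> alternating x y (b = even n) n' \<otimes> (m \<otimes> q) \<otimes> alternating x y (\<not> (b = even n)) n' \<otimes> e)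
      (c \<otimes> p \<otimes> p' \<otimes> (m \<otimes> q) \<otimes> q' \<otimes> e)"
      using assms(2) c car unfolding reach_def by simp
    then show "ceq t' (c \<otimes> p \<otimes> alternating x y (b = even n) n' \<otimes> (m \<otimes> q) \<otimes> alternating x y (\<not> (b = even n)) n' \<otimes> e)
      (c \<otimes> (p \<otimes> p') \<otimes> m \<otimes> (q \<otimes> q') \<otimes> e)"
      using c car by (simp add: m_assoc)
  qed
  then show ?thesis using car by (simp add: reach_def)
qed

text \<open>Interchanging every second position makes both words constant, which takes
  \<open>i\<close> interchanges among \<open>2 * i + 1\<close> positions.\<close>

lemma reach_power:
  "reach x y b (2 * i + 1) i (letter x y b [^] (2 * i + 1)) (letter x y (\<not> b) [^] (2 * i + 1))"
proof (induction i)
  case 0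
  then show ?case using reach_keep[of b] by simp
next
  case (Suc i)
  have 1: "reach x y b (2 * i + 1 + 1) (i + 1)
      (letter x y b [^] (2 * i + 1) \<otimes> letter x y b) (letter x y (\<not> b) [^] (2 * i + 1) \<otimes> letter x y (\<not> b))"
    using reach_append[OF Suc, of 1 1 "letter x y b" "letter x y (\<not> b)"] reach_swap[of "\<not> b"] by simp
  have "reach x y b (2 * i + 1 + 1 + 1) (i + 1 + 0)
      (letter x y b [^] (2 * i + 1) \<otimes> letter x y b \<otimes> letter x y b)
      (letter x y (\<not> b) [^] (2 * i + 1) \<otimes> letter x y (\<not> b) \<otimes> letter x y (\<not> b))"
    by (rule reach_append[OF 1]) (use reach_keep[of b] in simp)
  then show ?case by (simp add: eval_nat_numeral)
qed

lemma reach_odd_power: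
  assumes "odd m"
  shows "reach x y b m (m div 2) (letter x y b [^] m) (letter x y (\<not> b) [^] m)"
  using assms reach_power[of b "m div 2"] by (auto elim: oddE)

text \<open>With \<open>z\<close> the letter other than \<open>w\<close>, the new word is \<open>z w\<^sup>N z\<^bsup>N - 2\<^esup> P z\<close>, where \<open>P\<close> is the old one.\<close>
lemma reach_step:
  assumes r: "reach x y w n t p q" "odd n" and N: "odd N" "3 \<le> N" and x1: "x [^] N = \<one>" and y1: "y [^] N = \<one>"
  shows "reach x y (\<not> w) (2 * N + n) (t + N - 2)
    (inv (letter x y (\<not> w)) \<otimes> p \<otimes> letter x y (\<not> w)) (inv (letter x y w) \<otimes> q \<otimes> letter x y w)"
proof -
  obtain M where M: "N = 2 * M + 1" "1 \<le> M" using N by (auto elim: oddE)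
  have one: "letter x y b [^] N = \<one>" for b using x1 y1 by (simp add: letter_def)
  have "odd (N - 2)" using M by simp
  have car: "p \<in> carrier G" "q \<in> carrier G" using r by (auto simp: reach_def)
  have 1: "reach x y (\<not> w) (1 + N) (0 + N div 2) (letter x y (\<not> w) \<otimes> \<one>) (letter x y w \<otimes> \<one>)"
    using reach_append[OF reach_keep[of "\<not> w"], of N "N div 2" \<one> \<one>] reach_odd_power[OF N(1), of w] by (simp add: one)
  have 2: "reach x y (\<not> w) (1 + N + (N - 2)) (0 + N div 2 + (N - 2) div 2)
    (letter x y (\<not> w) \<otimes> \<one> \<otimes> letter x y (\<not> w) [^] (N - 2)) (letter x y w \<otimes> \<one> \<otimes> letter x y w [^] (N - 2))"
    by (rule reach_append[OF 1]) (use reach_odd_power[OF \<open>odd (N - 2)\<close>, of "\<not> w"] N in simp)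
  have 3: "reach x y (\<not> w) (1 + N + (N - 2) + n) (0 + N div 2 + (N - 2) div 2 + t)
    (letter x y (\<not> w) \<otimes> \<one> \<otimes> letter x y (\<not> w) [^] (N - 2) \<otimes> p) (letter x y w \<otimes> \<one> \<otimes> letter x y w [^] (N - 2) \<otimes> q)"
    by (rule reach_append[OF 2]) (use r N \<open>odd (N - 2)\<close> in simp)
  have 4: "reach x y (\<not> w) (1 + N + (N - 2) + n + 1) (0 + N div 2 + (N - 2) div 2 + t + 0)
    (letter x y (\<not> w) \<otimes> \<one> \<otimes> letter x y (\<not> w) [^] (N - 2) \<otimes> p \<otimes> letter x y (\<not> w))
    (letter x y w \<otimes> \<one> \<otimes> letter x y w [^] (N - 2) \<otimes> q \<otimes> letter x y w)"
    by (rule reach_append[OF 3]) (use reach_keep[of "\<not> w"] r N \<open>odd (N - 2)\<close> in simp)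
  \<comment> \<open>With the block of length \<open>N\<close> gone, the prefix is a letter to the
    power \<open>N - 1\<close>, hence its inverse; the last letter of the word completes a
    conjugation.\<close>
  have pw: "letter x y b \<otimes> \<one> \<otimes> letter x y b [^] (N - 2) = inv (letter x y b)" for b
  proof -
    have "letter x y b \<otimes> letter x y b [^] (N - 2) = letter x y b [^] (N - 1)"
      using nat_pow_Suc2[of "letter x y b" "N - 2"] M by (simp add: Suc_diff_le numeral_2_eq_2)
    moreover have "letter x y b [^] (N - 1) \<otimes> letter x y b = \<one>"
      using nat_pow_Suc[of "letter x y b" "N - 1"] one[of b] M by simp
    ultimately show ?thesis by (simp add: inv_equality)
  qed
  \<comment> \<open>The \<open>2 * N\<close> additional positions cost only \<open>N - 2\<close>
    interchanges, two fewer than one for every second position.\<close>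
  have len: "1 + N + (N - 2) + n + 1 = 2 * N + n" "0 + N div 2 + (N - 2) div 2 + t + 0 = t + N - 2"
    using M by simp_all
  show ?thesis using 4 unfolding pw len .
qed

text \<open>The induction proceeds in steps of two because \<open>reach_step\<close> consumes two
  blocks of length \<open>N\<close>. The equation for \<open>t\<close> says that each of the
  \<open>q\<close> blocks saves one interchange. For \<open>q = 1\<close> the word is
  \<open>x\<close>, then \<open>N\<close> letters \<open>y\<close>, then \<open>s - 1\<close>
  letters \<open>x\<close>.\<close>

lemma reach_discs:
  assumes N: "odd N" "3 \<le> N" and one: "0 < q \<Longrightarrow> x [^] N = \<one> \<and> y [^] N = \<one>"
    and s: "0 < s" "odd (q * N + s)"
  shows "\<exists>b t u v. u \<in> carrier G \<and> v \<in> carrier G \<and> 2 * t + 2 * q + 1 = q * N + s \<and>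
    reach x y b (q * N + s) t (inv u \<otimes> x [^] s \<otimes> u) (inv v \<otimes> y [^] s \<otimes> v)"
  using one s(2)
proof (induction q rule: induct_nat_012)
  case 0
  then have "reach x y True s (s div 2) (x [^] s) (y [^] s)" using reach_odd_power[of s True] by (simp add: letter_def)
  then show ?case using 0 x y
    by (intro exI[of _ True] exI[of _ "s div 2"] exI[of _ \<one>]) (auto elim: oddE)
next
  case 1
  then have xy: "x [^] N = \<one>" "y [^] N = \<one>" by simp_all
  have es: "even s" "2 \<le> s" "odd (s - 1)" using 1 N s(1) by (auto elim!: evenE)
  have 2: "reach x y True (1 + N) (0 + N div 2) (x \<otimes> \<one>) (y \<otimes> \<one>)"
    using reach_append[OF reach_keep[of True], of N "N div 2" \<one> \<one>] reach_odd_power[OF N(1), of False] xy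
    by (simp add: letter_def)
  have "reach x y True (1 + N + (s - 1)) (0 + N div 2 + (s - 1) div 2) (x \<otimes> \<one> \<otimes> x [^] (s - 1)) (y \<otimes> \<one> \<otimes> y [^] (s - 1))"
    by (rule reach_append[OF 2]) (use reach_odd_power[OF es(3), of True] N in \<open>simp add: letter_def\<close>)
  moreover have "x \<otimes> \<one> \<otimes> x [^] (s - 1) = x [^] s" "y \<otimes> \<one> \<otimes> y [^] (s - 1) = y [^] s"
    using nat_pow_Suc2[of x "s - 1"] nat_pow_Suc2[of y "s - 1"] x y s(1) by simp_all
  moreover have "2 * (N div 2 + (s - 1) div 2) + 2 * 1 + 1 = N + s" using N es by (auto elim!: oddE evenE)
  ultimately show ?case using x y s(1)
    by (intro exI[of _ True] exI[of _ "N div 2 + (s - 1) div 2"] exI[of _ \<one>]) simp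
next
  case (ge2 q)
  then have xy: "x [^] N = \<one>" "y [^] N = \<one>" by simp_all
  have "Suc (Suc q) * N + s = 2 * N + (q * N + s)" by simp
  then have odd: "odd (q * N + s)" using ge2.prems(2) by (simp only:) presburger
  obtain b t u v where ih: "u \<in> carrier G" "v \<in> carrier G" "2 * t + 2 * q + 1 = q * N + s"
    "reach x y b (q * N + s) t (inv u \<otimes> x [^] s \<otimes> u) (inv v \<otimes> y [^] s \<otimes> v)"
    using ge2.IH(1)[OF _ odd] xy by blast
  define u' v' where "u' = u \<otimes> letter x y (\<not> b)" and "v' = v \<otimes> letter x y b"
  have "inv (letter x y (\<not> b)) \<otimes> (inv u \<otimes> x [^] s \<otimes> u) \<otimes> letter x y (\<not> b) = inv u' \<otimes> x [^] s \<otimes> u'"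
    "inv (letter x y b) \<otimes> (inv v \<otimes> y [^] s \<otimes> v) \<otimes> letter x y b = inv v' \<otimes> y [^] s \<otimes> v'"
    using ih x y by (simp_all add: u'_def v'_def inv_mult_group m_assoc)
  then have "reach x y (\<not> b) (2 * N + (q * N + s)) (t + N - 2) (inv u' \<otimes> x [^] s \<otimes> u') (inv v' \<otimes> y [^] s \<otimes> v')"
    using reach_step[OF ih(4) odd N xy] by simp
  moreover have "2 * N + (q * N + s) = Suc (Suc q) * N + s" by simp
  moreover have "2 * (t + N - 2) + 2 * Suc (Suc q) + 1 = Suc (Suc q) * N + s" using ih(3) N by simp
  moreover have "u' \<in> carrier G" "v' \<in> carrier G" using ih by (simp_all add: u'_def v'_def)
  ultimately show ?case by metis
qed

lemma conj_inverse_product: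
  assumes "u \<in> carrier G" "w \<in> carrier G" "a \<in> carrier G"
  shows "prod_of_commutators G 1 (inv u \<otimes> a \<otimes> u \<otimes> (inv w \<otimes> inv a \<otimes> w))"
proof -
  have "prod_of_commutators G 1 (commutator G (inv a) (w \<otimes> inv u))" using assms by (intro prod_of_commutators_1) simp_all
  then have "prod_of_commutators G 1 (inv u \<otimes> commutator G (inv a) (w \<otimes> inv u) \<otimes> u)"
    by (rule conj_prod_of_commutators) (use assms in simp_all)
  then show ?thesis using assms by (simp add: commutator_def inv_mult_group m_assoc)
qed

text \<open>For odd \<open>n = q * N + s\<close>, the alternating word of length
  \<open>2 * n\<close> falls into two complementary halves, to which \<open>reach_discs\<close>
  applies. If the starting letter it provides is \<open>y\<close>, the power obtained is that of
  \<open>y \<otimes> x\<close>, a conjugate of the required one.\<close>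

lemma power_product_upper:
  assumes N: "odd N" "3 \<le> N" and one: "0 < q \<Longrightarrow> x [^] N = \<one>"
    and s: "0 < s" "odd (q * N + s)" and t: "2 * t + 2 * q + 1 = q * N + s"
    and b: "b \<in> carrier G" "y = inv b \<otimes> inv x \<otimes> b"
  shows "prod_of_commutators G (t + 1) ((x \<otimes> y) [^] (q * N + s))"
    and "x [^] s = \<one> \<Longrightarrow> prod_of_commutators G t ((x \<otimes> y) [^] (q * N + s))"
proof -
  define n where "n = q * N + s"
  have ypow: "y [^] m = inv b \<otimes> inv (x [^] m) \<otimes> b" for m :: nat
  proof (induction m)
    case (Suc m)
    have "x [^] Suc m = x \<otimes> x [^] m" using nat_pow_Suc2 x by simp
    then have e: "inv (x [^] Suc m) = inv (x [^] m) \<otimes> inv x" using x by (simp only: inv_mult_group nat_pow_closed)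
    have "y [^] Suc m = (inv b \<otimes> inv (x [^] m) \<otimes> b) \<otimes> (inv b \<otimes> inv x \<otimes> b)"
      by (simp only: nat_pow_Suc Suc flip: b(2))
    also have "\<dots> = inv b \<otimes> (inv (x [^] m) \<otimes> inv x) \<otimes> b" using x b(1) by (simp add: m_assoc)
    finally show ?case unfolding e .
  qed (use b in simp)
  have "0 < q \<Longrightarrow> x [^] N = \<one> \<and> y [^] N = \<one>" using one ypow[of N] b by simp
  then obtain d t' u v where r: "u \<in> carrier G" "v \<in> carrier G" "2 * t' + 2 * q + 1 = q * N + s"
    "reach x y d n t' (inv u \<otimes> x [^] s \<otimes> u) (inv v \<otimes> y [^] s \<otimes> v)"
    using reach_discs[OF N _ s] unfolding n_def by blast
  have tt: "t' = t" using r(3) t by simp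
  define pq where "pq = inv u \<otimes> x [^] s \<otimes> u \<otimes> (inv v \<otimes> y [^] s \<otimes> v)"
  have "ceq t (\<one> \<otimes> alternating x y d n \<otimes> \<one> \<otimes> alternating x y (\<not> d) n \<otimes> \<one>)
    (\<one> \<otimes> (inv u \<otimes> x [^] s \<otimes> u) \<otimes> \<one> \<otimes> (inv v \<otimes> y [^] s \<otimes> v) \<otimes> \<one>)"
    using r(4) unfolding reach_def tt by blast
  then have ce: "ceq t (alternating x y d n \<otimes> alternating x y (\<not> d) n) pq"
    using x y r by (simp add: pq_def)
  have "alternating x y d n \<otimes> alternating x y (\<not> d) n = alternating x y d (2 * n)"
    using alternating_add[of d n n] s(2)[folded n_def] by (simp add: mult_2)
  then have ce': "ceq t ((letter x y d \<otimes> letter x y (\<not> d)) [^] n) pq" using ce by (simp add: alternating_double)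
  have main: "prod_of_commutators G k ((x \<otimes> y) [^] n)"
    if k: "prod_of_commutators G k ((letter x y d \<otimes> letter x y (\<not> d)) [^] n)" for k
  proof (cases d)
    case True
    then show ?thesis using k by (simp add: letter_def)
  next
    case False
    then have "prod_of_commutators G k ((y \<otimes> x) [^] n)" using k by (simp add: letter_def)
    then have "prod_of_commutators G k (inv (inv x) \<otimes> (y \<otimes> x) [^] n \<otimes> inv x)"
      by (rule conj_prod_of_commutators) (use x y in simp_all)
    moreover have "inv (inv x) \<otimes> (y \<otimes> x) [^] m \<otimes> inv x = (x \<otimes> y) [^] m" for m :: nat
    proof (induction m)
      case (Suc m)
      have "inv (inv x) \<otimes> (y \<otimes> x) [^] Suc m \<otimes> inv x = inv (inv x) \<otimes> (y \<otimes> x) [^] m \<otimes> inv x \<otimes> (x \<otimes> y)"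
        using x y by (simp add: m_assoc)
      then show ?case using Suc by simp
    qed (use x in simp)
    ultimately show ?thesis by simp
  qed
  have "pq = inv u \<otimes> x [^] s \<otimes> u \<otimes> (inv (b \<otimes> v) \<otimes> inv (x [^] s) \<otimes> (b \<otimes> v))"
    using x b(1) r(1,2) by (simp add: pq_def ypow inv_mult_group m_assoc)
  then have "prod_of_commutators G 1 pq" using conj_inverse_product[of u "b \<otimes> v" "x [^] s"] r(1,2) b(1) x by simp
  then show "prod_of_commutators G (t + 1) ((x \<otimes> y) [^] (q * N + s))"
    unfolding n_def[symmetric] by (rule main[OF ceq_prod[OF ce']])
  assume "x [^] s = \<one>"
  then have "pq = \<one>" using r(1,2) b(1) by (simp add: pq_def ypow)
  then show "prod_of_commutators G t ((x \<otimes> y) [^] (q * N + s))"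
    using main[OF ceq_prod[OF ce', of 0]] prod_of_commutators_0 by (simp add: n_def)
qed

end

section \<open>Powers of a single commutator\<close>

lemma commutator_power_odd_order:
  assumes ab: "a \<in> carrier G" "b \<in> carrier G" and N: "odd N" "3 \<le> N" "a [^] N = \<one>" and n: "0 < n"
  shows "prod_of_commutators G (n div 2 + 1 - n div N) (commutator G a b [^] n)"
proof -
  define x y where "x = inv a" and "y = inv b \<otimes> a \<otimes> b"
  have xy: "x \<in> carrier G" "y \<in> carrier G" "commutator G a b = x \<otimes> y" "y = inv b \<otimes> inv x \<otimes> b"
    using ab by (simp_all add: x_def y_def commutator_def m_assoc)
  have x1: "x [^] N = \<one>" using N ab by (simp add: x_def nat_pow_inv)
  define g where "g = commutator G a b"
  have g: "g \<in> carrier G" using ab by (simp add: g_def)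
  have odd_case: "prod_of_commutators G (m div 2 + 1 - m div N) (g [^] m)" if m: "odd m" for m
  proof -
    have le: "m div N \<le> m div 2" using N by (intro div_le_mono2) auto
    show ?thesis
    proof (cases "m mod N = 0")
      case False
      define q s where "q = m div N" and "s = m mod N"
      have ms: "m = q * N + s" "0 < s" using False by (simp_all add: q_def s_def)
      have "2 * (m div 2 - q) + 2 * q + 1 = q * N + s" using odd_two_times_div_two_succ[OF m] le[folded q_def] ms(1) by linarith
      then have "prod_of_commutators G (m div 2 - q + 1) ((x \<otimes> y) [^] (q * N + s))"
        by (rule power_product_upper(1)[OF xy(1,2) N(1,2) x1 ms(2) _ _ ab(2) xy(4), rotated]) (use m ms(1) in simp)
      moreover have "m div 2 - q + 1 = m div 2 + 1 - m div N" using le by (simp add: q_def)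
      ultimately show ?thesis using ms(1) xy(3) by (simp add: g_def)
    next
      case True
      \<comment> \<open>If \<open>N\<close> divides \<open>m\<close>, one block is held back as
        \<open>s = N\<close>. Then \<open>x [^] s = \<one>\<close> and the final commutator is
        saved, which compensates for the smaller \<open>q\<close>.\<close>
      define q where "q = m div N - 1"
      have "0 < m" using m by (auto elim: oddE)
      then have "N \<le> m" using True by (simp add: dvd_imp_le mod_0_imp_dvd)
      then have "0 < m div N" using N by (simp add: div_greater_zero_iff)
      moreover have "m = (m div N) * N" using True div_mult_mod_eq[of m N] by simp
      ultimately have ms: "m = q * N + N" using mult_Suc[of q N] by (simp add: q_def)
      have "q < m div 2" using \<open>0 < m div N\<close> le by (simp add: q_def)
      have "2 * (m div 2 - q) + 2 * q + 1 = q * N + N" using odd_two_times_div_two_succ[OF m] ms \<open>q < m div 2\<close> by linarith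
      then have "prod_of_commutators G (m div 2 - q) ((x \<otimes> y) [^] (q * N + N))"
        by (rule power_product_upper(2)[OF xy(1,2) N(1,2) x1 _ _ _ ab(2) xy(4) x1, rotated 2]) (use m ms N in simp_all)
      moreover have "m div 2 - q = m div 2 + 1 - m div N" using \<open>0 < m div N\<close> le by (simp add: q_def)
      ultimately show ?thesis using ms xy(3) by (simp add: g_def)
    qed
  qed
  show ?thesis
  proof (cases "odd n")
    case True
    then show ?thesis using odd_case g_def by simp
  next
    case ev: False
    have le: "n div N \<le> n div 2" using N by (intro div_le_mono2) auto
    show ?thesis
    proof (cases "N dvd n")
      case False
      \<comment> \<open>Since \<open>N\<close> does not divide \<open>n\<close>, splitting off a
        single factor leaves the quotient by \<open>N\<close> unchanged.\<close>
      obtain m where m: "n = Suc m" using n by (cases n) auto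
      have om: "odd m" using ev m by simp
      have "\<not> n mod N = 0" using False by (simp add: dvd_eq_mod_eq_0)
      then have d: "m div N = n div N" using m by (simp add: div_Suc)
      have "prod_of_commutators G (m div 2 + 1 - m div N + 1) (g [^] m \<otimes> g)"
        using prod_of_commutators_mult[OF odd_case[OF om] prod_of_commutators_1[OF ab]] by (simp only: g_def)
      moreover have "m div 2 + 1 - m div N + 1 = n div 2 + 1 - n div N"
      proof -
        have "m div N \<le> m div 2" using N by (intro div_le_mono2) auto
        moreover have "n div 2 = m div 2 + 1" using om m by presburger
        ultimately show ?thesis using d by linarith
      qed
      ultimately show ?thesis using m by (simp add: g_def)
    next
      case True
      then obtain q where q: "n = N * q" by (auto elim: dvdE)
      have evq: "even q" "2 \<le> q" using ev q N n by (auto elim!: evenE)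
      \<comment> \<open>Splitting off a single factor would lower the quotient and cost one
        commutator too many. Instead \<open>N\<close> factors are split off; both \<open>N\<close>
        and \<open>m\<close> are odd.\<close>
      define m where "m = N * (q - 1)"
      have nm: "n = N + m" using q evq by (simp add: m_def right_diff_distrib')
      have om: "odd m" using ev nm N(1) by simp
      have dm: "m div N = q - 1" "n div N = q" "N div N = 1" using N q by (simp_all add: m_def)
      have "prod_of_commutators G ((N div 2 + 1 - N div N) + (m div 2 + 1 - m div N)) (g [^] N \<otimes> g [^] m)"
        by (rule prod_of_commutators_mult[OF odd_case[OF N(1)] odd_case[OF om]])
      moreover have "(N div 2 + 1 - N div N) + (m div 2 + 1 - m div N) = n div 2 + 1 - n div N"
      proof -
        have "m div N \<le> m div 2" using N by (intro div_le_mono2) auto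
        then have "q - 1 \<le> m div 2" using dm by simp
        moreover have "n div 2 = N div 2 + m div 2 + 1" using N(1) om nm by (auto elim!: oddE)
        ultimately show ?thesis using dm evq by simp
      qed
      ultimately show ?thesis using g nm by (simp add: g_def nat_pow_mult)
    qed
  qed
qed

lemma commutator_power_upper:
  assumes ab: "a \<in> carrier G" "b \<in> carrier G" and n: "0 < n"
  shows "prod_of_commutators G (n div 2 + 1) (commutator G a b [^] n)"
proof -
  define x y where "x = inv a" and "y = inv b \<otimes> a \<otimes> b"
  have xy: "x \<in> carrier G" "y \<in> carrier G" "commutator G a b = x \<otimes> y" "y = inv b \<otimes> inv x \<otimes> b"
    using ab by (simp_all add: x_def y_def commutator_def m_assoc)
  \<comment> \<open>No blocks are used, so \<open>q = 0\<close>; the number 3 stands for an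
    arbitrary odd \<open>N \<ge> 3\<close>.\<close>
  have odd_case: "prod_of_commutators G (m div 2 + 1) (commutator G a b [^] m)" if m: "odd m" for m
    using power_product_upper(1)[OF xy(1,2), of 3 0 m "m div 2" b] m xy ab by (auto elim!: oddE)
  show ?thesis
  proof (cases "odd n")
    case True
    then show ?thesis by (rule odd_case)
  next
    case False
    then obtain m where m: "n = Suc m" "odd m" using n by (cases n) auto
    have "prod_of_commutators G (m div 2 + 1 + 1) (commutator G a b [^] m \<otimes> commutator G a b)"
      using prod_of_commutators_mult[OF odd_case[OF m(2)] prod_of_commutators_1[OF ab]] .
    moreover have "m div 2 + 1 + 1 = n div 2 + 1" using m by (auto elim!: oddE)
    ultimately show ?thesis using m by simp
  qed
qed

text \<open>As \<open>a\<close> is its own inverse, conjugation by \<open>a\<close> inverts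
  \<open>r = [a, b]\<close>. Hence the commutator of \<open>a\<close> and \<open>r [^] n\<close> is
  \<open>r [^] n \<otimes> r [^] n\<close>.\<close>

lemma commutator_power_involution:
  fixes n :: nat
  assumes ab: "a \<in> carrier G" "b \<in> carrier G" and a: "a [^] (2::nat) = \<one>"
  shows "prod_of_commutators G 1 (commutator G a b [^] (2 * n))"
proof -
  define r where "r = commutator G a b"
  have aa: "a \<otimes> a = \<one>" using a ab by (simp add: numeral_2_eq_2)
  have ia: "inv a = a" using aa ab by (simp add: inv_equality)
  have aay: "a \<otimes> (a \<otimes> z) = z" if "z \<in> carrier G" for z using aa ab that by (simp flip: m_assoc)
  have r: "r \<in> carrier G" using ab by (simp add: r_def)
  have conj: "inv a \<otimes> r \<otimes> a = inv r"
    using ab by (simp add: r_def commutator_def ia inv_mult_group m_assoc aay)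
  have "inv a \<otimes> r [^] n \<otimes> a = inv (r [^] n)"
  proof (induction n)
    case (Suc n)
    have "inv a \<otimes> r [^] Suc n \<otimes> a = (inv a \<otimes> r [^] n \<otimes> a) \<otimes> (inv a \<otimes> r \<otimes> a)"
      using ab r by (simp add: m_assoc)
    also have "\<dots> = inv (r [^] n) \<otimes> inv r" using Suc conj by simp
    also have "\<dots> = inv (r \<otimes> r [^] n)" using r by (simp add: inv_mult_group)
    also have "r \<otimes> r [^] n = r [^] Suc n" using r nat_pow_Suc2 by simp
    finally show ?case .
  qed (use ab in simp)
  moreover have "commutator G a (r [^] n) = inv a \<otimes> inv (r [^] n) \<otimes> a \<otimes> r [^] n" by (simp add: commutator_def)
  moreover have "inv a \<otimes> inv (r [^] n) \<otimes> a = inv (inv a \<otimes> r [^] n \<otimes> a)"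
    using ab r by (simp add: inv_mult_group m_assoc ia)
  ultimately have "commutator G a (r [^] n) = r [^] n \<otimes> r [^] n" using r by simp
  also have "\<dots> = r [^] (2 * n)" using r by (simp add: nat_pow_mult mult_2)
  finally show ?thesis using prod_of_commutators_1[OF ab(1), of "r [^] n"] r by (simp add: r_def)
qed

end

section \<open>The minimal commutator length\<close>

context free_prod
begin

lemma commutator_power_in_hat:
  assumes ij: "i \<in> J" "j \<in> J" "i \<noteq> j" and ab: "a \<in> A i" "b \<in> A j" "a \<noteq> \<one>" "b \<noteq> \<one>" and n: "0 < n"
  shows "commutator G a b [^] (n::nat) \<in> hatG G J A"
proof -
  have car: "a \<in> carrier G" "b \<in> carrier G" using factor_carrier ij ab by auto
  have "inv a \<noteq> \<one>" "inv b \<noteq> \<one>" using ab(3,4) car by (metis inv_inv inv_one)+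
  moreover have "inv a \<in> A i" "inv b \<in> A j"
    using ij ab subgroup.m_inv_closed[OF factor_subgroup] by auto
  ultimately have u: "cyc_reduced [(i, inv a), (j, inv b), (i, a), (j, b)]" (is "cyc_reduced ?u")
    using ij ab by (simp add: cyc_reduced_def reduced_Cons)
  obtain m where m: "n = Suc m" using n by (cases n) auto
  have "hd (concat (replicate n ?u)) = hd ?u" using m by simp
  moreover have "last (concat (replicate n ?u)) = last ?u" unfolding m by (induction m) auto
  moreover have "concat (replicate n ?u) \<noteq> []" using m by simp
  ultimately have "cyc_reduced (concat (replicate n ?u))"
    using reduced_concat_replicate[OF u, of n] u by (simp add: cyc_reduced_def)
  then have "val (concat (replicate n ?u)) \<in> hatG G J A" by (rule cyc_reduced_in_hat)
  moreover have "val ?u = commutator G a b" using car by (simp add: commutator_def m_assoc)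
  moreover have "in_carrier ?u" using car by simp
  ultimately show ?thesis by (simp only: val_concat_replicate)
qed

text \<open>Cyclically reduced words have infinite order, so an element of finite order is conjugate
  to a single letter.\<close>

lemma torsion_in_factor:
  assumes "x \<in> carrier G" "x \<noteq> \<one>" "0 < m" "x [^] (m::nat) = \<one>"
  obtains i a where "i \<in> J" "a \<in> A i" "a \<noteq> \<one>" "a [^] m = \<one>"
proof -
  obtain y w where w: "y \<in> carrier G" "reduced w" "val w = inv y \<otimes> x \<otimes> y" "length w \<le> 1 \<or> cyc_reduced w"
    using conj_cyc_reduced[OF assms(1)] .
  have pw: "val w [^] m = \<one>" using conj_pow[OF w(1) assms(1)] w(1,3) assms(4) by simp
  then have "length w \<le> 1" using cyc_reduced_pow_ne_one[of w m] assms(3) w(4) by blast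
  moreover have "w \<noteq> []"
  proof
    assume "w = []"
    then have "\<one> = inv y \<otimes> x \<otimes> y" using w(3) by simp
    then have "y \<otimes> \<one> \<otimes> inv y = y \<otimes> (inv y \<otimes> x \<otimes> y) \<otimes> inv y" by simp
    then show False using w(1) assms(1,2) by (simp add: m_assoc)
  qed
  ultimately obtain p where p: "w = [p]" by (cases w) auto
  have "fst p \<in> J" "snd p \<in> A (fst p)" "snd p \<noteq> \<one>" using w(2) p by (auto simp: reduced_Cons)
  moreover have "snd p [^] m = \<one>" using pw p factor_carrier[OF calculation(1,2)] by simp
  ultimately show ?thesis by (rule that)
qed

end

context group
begin

lemma min_order_infinite:
  assumes "min_order G = \<infinity>" "x \<in> carrier G" "x \<noteq> \<one>" "0 < m"
  shows "x [^] (m::nat) \<noteq> \<one>"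
proof
  assume "x [^] m = \<one>"
  then have "ord x dvd m" using assms(2) by (simp add: pow_eq_id)
  then have "ord x \<noteq> 0" using assms(4) by auto
  then have "min_order G \<le> enat (ord x)"
    unfolding min_order_def using assms by (intro Inf_lower) blast
  then show False using assms(1) by simp
qed

lemma min_order_finite:
  assumes "min_order G = enat N"
  shows "\<exists>x\<in>carrier G. x \<noteq> \<one> \<and> x [^] N = \<one>" "2 \<le> N" "N = 2 \<or> odd N"
    and "\<And>x m. x \<in> carrier G \<Longrightarrow> x \<noteq> \<one> \<Longrightarrow> 0 < m \<Longrightarrow> x [^] (m::nat) = \<one> \<Longrightarrow> N \<le> m"
proof -
  define S where "S = {enat (ord x) |x. x \<in> carrier G \<and> x \<noteq> \<one> \<and> ord x \<noteq> 0}"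
  have inf: "Inf S = enat N" using assms by (simp add: min_order_def S_def)
  have "S \<noteq> {}"
  proof
    assume "S = {}"
    then show False using inf by (simp add: Inf_enat_def)
  qed
  then have "enat N \<in> S" unfolding inf[symmetric] by (auto simp: Inf_enat_def intro: LeastI)
  then obtain x where x: "x \<in> carrier G" "x \<noteq> \<one>" "ord x = N" "N \<noteq> 0" by (auto simp: S_def)
  have xN: "x [^] N = \<one>" using x by (metis pow_ord_eq_1)
  then show "\<exists>x\<in>carrier G. x \<noteq> \<one> \<and> x [^] N = \<one>" using x by blast
  have "N \<noteq> 1" using xN x by auto
  then show N2: "2 \<le> N" using x(4) by simp
  show least: "N \<le> m" if y: "y \<in> carrier G" "y \<noteq> \<one>" "0 < m" "y [^] m = \<one>" for y and m :: nat
  proof -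
    have d: "ord y dvd m" using y by (simp add: pow_eq_id)
    then have "ord y \<noteq> 0" using y(3) by auto
    then have "Inf S \<le> enat (ord y)" using y by (intro Inf_lower) (auto simp: S_def)
    then have "N \<le> ord y" by (simp add: inf)
    then show ?thesis using d y(3) by (meson dvd_imp_le le_trans)
  qed
  \<comment> \<open>If \<open>N = 2 * M\<close> with \<open>M > 1\<close>, then
    \<open>x [^] M\<close> would have order 2, below the minimum.\<close>
  show "N = 2 \<or> odd N"
  proof (rule ccontr)
    assume "\<not> ?thesis"
    then obtain M where M: "N = 2 * M" "N \<noteq> 2" by (auto elim: evenE)
    have "x [^] M \<noteq> \<one>" using least[of x M] x M N2 by auto
    moreover have "(x [^] M) [^] (2::nat) = \<one>" using xN x by (simp add: nat_pow_pow M mult.commute)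
    ultimately have "N \<le> 2" using least[of "x [^] M" 2] x by simp
    then show False using N2 M by simp
  qed
qed

end

theorem theorem1:
  fixes G :: "('a, 'b) monoid_scheme" and J :: "'j set" and A :: "'j \<Rightarrow> 'a set" and n :: nat
  assumes "is_free_product G J A"
    and "\<forall>j\<in>J. A j \<noteq> {\<one>\<^bsub>G\<^esub>}"
    and "\<exists>i\<in>J. \<exists>j\<in>J. i \<noteq> j"
    and "n > 0"
  shows "nat (int (n div 2) - int (floor_div_enat n (min_order G)) + 1) \<in> kset G J A n
         \<and> (\<forall>k\<in>kset G J A n. nat (int (n div 2) - int (floor_div_enat n (min_order G)) + 1) \<le> k)"
proof -
  interpret group G using assms(1) by (simp add: is_free_product_def)
  interpret free_prod G J A by unfold_locales (rule assms(1))
  have J: "J \<noteq> {}" using assms(3) by blast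
  have nontrivial: "\<exists>a\<in>A j. a \<noteq> \<one>\<^bsub>G\<^esub>" if "j \<in> J" for j
    using assms(2) that subgroup.one_closed[OF factor_subgroup[OF that]] by blast
  have other: "\<exists>j\<in>J. \<exists>b\<in>A j. j \<noteq> i \<and> b \<noteq> \<one>\<^bsub>G\<^esub>" for i
    using assms(3) nontrivial by metis
  \<comment> \<open>The witness is the \<open>r\<close>-th power of a commutator:
    \<open>r = 2\<close> serves \<open>N = 2\<close>, where even powers are cheap, and
    \<open>r = 1\<close> all other cases.\<close>
  have upper: "k \<in> kset G J A n"
    if "i \<in> J" "j \<in> J" "i \<noteq> j" "a \<in> A i" "b \<in> A j" "a \<noteq> \<one>\<^bsub>G\<^esub>" "b \<noteq> \<one>\<^bsub>G\<^esub>" "0 < r"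
      "prod_of_commutators G k (commutator G a b [^]\<^bsub>G\<^esub> (r * n))" for i j a b k and r :: nat
  proof -
    have car: "a \<in> carrier G" "b \<in> carrier G" using factor_carrier that by auto
    have "(commutator G a b [^]\<^bsub>G\<^esub> r) [^]\<^bsub>G\<^esub> n = commutator G a b [^]\<^bsub>G\<^esub> (r * n)"
      using car by (simp add: nat_pow_pow)
    then show ?thesis
      unfolding kset_def using that commutator_power_in_hat[of i j a b "r * n"] assms(4) car
      by (intro CollectI bexI[of _ "commutator G a b [^]\<^bsub>G\<^esub> r"]) simp_all
  qed
  show ?thesis
  proof (cases "min_order G")
    case infinity
    then have F: "nat (int (n div 2) - int (floor_div_enat n (min_order G)) + 1) = n div 2 + 1"
      by (simp add: floor_div_enat_def nat_add_distrib)
    obtain i a where i: "i \<in> J" "a \<in> A i" "a \<noteq> \<one>\<^bsub>G\<^esub>" using J nontrivial by blast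
    obtain j b where j: "j \<in> J" "b \<in> A j" "j \<noteq> i" "b \<noteq> \<one>\<^bsub>G\<^esub>" using other[of i] by blast
    have "n div 2 + 1 \<in> kset G J A n"
      using upper[of i j a b 1] commutator_power_upper[of a b n] i j assms(4) factor_carrier by simp
    moreover have "n div 2 + 1 \<le> k" if kset: "k \<in> kset G J A n" for k
    proof -
      obtain g where g: "g \<in> carrier G" "g [^]\<^bsub>G\<^esub> n \<in> hatG G J A" "prod_of_commutators G k (g [^]\<^bsub>G\<^esub> n)"
        using kset by (auto simp: kset_def)
      \<comment> \<open>The number \<open>2 * n + 3\<close> stands for infinity: it is at least 3
        and makes the quotient 0.\<close>
      have "n + 1 \<le> 2 * k + 2 * (n div (2 * n + 3))"
        by (rule commutator_length_lower_bound[OF J g(1,2) assms(4) _ g(3)])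
          (use min_order_infinite[OF infinity] in auto)
      then show ?thesis by simp
    qed
    ultimately show ?thesis using F by simp
  next
    case (enat N)
    note N = min_order_finite[OF enat]
    have F: "nat (int (n div 2) - int (floor_div_enat n (min_order G)) + 1) = n div 2 + 1 - n div N"
      by (simp add: enat floor_div_enat_def)
    obtain x where "x \<in> carrier G" "x \<noteq> \<one>\<^bsub>G\<^esub>" "x [^]\<^bsub>G\<^esub> N = \<one>\<^bsub>G\<^esub>" using N(1) by blast
    then obtain i a where i: "i \<in> J" "a \<in> A i" "a \<noteq> \<one>\<^bsub>G\<^esub>" "a [^]\<^bsub>G\<^esub> N = \<one>\<^bsub>G\<^esub>"
      using torsion_in_factor[of x N] N(2) by auto
    obtain j b where j: "j \<in> J" "b \<in> A j" "j \<noteq> i" "b \<noteq> \<one>\<^bsub>G\<^esub>" using other[of i] by blast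
    have car: "a \<in> carrier G" "b \<in> carrier G" using i j factor_carrier by auto
    show ?thesis
    proof (cases "N = 2")
      case True
      have "1 \<in> kset G J A n"
        using upper[of i j a b 2 1] commutator_power_involution[OF car, of n] i j True by simp
      \<comment> \<open>For \<open>N = 2\<close> the claimed value is 1, and 0 commutators give only
        the identity, which lies in every factor.\<close>
      moreover have "1 \<le> k" if "k \<in> kset G J A n" for k
      proof (rule ccontr)
        assume "\<not> 1 \<le> k"
        then have "k = 0" by simp
        then have "\<one>\<^bsub>G\<^esub> \<in> hatG G J A" using that by (auto simp: kset_def prod_of_commutators_def)
        then show False using i(1) subgroup.one_closed[OF factor_subgroup[OF i(1)]]
          by (auto simp: hatG_def) (metis inv_one one_closed r_one)
      qed
      ultimately show ?thesis using F True by simp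
    next
      case False
      then have N3: "odd N" "3 \<le> N" using N(2,3) by auto
      have "n div 2 + 1 - n div N \<in> kset G J A n"
        using upper[of i j a b 1] commutator_power_odd_order[OF car N3 i(4) assms(4)] i j by simp
      moreover have "n div 2 + 1 - n div N \<le> k" if kset: "k \<in> kset G J A n" for k
      proof -
        obtain g where g: "g \<in> carrier G" "g [^]\<^bsub>G\<^esub> n \<in> hatG G J A" "prod_of_commutators G k (g [^]\<^bsub>G\<^esub> n)"
          using kset by (auto simp: kset_def)
        have "n + 1 \<le> 2 * k + 2 * (n div N)"
          by (rule commutator_length_lower_bound[OF J g(1,2) assms(4) N3(2) g(3) N(4)])
        then show ?thesis by linarith
      qed
      ultimately show ?thesis using F by simp
    qed
  qed
qed

end
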